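(* The characteristic distribution of the Banach Lie-Poisson space $\tilde{\mathfrak u}_2=\mathfrak u_2\oplus\mathbb R$ is integrable.
   Context: $\mathcal H=\mathcal H_+\oplus\mathcal H_-$ is a separable complex Hilbert space written as an orthogonal sum of two closed infinite-dimensional subspaces, $p_\pm$ are the orthogonal projections onto $\mathcal H_\pm$, and $d=i(p_+-p_-)$. $\mathfrak S_2(\mathcal H)$ is the ideal of Hilbert-Schmidt operators. $\mathfrak u_2=\{a\in\mathfrak S_2(\mathcal H)\mid a^*=-a\}$ is the (real Hilbert) Lie algebra of $U_2=\{u \text{ unitary on }\mathcal H\mid u-\mathrm{id}\in\mathfrak S_2(\mathcal H)\}$. $\tilde{\mathfrak u}_2=\mathfrak u_2\oplus\mathbb R$ is the central extension of $\mathfrak u_2$ with bracket $[(A,a),(B,b)]_d=([A,B],-s(A,B))$, where $s(A,B)=\mathrm{Tr}(A[d,B])$. The pairing $\langle(\mu,\gamma),(A,a)\rangle_d=\langle\mu,A\rangle+\gamma a$, $\langle\mu,A\rangle=\mathrm{Tr}(\mu A)$, identifies $\tilde{\mathfrak u}_2$ with its own dual, and with this identification $\tilde{\mathfrak u}_2$ is a Banach Lie-Poisson space with Poisson bracket, for $f,g\in C^\infty(\tilde{\mathfrak u}_2)$, $$\{f,g\}_d(\mu,\gamma)=\langle\mu,[D_\mu f,D_\mu g]\rangle-\gamma\, s(D_\mu f,D_\mu g),$$ where $D_\mu f\in\mathfrak u_2$ denotes the partial Fréchet derivative of $f$ with respect to $\mu$ at $(\mu,\gamma)$. The Hamiltonian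 vector field $X_h$ of $h\in C^\infty(\tilde{\mathfrak u}_2)$ is determined by $Df(X_h)=\{f,h\}_d$ for all smooth $f$. The characteristic distribution assigns to each point $(\mu,\gamma)$ the subspace $P(\mu,\gamma)=\{X_h(\mu,\gamma)\mid h\in C^\infty(\tilde{\mathfrak u}_2)\}$. It is integrable if through every point there passes an integral manifold, i.e. there are a smooth Banach manifold $L$ and an injective smooth map $\iota:L\to\tilde{\mathfrak u}_2$ with injective tangent maps, whose image contains the point, such that $T_x\iota(T_xL)=P(\iota(x))$ for all $x\in L$. *)

theory Defs
  imports "HOL-Analysis.Analysis"
begin

section \<open>Complex Hilbert spaces\<close>

text \<open>The inner product is antilinear in the first argument. The real inner product inherited
  from \<^class>\<open>real_inner\<close> is its real part, so both define the same norm.\<close>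

class complex_hilbert = real_inner + complete_space +
  fixes scaleC :: "complex \<Rightarrow> 'a \<Rightarrow> 'a"  (infixr "*\<^sub>C" 75)
    and cinner :: "'a \<Rightarrow> 'a \<Rightarrow> complex"
  assumes scaleC_add_right: "c *\<^sub>C (x + y) = c *\<^sub>C x + c *\<^sub>C y"
    and scaleC_add_left: "(b + c) *\<^sub>C x = b *\<^sub>C x + c *\<^sub>C x"
    and scaleC_scaleC: "b *\<^sub>C c *\<^sub>C x = (b * c) *\<^sub>C x"
    and scaleR_scaleC: "r *\<^sub>R x = complex_of_real r *\<^sub>C x"
    and cinner_commute: "cinner x y = cnj (cinner y x)"
    and cinner_add_right: "cinner x (y + z) = cinner x y + cinner x z"
    and cinner_scaleC_right: "cinner x (c *\<^sub>C y) = c * cinner x y"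
    and Re_cinner: "Re (cinner x y) = inner x y"

interpretation complex_space: vector_space "scaleC :: complex \<Rightarrow> 'a \<Rightarrow> 'a::complex_hilbert"
proof
  show "(1::complex) *\<^sub>C x = x" for x :: 'a
    using scaleR_scaleC[of 1 x] by simp
qed (simp_all add: scaleC_add_right scaleC_add_left scaleC_scaleC)

lemma cinner_add_left: "cinner (x + y) z = cinner x z + cinner y z"
  by (metis cinner_add_right cinner_commute complex_cnj_add)

lemma cinner_scaleC_left: "cinner (c *\<^sub>C x) y = cnj c * cinner x y"
  by (metis cinner_commute cinner_scaleC_right complex_cnj_mult)

lemma cinner_zero_right [simp]: "cinner x 0 = 0"
  by (metis add_cancel_right_right cinner_add_right)

lemma cinner_zero_left [simp]: "cinner 0 x = 0"
  by (metis cinner_commute cinner_zero_right complex_cnj_zero)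

lemma cinner_minus_right: "cinner x (- y) = - cinner x y"
  by (metis add.right_inverse add_eq_0_iff cinner_add_right cinner_zero_right)

lemma cinner_minus_left: "cinner (- x) y = - cinner x y"
  by (metis add.right_inverse add_eq_0_iff cinner_add_left cinner_zero_left)

lemma cinner_diff_right: "cinner x (y - z) = cinner x y - cinner x z"
  by (metis cinner_add_right cinner_minus_right diff_conv_add_uminus)

lemma cinner_diff_left: "cinner (x - y) z = cinner x z - cinner y z"
  by (metis cinner_add_left cinner_minus_left diff_conv_add_uminus)

lemma cinner_scaleR_right: "cinner x (r *\<^sub>R y) = of_real r * cinner x y"
  by (simp add: scaleR_scaleC cinner_scaleC_right)

lemma cinner_scaleR_left: "cinner (r *\<^sub>R x) y = of_real r * cinner x y"
  by (simp add: scaleR_scaleC cinner_scaleC_left)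

lemma cinner_self: "cinner x x = of_real ((norm x)\<^sup>2)"
proof (rule complex_eqI)
  have "Im (cinner x x) = - Im (cinner x x)"
    by (metis cinner_commute cnj.simps(2))
  then show "Im (cinner x x) = Im (of_real ((norm x)\<^sup>2))" by simp
qed (simp add: Re_cinner power2_norm_eq_inner)

text \<open>An orthonormal basis is a maximal orthonormal set.\<close>

definition is_onb :: "'h::complex_hilbert set \<Rightarrow> bool" where
  "is_onb B \<longleftrightarrow> (\<forall>e\<in>B. \<forall>f\<in>B. cinner e f = (if e = f then 1 else 0))
     \<and> (\<forall>x. (\<forall>e\<in>B. cinner e x = 0) \<longrightarrow> x = 0)"

lemma is_onb_exists: "\<exists>B :: 'h::complex_hilbert set. is_onb B"
proof -
  define \<A> :: "'h set set" where
    "\<A> = {B. \<forall>e\<in>B. \<forall>f\<in>B. cinner e f = (if e = f then 1 else 0)}"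
  have "\<exists>M\<in>\<A>. \<forall>X\<in>\<A>. M \<subseteq> X \<longrightarrow> X = M"
  proof (rule subset_Zorn')
    fix C assume C: "subset.chain \<A> C"
    show "\<Union>C \<in> \<A>"
      unfolding \<A>_def
    proof (clarify)
      fix e f X Y assume "e \<in> X" "X \<in> C" "f \<in> Y" "Y \<in> C"
      moreover from this have "X \<subseteq> Y \<or> Y \<subseteq> X" "X \<in> \<A>" "Y \<in> \<A>"
        using C by (auto simp: subset_chain_def)
      ultimately show "cinner e f = (if e = f then 1 else 0)"
        unfolding \<A>_def by blast
    qed
  qed
  then obtain M where M: "M \<in> \<A>" "\<And>X. X \<in> \<A> \<Longrightarrow> M \<subseteq> X \<Longrightarrow> X = M" by blast
  have "x = 0" if x: "\<forall>e\<in>M. cinner e x = 0" for x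
  proof (rule ccontr)
    assume "x \<noteq> 0"
    define u where "u = (1 / norm x) *\<^sub>R x"
    have uu: "cinner u u = 1"
      using \<open>x \<noteq> 0\<close> by (simp add: cinner_self u_def)
    have Mu: "cinner e u = 0" "cinner u e = 0" if "e \<in> M" for e
      using x that cinner_commute[of u e] by (simp_all add: u_def cinner_scaleR_right)
    have "u \<notin> M" using uu Mu by force
    have "insert u M \<in> \<A>"
      using M(1) uu Mu \<open>u \<notin> M\<close> unfolding \<A>_def by auto
    with M(2)[of "insert u M"] \<open>u \<notin> M\<close> show False by blast
  qed
  with M(1) have "is_onb M" by (simp add: is_onb_def \<A>_def)
  then show ?thesis ..
qed

text \<open>The Hilbert-Schmidt property, the Hilbert-Schmidt norm and the trace of a trace class
  operator do not depend on the orthonormal basis used to compute them; we fix one.\<close>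

definition onb :: "'h::complex_hilbert set" where
  "onb = (SOME B. is_onb B)"

lemma is_onb_onb: "is_onb onb"
  unfolding onb_def by (rule someI_ex[OF is_onb_exists])

definition hilbert_schmidt :: "('h::complex_hilbert \<Rightarrow> 'h) \<Rightarrow> bool" where
  "hilbert_schmidt f \<longleftrightarrow> (\<lambda>e. (norm (f e))\<^sup>2) summable_on onb"

definition op_trace :: "('h::complex_hilbert \<Rightarrow> 'h) \<Rightarrow> complex" where
  "op_trace f = (\<Sum>\<^sub>\<infinity>e\<in>onb. cinner e (f e))"

lemma hilbert_schmidt_dominated:
  assumes "hilbert_schmidt f" "\<And>e. norm (g e) \<le> C * norm (f e)"
  shows "hilbert_schmidt g"
  unfolding hilbert_schmidt_def
proof (rule summable_on_comparison_test)
  show "(\<lambda>e. C\<^sup>2 * (norm (f e))\<^sup>2) summable_on onb"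
    using assms(1) unfolding hilbert_schmidt_def by (rule summable_on_cmult_right)
  show "(norm (g e))\<^sup>2 \<le> C\<^sup>2 * (norm (f e))\<^sup>2" for e
    using power_mono[OF assms(2), of e 2] by (simp add: power_mult_distrib)
qed simp

lemma hilbert_schmidt_add:
  assumes "hilbert_schmidt f" "hilbert_schmidt g"
  shows "hilbert_schmidt (\<lambda>x. f x + g x)"
  unfolding hilbert_schmidt_def
proof (rule summable_on_comparison_test)
  show "(\<lambda>e. 2 * (norm (f e))\<^sup>2 + 2 * (norm (g e))\<^sup>2) summable_on onb"
    using assms unfolding hilbert_schmidt_def
    by (intro summable_on_add summable_on_cmult_right)
  show "(norm (f e + g e))\<^sup>2 \<le> 2 * (norm (f e))\<^sup>2 + 2 * (norm (g e))\<^sup>2" for e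
  proof -
    have "(norm (f e + g e))\<^sup>2 \<le> (norm (f e) + norm (g e))\<^sup>2"
      by (simp add: norm_triangle_ineq power_mono)
    also have "\<dots> \<le> 2 * (norm (f e))\<^sup>2 + 2 * (norm (g e))\<^sup>2"
      using sum_squares_bound[of "norm (f e)" "norm (g e)"]
      by (simp add: power2_sum)
    finally show ?thesis .
  qed
qed simp

section \<open>The Lie algebra of skew-adjoint Hilbert-Schmidt operators\<close>

typedef (overloaded) 'h u2 =
  "{a :: 'h::complex_hilbert \<Rightarrow>\<^sub>L 'h. (\<forall>c x. a (c *\<^sub>C x) = c *\<^sub>C a x)
      \<and> hilbert_schmidt a \<and> (\<forall>x y. cinner (a x) y = cinner x (- a y))}"
  by (rule exI[of _ 0]) (simp add: hilbert_schmidt_def)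

setup_lifting type_definition_u2

lift_definition u2_apply :: "'h::complex_hilbert u2 \<Rightarrow> 'h \<Rightarrow> 'h" is blinfun_apply .

lemma u2_hs: "hilbert_schmidt (u2_apply A)"
  by transfer simp

lemma u2_skew: "cinner (u2_apply A x) y = cinner x (- u2_apply A y)"
  by transfer simp

lemma u2_eq_iff: "A = B \<longleftrightarrow> (\<forall>x. u2_apply A x = u2_apply B x)"
  by transfer (auto intro: blinfun_eqI)

instantiation u2 :: (complex_hilbert) real_vector
begin

lift_definition zero_u2 :: "'a u2" is 0
  by (simp add: hilbert_schmidt_def)

lift_definition plus_u2 :: "'a u2 \<Rightarrow> 'a u2 \<Rightarrow> 'a u2" is "(+)"
  by (auto simp: plus_blinfun.rep_eq hilbert_schmidt_add scaleC_add_right cinner_add_left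
      cinner_diff_right cinner_minus_right)

lift_definition uminus_u2 :: "'a u2 \<Rightarrow> 'a u2" is uminus
  by (auto simp: uminus_blinfun.rep_eq hilbert_schmidt_def complex_space.scale_minus_right
      cinner_minus_left cinner_minus_right)

lift_definition scaleR_u2 :: "real \<Rightarrow> 'a u2 \<Rightarrow> 'a u2" is scaleR
  by (auto simp: scaleR_blinfun.rep_eq cinner_scaleR_left cinner_scaleR_right cinner_minus_right
      intro: hilbert_schmidt_dominated[OF _ eq_refl[OF norm_scaleR]])
    (simp add: scaleR_scaleC complex_space.scale_left_commute)

definition minus_u2 :: "'a u2 \<Rightarrow> 'a u2 \<Rightarrow> 'a u2" where
  "minus_u2 A B = A + - B"

lemma u2_apply_zero [simp]: "u2_apply 0 x = 0"
  by transfer simp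

lemma u2_apply_add [simp]: "u2_apply (A + B) x = u2_apply A x + u2_apply B x"
  by transfer (simp add: plus_blinfun.rep_eq)

lemma u2_apply_minus [simp]: "u2_apply (- A) x = - u2_apply A x"
  by transfer (simp add: uminus_blinfun.rep_eq)

lemma u2_apply_diff [simp]: "u2_apply (A - B) x = u2_apply A x - u2_apply B x"
  by (simp add: minus_u2_def)

lemma u2_apply_scaleR [simp]: "u2_apply (r *\<^sub>R A) x = r *\<^sub>R u2_apply A x"
  by transfer (simp add: scaleR_blinfun.rep_eq)

instance
  by standard (simp_all add: u2_eq_iff algebra_simps)

end

lemma summable_inner_u2:
  "(\<lambda>e. inner (u2_apply A e) (u2_apply B e)) summable_on onb"
proof (rule abs_summable_summable, rule summable_on_comparison_test)
  show "(\<lambda>e. (norm (u2_apply A e))\<^sup>2 + (norm (u2_apply B e))\<^sup>2) summable_on onb"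
    using u2_hs[of A] u2_hs[of B] unfolding hilbert_schmidt_def by (rule summable_on_add)
  show "norm (inner (u2_apply A e) (u2_apply B e))
      \<le> (norm (u2_apply A e))\<^sup>2 + (norm (u2_apply B e))\<^sup>2" for e
  proof -
    have "\<bar>inner (u2_apply A e) (u2_apply B e)\<bar> \<le> norm (u2_apply A e) * norm (u2_apply B e)"
      by (rule Cauchy_Schwarz_ineq2)
    also have "\<dots> \<le> (norm (u2_apply A e))\<^sup>2 + (norm (u2_apply B e))\<^sup>2"
      using sum_squares_bound[of "norm (u2_apply A e)" "norm (u2_apply B e)"]
        mult_nonneg_nonneg[OF norm_ge_zero[of "u2_apply A e"] norm_ge_zero[of "u2_apply B e"]]
      by linarith
    finally show ?thesis by simp
  qed
qed simp

text \<open>The norm is the Hilbert-Schmidt norm.\<close>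

instantiation u2 :: (complex_hilbert) real_inner
begin

definition inner_u2 :: "'a u2 \<Rightarrow> 'a u2 \<Rightarrow> real" where
  "inner_u2 A B = (\<Sum>\<^sub>\<infinity>e\<in>onb. inner (u2_apply A e) (u2_apply B e))"

definition norm_u2 :: "'a u2 \<Rightarrow> real" where
  "norm_u2 A = sqrt (\<Sum>\<^sub>\<infinity>e\<in>onb. (norm (u2_apply A e))\<^sup>2)"

definition dist_u2 :: "'a u2 \<Rightarrow> 'a u2 \<Rightarrow> real" where
  "dist_u2 A B = norm (A - B)"

definition sgn_u2 :: "'a u2 \<Rightarrow> 'a u2" where
  "sgn_u2 A = A /\<^sub>R norm A"

definition uniformity_u2 :: "('a u2 \<times> 'a u2) filter" where
  "uniformity_u2 = (INF e\<in>{0<..}. principal {(A, B). dist A B < e})"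

definition open_u2 :: "'a u2 set \<Rightarrow> bool" where
  "open_u2 U \<longleftrightarrow> (\<forall>x\<in>U. \<forall>\<^sub>F (x', y) in uniformity. x' = x \<longrightarrow> y \<in> U)"

instance
proof
  fix A B C :: "'a u2" and r :: real
  show "inner A B = inner B A"
    by (simp add: inner_u2_def inner_commute)
  show "inner (A + B) C = inner A C + inner B C"
    by (simp add: inner_u2_def inner_add_left infsum_add summable_inner_u2)
  show "inner (r *\<^sub>R A) B = r * inner A B"
    by (simp add: inner_u2_def infsum_cmult_right summable_inner_u2)
  show "0 \<le> inner A A"
    by (simp add: inner_u2_def infsum_nonneg)
  show "inner A A = 0 \<longleftrightarrow> A = 0"
  proof
    assume 0: "inner A A = 0"
    have e: "u2_apply A e = 0" if "e \<in> onb" for e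
      using nonneg_infsum_le_0D[OF _ summable_inner_u2[of A A] _ that] 0
      by (simp add: inner_u2_def)
    have "u2_apply A x = 0" for x
    proof -
      have "\<forall>e\<in>onb. cinner e (u2_apply A x) = 0"
      proof
        fix e :: 'a assume "e \<in> onb"
        with u2_skew[of A e x] e show "cinner e (u2_apply A x) = 0"
          by (simp add: cinner_minus_right)
      qed
      with is_onb_onb show ?thesis by (auto simp: is_onb_def)
    qed
    then show "A = 0" by (simp add: u2_eq_iff)
  qed (simp add: inner_u2_def)
  show "norm A = sqrt (inner A A)"
    by (simp add: norm_u2_def inner_u2_def power2_norm_eq_inner)
qed (simp_all add: dist_u2_def sgn_u2_def uniformity_u2_def open_u2_def)

end

lift_definition u2_commutator :: "'h::complex_hilbert u2 \<Rightarrow> 'h u2 \<Rightarrow> 'h u2"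
  is "\<lambda>a b. (a o\<^sub>L b) - (b o\<^sub>L a)"
proof -
  fix a b :: "'h \<Rightarrow>\<^sub>L 'h"
  assume ab:
    "(\<forall>c x. a (c *\<^sub>C x) = c *\<^sub>C a x) \<and> hilbert_schmidt a \<and> (\<forall>x y. cinner (a x) y = cinner x (- a y))"
    "(\<forall>c x. b (c *\<^sub>C x) = c *\<^sub>C b x) \<and> hilbert_schmidt b \<and> (\<forall>x y. cinner (b x) y = cinner x (- b y))"
  have "hilbert_schmidt (\<lambda>x. a (b x) + - b (a x))"
  proof (rule hilbert_schmidt_add)
    show "hilbert_schmidt (\<lambda>x. a (b x))"
      using ab norm_blinfun[of a] by (blast intro: hilbert_schmidt_dominated)
    have "norm (- b (a x)) \<le> norm b * norm (a x)" for x
      using norm_blinfun[of b] by simp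
    then show "hilbert_schmidt (\<lambda>x. - b (a x))"
      using ab by (blast intro: hilbert_schmidt_dominated)
  qed
  moreover have "blinfun_apply ((a o\<^sub>L b) - (b o\<^sub>L a)) = (\<lambda>x. a (b x) + - b (a x))"
    by (simp add: fun_eq_iff blinfun.diff_left)
  moreover have "cinner (a x) y = - cinner x (a y)" "cinner (b x) y = - cinner x (b y)" for x y
    using ab by (simp_all add: cinner_minus_right)
  ultimately show "(\<forall>c x. ((a o\<^sub>L b) - (b o\<^sub>L a)) (c *\<^sub>C x) = c *\<^sub>C ((a o\<^sub>L b) - (b o\<^sub>L a)) x)
      \<and> hilbert_schmidt ((a o\<^sub>L b) - (b o\<^sub>L a))
      \<and> (\<forall>x y. cinner (((a o\<^sub>L b) - (b o\<^sub>L a)) x) y = cinner x (- ((a o\<^sub>L b) - (b o\<^sub>L a)) y))"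
    using ab
    by (simp add: blinfun.diff_left complex_space.scale_right_diff_distrib
        cinner_diff_left cinner_diff_right)
qed

lemma u2_commutator_apply:
  "u2_apply (u2_commutator A B) x = u2_apply A (u2_apply B x) - u2_apply B (u2_apply A x)"
  by transfer (simp add: blinfun.diff_left)

section \<open>Smooth maps and Banach manifolds\<close>

text \<open>The model space of a manifold may be an arbitrary Banach space, but a HOL formula cannot
  quantify over types. A normed space is therefore given by a linear subspace E of a type
  together with a norm n on E, which need not be related to the norm of the type. Values of n
  outside E are irrelevant.\<close>

definition banach_on :: "'e::real_vector set \<Rightarrow> ('e \<Rightarrow> real) \<Rightarrow> bool" where
  "banach_on E n \<longleftrightarrow> subspace E
     \<and> (\<forall>x\<in>E. n x \<ge> 0 \<and> (n x = 0 \<longleftrightarrow> x = 0))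
     \<and> (\<forall>x\<in>E. \<forall>y\<in>E. n (x + y) \<le> n x + n y)
     \<and> (\<forall>r. \<forall>x\<in>E. n (r *\<^sub>R x) = \<bar>r\<bar> * n x)
     \<and> (\<forall>X::nat \<Rightarrow> 'e. range X \<subseteq> E \<and> (\<forall>\<epsilon>>0. \<exists>N. \<forall>i\<ge>N. \<forall>j\<ge>N. n (X i - X j) < \<epsilon>)
          \<longrightarrow> (\<exists>x\<in>E. (\<lambda>i. n (X i - x)) \<longlonglongrightarrow> 0))"

definition open_on :: "'e::real_vector set \<Rightarrow> ('e \<Rightarrow> real) \<Rightarrow> 'e set \<Rightarrow> bool" where
  "open_on E n U \<longleftrightarrow> U \<subseteq> E \<and> (\<forall>x\<in>U. \<exists>r>0. \<forall>y\<in>E. n (y - x) < r \<longrightarrow> y \<in> U)"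

text \<open>Bounded k-linear maps, acting on lists of length k.\<close>

definition bounded_multilinear_on ::
  "'e::real_vector set \<Rightarrow> ('e \<Rightarrow> real) \<Rightarrow> 'f::real_vector set \<Rightarrow> ('f \<Rightarrow> real)
     \<Rightarrow> nat \<Rightarrow> ('e list \<Rightarrow> 'f) \<Rightarrow> bool" where
  "bounded_multilinear_on E n F m k M \<longleftrightarrow>
     (\<forall>vs\<in>lists E. length vs = k \<longrightarrow> M vs \<in> F)
     \<and> (\<forall>vs\<in>lists E. \<forall>i<k. \<forall>v\<in>E. \<forall>w\<in>E. \<forall>r. length vs = k \<longrightarrow>
          M (vs[i := v + w]) = M (vs[i := v]) + M (vs[i := w])
          \<and> M (vs[i := r *\<^sub>R v]) = r *\<^sub>R M (vs[i := v]))
     \<and> (\<exists>C. \<forall>vs\<in>lists E. length vs = k \<longrightarrow> m (M vs) \<le> C * prod_list (map n vs))"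

text \<open>A map is smooth if it has Frechet derivatives of all orders. The iterated derivative of
  order k at x is the bounded k-linear map \<open>D k x\<close>, and \<open>D (Suc k)\<close> is the Frechet derivative of
  \<open>D k\<close> with respect to the operator norm of k-linear maps, the direction of differentiation
  being the first argument.\<close>

definition smooth_map_on ::
  "'e::real_vector set \<Rightarrow> ('e \<Rightarrow> real) \<Rightarrow> 'f::real_vector set \<Rightarrow> ('f \<Rightarrow> real)
     \<Rightarrow> 'e set \<Rightarrow> ('e \<Rightarrow> 'f) \<Rightarrow> bool" where
  "smooth_map_on E n F m U f \<longleftrightarrow> (\<exists>D :: nat \<Rightarrow> 'e \<Rightarrow> 'e list \<Rightarrow> 'f.
     (\<forall>x\<in>U. D 0 x [] = f x)
     \<and> (\<forall>k. \<forall>x\<in>U. bounded_multilinear_on E n F m k (D k x))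
     \<and> (\<forall>k. \<forall>x\<in>U. \<forall>\<epsilon>>0. \<exists>\<delta>>0. \<forall>h\<in>E. n h < \<delta> \<and> x + h \<in> U \<longrightarrow>
          (\<forall>vs\<in>lists E. length vs = k \<longrightarrow>
            m (D k (x + h) vs - D k x vs - D (Suc k) x (h # vs))
              \<le> \<epsilon> * n h * prod_list (map n vs))))"

definition has_frechet_derivative_on ::
  "'e::real_vector set \<Rightarrow> ('e \<Rightarrow> real) \<Rightarrow> 'f::real_vector set \<Rightarrow> ('f \<Rightarrow> real)
     \<Rightarrow> 'e set \<Rightarrow> ('e \<Rightarrow> 'f) \<Rightarrow> 'e \<Rightarrow> ('e \<Rightarrow> 'f) \<Rightarrow> bool" where
  "has_frechet_derivative_on E n F m U f x T \<longleftrightarrow>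
     (\<forall>v\<in>E. T v \<in> F)
     \<and> (\<forall>v\<in>E. \<forall>w\<in>E. \<forall>r. T (v + w) = T v + T w \<and> T (r *\<^sub>R v) = r *\<^sub>R T v)
     \<and> (\<exists>C. \<forall>v\<in>E. m (T v) \<le> C * n v)
     \<and> (\<forall>\<epsilon>>0. \<exists>\<delta>>0. \<forall>h\<in>E. n h < \<delta> \<and> x + h \<in> U \<longrightarrow>
          m (f (x + h) - f x - T h) \<le> \<epsilon> * n h)"

abbreviation smooth :: "('a::real_normed_vector \<Rightarrow> 'b::real_normed_vector) \<Rightarrow> bool" where
  "smooth f \<equiv> smooth_map_on UNIV norm UNIV norm UNIV f"

lemma has_frechet_derivative_on_UNIV:
  fixes f :: "'a::real_normed_vector \<Rightarrow> 'b::real_normed_vector"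
  shows "has_frechet_derivative_on UNIV norm UNIV norm UNIV f x T \<longleftrightarrow> (f has_derivative T) (at x)"
proof -
  have *: "norm (y - x) < \<delta> \<longrightarrow> norm (f y - f x - T (y - x)) \<le> \<epsilon> * norm (y - x)"
    if "\<And>h. norm h < \<delta> \<longrightarrow> norm (f (x + h) - f x - T h) \<le> \<epsilon> * norm h" for \<epsilon> \<delta> y
    using that[of "y - x"] by simp
  have **: "norm h < \<delta> \<longrightarrow> norm (f (x + h) - f x - T h) \<le> \<epsilon> * norm h"
    if "\<And>y. norm (y - x) < \<delta> \<longrightarrow> norm (f y - f x - T (y - x)) \<le> \<epsilon> * norm (y - x)" for \<epsilon> \<delta> h
    using that[of "x + h"] by simp
  have "(\<forall>\<epsilon>>0. \<exists>\<delta>>0. \<forall>h. norm h < \<delta> \<longrightarrow> norm (f (x + h) - f x - T h) \<le> \<epsilon> * norm h)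
    \<longleftrightarrow> (\<forall>\<epsilon>>0. \<exists>\<delta>>0. \<forall>y. norm (y - x) < \<delta> \<longrightarrow> norm (f y - f x - T (y - x)) \<le> \<epsilon> * norm (y - x))"
    by (meson * **)
  moreover have "bounded_linear T \<longleftrightarrow> (\<forall>v w r. T (v + w) = T v + T w \<and> T (r *\<^sub>R v) = r *\<^sub>R T v)
      \<and> (\<exists>C. \<forall>v. norm (T v) \<le> C * norm v)"
    by (auto simp: bounded_linear_def bounded_linear_axioms_def linear_iff mult.commute)
  ultimately show ?thesis
    by (simp add: has_frechet_derivative_on_def has_derivative_at_alt)
qed

lemma smooth_differentiable:
  assumes "smooth f"
  shows "f differentiable (at x)"
proof -
  obtain D where D: "\<And>x. D 0 x [] = f x"
    "\<And>k x. bounded_multilinear_on UNIV norm UNIV norm k (D k x)"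
    "\<And>k x \<epsilon>. \<epsilon> > 0 \<Longrightarrow> \<exists>\<delta>>0. \<forall>h. norm h < \<delta> \<longrightarrow> (\<forall>vs. length vs = k \<longrightarrow>
      norm (D k (x + h) vs - D k x vs - D (Suc k) x (h # vs)) \<le> \<epsilon> * norm h * prod_list (map norm vs))"
    using assms by (auto simp: smooth_map_on_def)
  have "has_frechet_derivative_on UNIV norm UNIV norm UNIV f x (\<lambda>h. D 1 x [h])"
    unfolding has_frechet_derivative_on_def
  proof (intro conjI ballI allI impI)
    fix v w r
    show "D 1 x [v + w] = D 1 x [v] + D 1 x [w]" "D 1 x [r *\<^sub>R v] = r *\<^sub>R D 1 x [v]"
      using D(2)[of 1 x] unfolding bounded_multilinear_on_def
      by (auto dest!: spec[of _ "[0]"])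
  next
    obtain C where "\<And>vs. length vs = 1 \<Longrightarrow> norm (D 1 x vs) \<le> C * prod_list (map norm vs)"
      using D(2)[of 1 x] unfolding bounded_multilinear_on_def by auto
    from this[of "[_]"] show "\<exists>C. \<forall>v\<in>UNIV. norm (D 1 x [v]) \<le> C * norm v" by auto
  next
    fix \<epsilon> :: real assume "\<epsilon> > 0"
    from D(3)[OF this, where x = x and k = 0] D(1)
    show "\<exists>\<delta>>0. \<forall>h\<in>UNIV. norm h < \<delta> \<and> x + h \<in> UNIV \<longrightarrow>
        norm (f (x + h) - f x - D 1 x [h]) \<le> \<epsilon> * norm h" by auto
  qed simp
  then show ?thesis
    unfolding has_frechet_derivative_on_UNIV differentiable_def by blast
qed

record ('p, 'e) chart =
  cdom :: "'p set"
  coord :: "'p \<Rightarrow> 'e"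
  model :: "'e set"
  mnorm :: "'e \<Rightarrow> real"

definition chart_inv :: "('p, 'e) chart \<Rightarrow> 'e \<Rightarrow> 'p" where
  "chart_inv c = inv_into (cdom c) (coord c)"

text \<open>The topology of the manifold L is the one for which all charts are homeomorphisms onto
  open sets of their models. It is automatically Hausdorff if L admits a continuous injection
  into a normed space.\<close>

definition banach_atlas :: "'p set \<Rightarrow> ('p, 'e::real_vector) chart set \<Rightarrow> bool" where
  "banach_atlas L \<A> \<longleftrightarrow> \<Union>(cdom ` \<A>) = L
     \<and> (\<forall>c\<in>\<A>. banach_on (model c) (mnorm c) \<and> inj_on (coord c) (cdom c)
          \<and> open_on (model c) (mnorm c) (coord c ` cdom c))
     \<and> (\<forall>c\<in>\<A>. \<forall>c'\<in>\<A>. open_on (model c) (mnorm c) (coord c ` (cdom c \<inter> cdom c'))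
          \<and> smooth_map_on (model c) (mnorm c) (model c') (mnorm c')
              (coord c ` (cdom c \<inter> cdom c')) (coord c' \<circ> chart_inv c))"

text \<open>The tangent map of \<open>\<iota>\<close> at x is represented in a chart around x by the derivative T of the
  coordinate expression of \<open>\<iota>\<close>, the tangent space at x being identified with the model space.\<close>

definition integral_manifold ::
  "('v::real_normed_vector \<Rightarrow> 'v set) \<Rightarrow> 'p set \<Rightarrow> ('p, 'e::real_vector) chart set
     \<Rightarrow> ('p \<Rightarrow> 'v) \<Rightarrow> bool" where
  "integral_manifold P L \<A> \<iota> \<longleftrightarrow> banach_atlas L \<A> \<and> inj_on \<iota> L
     \<and> (\<forall>c\<in>\<A>. smooth_map_on (model c) (mnorm c) UNIV norm (coord c ` cdom c) (\<iota> \<circ> chart_inv c))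
     \<and> (\<forall>c\<in>\<A>. \<forall>x\<in>cdom c. \<exists>T.
          has_frechet_derivative_on (model c) (mnorm c) UNIV norm (coord c ` cdom c)
            (\<iota> \<circ> chart_inv c) (coord c x) T
          \<and> inj_on T (model c) \<and> T ` model c = P (\<iota> x))"

text \<open>Taking the points and the model spaces of the integral manifolds inside the type of the
  ambient space is no restriction: the map \<open>\<iota>\<close> and its tangent maps are injective, so both can be
  transported there, the model spaces keeping their own norms.\<close>

definition integrable_distribution :: "('v::real_normed_vector \<Rightarrow> 'v set) \<Rightarrow> bool" where
  "integrable_distribution P \<longleftrightarrow>
     (\<forall>p. \<exists>(L :: 'v set) (\<A> :: ('v, 'v) chart set) \<iota>. integral_manifold P L \<A> \<iota> \<and> p \<in> \<iota> ` L)"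

section \<open>The Poisson structure on the central extension\<close>

definition orth_proj :: "'h::complex_hilbert set \<Rightarrow> 'h \<Rightarrow> 'h" where
  "orth_proj S x = (THE y. y \<in> S \<and> (\<forall>z\<in>S. cinner z (x - y) = 0))"

definition d_op :: "'h::complex_hilbert set \<Rightarrow> 'h set \<Rightarrow> 'h \<Rightarrow> 'h" where
  "d_op Hp Hm x = \<i> *\<^sub>C (orth_proj Hp x - orth_proj Hm x)"

text \<open>The traces in the next two definitions are real, because the operators are products of two
  skew-adjoint ones.\<close>

definition pairing :: "'h::complex_hilbert u2 \<Rightarrow> 'h u2 \<Rightarrow> real" where
  "pairing \<mu> A = Re (op_trace (u2_apply \<mu> \<circ> u2_apply A))"

definition cocycle :: "'h::complex_hilbert set \<Rightarrow> 'h set \<Rightarrow> 'h u2 \<Rightarrow> 'h u2 \<Rightarrow> real" where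
  "cocycle Hp Hm A B = Re (op_trace (\<lambda>x. u2_apply A
     (d_op Hp Hm (u2_apply B x) - u2_apply B (d_op Hp Hm x))))"

text \<open>The partial derivative is an element of the dual of u2, identified with u2 by the
  pairing.\<close>

definition D_mu :: "('h::complex_hilbert u2 \<times> real \<Rightarrow> real) \<Rightarrow> 'h u2 \<times> real \<Rightarrow> 'h u2" where
  "D_mu f = (\<lambda>(\<mu>, \<gamma>). THE A. ((\<lambda>\<nu>. f (\<nu>, \<gamma>)) has_derivative (\<lambda>B. pairing A B)) (at \<mu>))"

definition poisson_bracket :: "'h::complex_hilbert set \<Rightarrow> 'h set
    \<Rightarrow> ('h u2 \<times> real \<Rightarrow> real) \<Rightarrow> ('h u2 \<times> real \<Rightarrow> real) \<Rightarrow> 'h u2 \<times> real \<Rightarrow> real" where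
  "poisson_bracket Hp Hm f g = (\<lambda>(\<mu>, \<gamma>).
     pairing \<mu> (u2_commutator (D_mu f (\<mu>, \<gamma>)) (D_mu g (\<mu>, \<gamma>)))
       - \<gamma> * cocycle Hp Hm (D_mu f (\<mu>, \<gamma>)) (D_mu g (\<mu>, \<gamma>)))"

definition hamiltonian_vector_field :: "'h::complex_hilbert set \<Rightarrow> 'h set
    \<Rightarrow> ('h u2 \<times> real \<Rightarrow> real) \<Rightarrow> ('h u2 \<times> real \<Rightarrow> 'h u2 \<times> real) \<Rightarrow> bool" where
  "hamiltonian_vector_field Hp Hm h X \<longleftrightarrow>
     (\<forall>f p. smooth f \<longrightarrow> frechet_derivative f (at p) (X p) = poisson_bracket Hp Hm f h p)"

definition characteristic_distribution :: "'h::complex_hilbert set \<Rightarrow> 'h set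
    \<Rightarrow> 'h u2 \<times> real \<Rightarrow> ('h u2 \<times> real) set" where
  "characteristic_distribution Hp Hm p =
     {X p | X h. smooth h \<and> hamiltonian_vector_field Hp Hm h X}"

end

theory Submission
  imports Defs
begin

text \<open>Identifying \<open>(\<mu>, \<gamma>)\<close> with the skew-adjoint operator \<open>a = \<mu> + \<gamma> d\<close>, the characteristic
  distribution consists of the commutators \<open>[B, a]\<close>, the tangent vectors to the orbit of \<open>a\<close> under
  conjugation. As only one integral manifold through each point is needed, a piece of the orbit
  suffices: \<open>X \<mapsto> g a g\<inverse>\<close> with the Cayley transform \<open>g = (1 - X)\<inverse> (1 + X)\<close>, for small \<open>X\<close> in the
  orthogonal complement of the stabilizer \<open>{B. [B, a] = 0}\<close>. The difference
  \<open>\<beta> = g a g\<inverse> - a\<close> is the unique solution of the linear equation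
  \<open>(1 - X) \<beta> (1 + X) = 2 [X, a]\<close> in the Hilbert space of skew-adjoint Hilbert-Schmidt operators.
  It is therefore smooth in \<open>X\<close>, and a perturbation argument shows that it is injective with
  injective tangent maps onto the distribution.\<close>

section \<open>Hilbert spaces\<close>

text \<open>The range of \<open>B \<mapsto> [B, a]\<close> need not be closed, so the tangent spaces
  are in general incomplete in the norm of \<open>u2\<close>. The kernel of this map is closed,
  however, and the orthogonal complement of the kernel is a Hilbert space carried bijectively onto
  the range; this is why it can serve as the model space.

  The second obstacle is algebraic. Neither \<open>a\<close>, which contains a multiple of
  \<open>d\<close>, nor the Cayley transforms are Hilbert-Schmidt in general, and a product of
  skew-adjoint operators is usually not skew-adjoint. Identities are therefore checked in a ring of
  linear endomorphisms, while estimates and fixed point arguments are run on combinations that stay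
  in \<open>u2\<close>: commutators, \<open>i (A B + B A)\<close> and \<open>A B C + C B A\<close>.

  The Cayley transform, unlike the exponential, leads to equations that are at most quadratic in
  \<open>X\<close> and linear in the unknown. The radius 1/20 makes
  \<open>B \<mapsto> (1 - X) B (1 + X)\<close> differ from the identity by an operator of norm at
  most 1/8; invertibility, transversality and injectivity all rest on this one bound.\<close>

lemma parallelogram:
  "(norm (b - a))\<^sup>2 + (norm (a + b))\<^sup>2 = 2 * (norm a)\<^sup>2 + 2 * (norm (b::'a::real_inner))\<^sup>2"
  by (simp add: power2_norm_eq_inner inner_add_left inner_add_right inner_diff_left inner_diff_right
      inner_commute)

text \<open>A minimizing sequence for the distance from \<open>x\<close> to \<open>S\<close> is
  Cauchy by the parallelogram law, because midpoints stay in \<open>S\<close>. The result yields the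
  Riesz representation, the density of the span of \<open>onb\<close> and the projection onto the
  stabilizer.\<close>

lemma closed_subspace_projection:
  fixes S :: "'a::{real_inner,complete_space} set"
  assumes S: "subspace S" "closed S"
  obtains y where "y \<in> S" "\<And>z. z \<in> S \<Longrightarrow> inner (x - y) z = 0"
proof -
  define D where "D = (INF y\<in>S. (norm (x - y))\<^sup>2)"
  have bdd: "bdd_below ((\<lambda>y. (norm (x - y))\<^sup>2) ` S)" by (rule bdd_belowI[of _ 0]) auto
  have Dle: "D \<le> (norm (x - y))\<^sup>2" if "y \<in> S" for y
    unfolding D_def using bdd that by (rule cINF_lower)
  have "S \<noteq> {}" using S(1) subspace_0 by blast
  have "\<exists>y\<in>S. (norm (x - y))\<^sup>2 < D + inverse (Suc n)" for n
    unfolding D_def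
    by (subst cINF_less_iff[OF \<open>S \<noteq> {}\<close> bdd, symmetric]) simp
  then obtain Y where Y: "\<And>n. Y n \<in> S" "\<And>n. (norm (x - Y n))\<^sup>2 < D + inverse (Suc n)"
    by metis
  have par: "(norm (Y n - Y m))\<^sup>2 \<le> 2 * inverse (Suc n) + 2 * inverse (Suc m)" for m n
  proof -
    have "(1/2) *\<^sub>R (Y n + Y m) \<in> S" using S(1) Y(1) by (simp add: subspace_add subspace_scale)
    from Dle[OF this]
    have 1: "4 * D \<le> (norm (2 *\<^sub>R (x - (1/2) *\<^sub>R (Y n + Y m))))\<^sup>2"
      by (simp add: power_mult_distrib)
    have 2: "2 *\<^sub>R (x - (1/2) *\<^sub>R (Y n + Y m)) = (x - Y n) + (x - Y m)"
      by (simp add: algebra_simps scaleR_2)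
    have 3: "Y n - Y m = (x - Y m) - (x - Y n)" by simp
    have "(norm ((x - Y m) - (x - Y n)))\<^sup>2 + (norm ((x - Y n) + (x - Y m)))\<^sup>2
        = 2 * (norm (x - Y n))\<^sup>2 + 2 * (norm (x - Y m))\<^sup>2"
      by (rule parallelogram)
    with 1[unfolded 2] Y(2)[of n] Y(2)[of m] show ?thesis unfolding 3 by linarith
  qed
  have "Cauchy Y"
  proof (rule metric_CauchyI)
    fix e :: real assume "e > 0"
    then obtain N where N: "inverse (real (Suc N)) < e\<^sup>2 / 4"
      using reals_Archimedean[of "e\<^sup>2 / 4"] by auto
    have "dist (Y m) (Y n) < e" if "m \<ge> N" "n \<ge> N" for m n
    proof -
      have "inverse (real (Suc m)) \<le> inverse (real (Suc N))" "inverse (real (Suc n)) \<le> inverse (real (Suc N))"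
        using that by (auto intro!: le_imp_inverse_le)
      with par[of m n] N have "(norm (Y m - Y n))\<^sup>2 < e\<^sup>2" by linarith
      with \<open>e > 0\<close> show ?thesis by (simp add: dist_norm power2_less_imp_less)
    qed
    then show "\<exists>M. \<forall>m\<ge>M. \<forall>n\<ge>M. dist (Y m) (Y n) < e" by blast
  qed
  then obtain y where y: "Y \<longlonglongrightarrow> y" using Cauchy_convergent convergent_def by blast
  have yS: "y \<in> S" using closed_sequentially[OF S(2)] Y(1) y by blast
  have "(\<lambda>n. (norm (x - Y n))\<^sup>2) \<longlonglongrightarrow> (norm (x - y))\<^sup>2"
    by (intro tendsto_intros y)
  moreover have "(\<lambda>n. D + inverse (real (Suc n))) \<longlonglongrightarrow> D + 0"
    by (intro tendsto_intros LIMSEQ_inverse_real_of_nat)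
  ultimately have min: "(norm (x - y))\<^sup>2 \<le> D"
    using Y(2) by (intro LIMSEQ_le[where X = "\<lambda>n. (norm (x - Y n))\<^sup>2"]) (auto intro: less_imp_le)
  show thesis
  proof (rule that[OF yS])
    fix z assume z: "z \<in> S"
    show "inner (x - y) z = 0"
    proof (rule ccontr)
      assume nz: "inner (x - y) z \<noteq> 0"
      then have zz: "inner z z > 0" by auto
      \<comment> \<open>This \<open>t\<close> minimizes the quadratic function
        \<open>t \<mapsto> (norm ((x - y) - t z))^2\<close>, whose minimum would lie below
        \<open>D\<close>.\<close>
      define t where "t = inner (x - y) z / inner z z"
      have "y + t *\<^sub>R z \<in> S" using S(1) yS z by (simp add: subspace_add subspace_scale)
      from Dle[OF this] min have "inner (x - y) (x - y) \<le> inner ((x - y) - t *\<^sub>R z) ((x - y) - t *\<^sub>R z)"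
        by (simp add: power2_norm_eq_inner diff_diff_eq)
      also have "\<dots> = inner (x - y) (x - y) - 2 * t * inner (x - y) z + t\<^sup>2 * inner z z"
        unfolding inner_diff_left[of "x - y"] inner_diff_right[of _ "x - y"]
        by (simp add: inner_commute power2_eq_square algebra_simps)
      finally have "2 * t * inner (x - y) z \<le> t\<^sup>2 * inner z z" by simp
      moreover have "t * inner (x - y) z = t\<^sup>2 * inner z z"
        using zz by (simp add: t_def power2_eq_square)
      moreover have "t\<^sup>2 * inner z z > 0" using nz zz by (simp add: t_def)
      ultimately show False by linarith
    qed
  qed
qed

lemma riesz_representation:
  fixes \<phi> :: "'a::{real_inner,complete_space} \<Rightarrow> real"
  assumes "bounded_linear \<phi>"
  obtains a where "\<And>x. \<phi> x = inner a x"
proof (cases "\<forall>x. \<phi> x = 0")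
  case True
  then show thesis using that[of 0] by simp
next
  case False
  interpret bounded_linear \<phi> by fact
  from False obtain x where x: "\<phi> x \<noteq> 0" by blast
  have "subspace {z. \<phi> z = 0}" by (auto simp: subspace_def add scaleR zero)
  moreover have "closed {z. \<phi> z = 0}"
    by (intro closed_Collect_eq continuous_intros linear_continuous_on assms)
  ultimately obtain y where y: "\<phi> y = 0" "\<And>z. \<phi> z = 0 \<Longrightarrow> inner (x - y) z = 0"
    using closed_subspace_projection[of "{z. \<phi> z = 0}" x] by auto
  define u where "u = x - y"
  have u: "\<phi> u = \<phi> x" by (simp add: u_def y diff)
  with x have uu: "inner u u \<noteq> 0" by (auto simp: zero)
  have "\<phi> w = inner ((\<phi> u / inner u u) *\<^sub>R u) w" for w
  proof -
    have "\<phi> (w - (\<phi> w / \<phi> u) *\<^sub>R u) = 0" using x u by (simp add: diff scaleR)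
    from y(2)[OF this] have "inner u w = (\<phi> w / \<phi> u) * inner u u"
      by (simp add: u_def[symmetric] inner_diff_right)
    with x u uu show ?thesis by simp
  qed
  then show thesis by (rule that)
qed

text \<open>Inverts \<open>1 - N\<close> by the contraction principle; existence gives surjectivity
  and uniqueness gives injectivity of \<open>1 - N\<close>.\<close>

lemma neumann_fixed_point:
  fixes N :: "'a::{real_normed_vector,complete_space} \<Rightarrow> 'a"
  assumes "linear N" "\<And>x. norm (N x) \<le> c * norm x" "c < 1"
  shows "\<exists>!z. z = w + N z"
proof -
  \<comment> \<open>The contraction factor has to be nonnegative, while \<open>c\<close> may be
    negative.\<close>
  have "dist (w + N x) (w + N y) \<le> max 0 c * dist x y" for x y
    using order.trans[OF assms(2)[of "x - y"] mult_right_mono[of c "max 0 c"]]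
    by (simp add: dist_norm linear_diff[OF assms(1)])
  then have "\<exists>!z. w + N z = z"
    using assms(3) by (intro banach_fix_type[of "max 0 c"]) auto
  then show ?thesis by metis
qed

section \<open>Orthonormal expansions and Parseval's identity\<close>

lemma complex_hilbert_linear_scaleC: "linear (\<lambda>x::'h::complex_hilbert. c *\<^sub>C x)"
  by (rule linearI) (simp_all add: scaleC_add_right scaleR_scaleC complex_space.scale_left_commute)

lemma cinner_sum_right: "cinner x (\<Sum>i\<in>I. f i) = (\<Sum>i\<in>I. cinner x (f i))"
  by (induction I rule: infinite_finite_induct) (simp_all add: cinner_add_right)

lemma norm_scaleC: "norm (c *\<^sub>C x :: 'h::complex_hilbert) = cmod c * norm x"
proof -
  have "of_real ((norm (c *\<^sub>C x))\<^sup>2) = (cnj c * c) * cinner x x"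
    unfolding cinner_self[symmetric] by (simp add: cinner_scaleC_left cinner_scaleC_right)
  also have "\<dots> = of_real ((cmod c * norm x)\<^sup>2)"
    unfolding cinner_self power_mult_distrib of_real_mult complex_norm_square by simp
  finally have "(norm (c *\<^sub>C x))\<^sup>2 = (cmod c * norm x)\<^sup>2" using of_real_eq_iff by blast
  then show ?thesis by (simp add: power2_eq_iff_nonneg)
qed

text \<open>Multiplying \<open>y\<close> by a phase makes the inner product real and nonnegative, so
  that the real Cauchy-Schwarz inequality applies.\<close>

lemma cmod_cinner_le: "cmod (cinner x y) \<le> norm x * norm (y :: 'h::complex_hilbert)"
proof (cases "cinner x y = 0")
  case False
  define c where "c = cnj (cinner x y) / cmod (cinner x y)"
  have c: "cmod c = 1" using False by (simp add: c_def norm_divide)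
  have "c * cinner x y = of_real (cmod (cinner x y))"
    using False complex_norm_square[of "cinner x y"]
    by (simp add: c_def field_simps power2_eq_square)
  then have "cmod (cinner x y) = Re (cinner x (c *\<^sub>C y))"
    by (simp add: cinner_scaleC_right)
  also have "\<dots> = inner x (c *\<^sub>C y)" by (rule Re_cinner)
  also have "\<dots> \<le> norm x * norm (c *\<^sub>C y)" by (rule norm_cauchy_schwarz)
  finally show ?thesis by (simp add: norm_scaleC c)
qed simp

lemma onb_cinner: "e \<in> onb \<Longrightarrow> f \<in> onb \<Longrightarrow> cinner e f = (if e = f then 1 else 0)"
  using is_onb_onb unfolding is_onb_def by blast

lemma onb_eq_0: "(\<And>e. e \<in> onb \<Longrightarrow> cinner e x = 0) \<Longrightarrow> x = 0"
  using is_onb_onb unfolding is_onb_def by blast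

text \<open>Completing the square. With the Fourier coefficients as \<open>c\<close> it gives
  Bessel's inequality; with the coefficients of an approximation of \<open>y\<close> it bounds the
  sum of squared Fourier coefficients from below. Together these are Parseval's identity.\<close>

lemma onb_partial_sum_norm:
  fixes y :: "'h::complex_hilbert"
  assumes F: "finite F" "F \<subseteq> onb"
  shows "(norm (y - (\<Sum>e\<in>F. c e *\<^sub>C e)))\<^sup>2
    = (norm y)\<^sup>2 - (\<Sum>e\<in>F. (cmod (cinner e y))\<^sup>2) + (\<Sum>e\<in>F. (cmod (cinner e y - c e))\<^sup>2)"
proof -
  define s where "s = (\<Sum>e\<in>F. c e *\<^sub>C e)"
  have es: "cinner e s = c e" if "e \<in> F" for e
  proof -
    have "cinner e (c f *\<^sub>C f) = (if e = f then c f else 0)" if "f \<in> F" for f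
      using onb_cinner[OF subsetD[OF F(2) \<open>e \<in> F\<close>] subsetD[OF F(2) that]] by (simp add: cinner_scaleC_right)
    then have "cinner e s = (\<Sum>f\<in>F. if e = f then c f else 0)"
      unfolding s_def cinner_sum_right by simp
    with that F show ?thesis by simp
  qed
  have cs: "cinner x s = (\<Sum>e\<in>F. c e * cnj (cinner e x))" for x
    unfolding s_def cinner_sum_right by (simp add: cinner_scaleC_right flip: cinner_commute)
  have 1: "inner y s = (\<Sum>e\<in>F. Re (c e * cnj (cinner e y)))"
    by (simp add: Re_cinner[symmetric] cs del: times_complex.sel)
  have 2: "inner s s = (\<Sum>e\<in>F. Re (c e * cnj (c e)))"
    unfolding Re_cinner[symmetric] cs[of s] Re_sum by (intro sum.cong) (simp_all only: es)
  have "(norm (y - s))\<^sup>2 = (norm y)\<^sup>2 - 2 * inner y s + inner s s"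
    by (simp add: power2_norm_eq_inner inner_diff_left inner_diff_right inner_commute)
  also have "\<dots> = (norm y)\<^sup>2 + (\<Sum>e\<in>F. Re (c e * cnj (c e)) - 2 * Re (c e * cnj (cinner e y)))"
    by (simp add: 1 2 sum_subtractf sum_distrib_left)
  also have "(\<Sum>e\<in>F. Re (c e * cnj (c e)) - 2 * Re (c e * cnj (cinner e y)))
     = (\<Sum>e\<in>F. (cmod (cinner e y - c e))\<^sup>2 - (cmod (cinner e y))\<^sup>2)"
    unfolding cmod_power2 by (intro sum.cong refl) (simp add: power2_eq_square algebra_simps)
  finally show ?thesis by (simp add: s_def sum_subtractf)
qed

lemma subspace_closure:
  fixes V :: "'a::real_normed_vector set"
  assumes V: "subspace V"
  shows "subspace (closure V)"
proof (rule subspaceI)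
  show "0 \<in> closure V" using subspace_0[OF V] closure_subset by blast
next
  fix x y assume "x \<in> closure V" "y \<in> closure V"
  then obtain X Y where "\<And>n. X n \<in> V" "X \<longlonglongrightarrow> x" "\<And>n. Y n \<in> V" "Y \<longlonglongrightarrow> y"
    by (auto simp: closure_sequential)
  then have "\<And>n. X n + Y n \<in> V" "(\<lambda>n. X n + Y n) \<longlonglongrightarrow> x + y"
    using subspace_add[OF V] by (auto intro: tendsto_add)
  then show "x + y \<in> closure V" unfolding closure_sequential
    by (intro exI[of _ "\<lambda>n. X n + Y n"]) simp
next
  fix x c assume "x \<in> closure V"
  then obtain X where "\<And>n. X n \<in> V" "X \<longlonglongrightarrow> x" by (auto simp: closure_sequential)
  then have "\<And>n. c *\<^sub>R X n \<in> V" "(\<lambda>n. c *\<^sub>R X n) \<longlonglongrightarrow> c *\<^sub>R x"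
    using subspace_scale[OF V] by (auto intro: tendsto_scaleR)
  then show "c *\<^sub>R x \<in> closure V" unfolding closure_sequential
    by (intro exI[of _ "\<lambda>n. c *\<^sub>R X n"]) simp
qed

text \<open>The residual of the projection onto the closed span is orthogonal to every basis vector,
  hence zero by maximality of the orthonormal set.\<close>

lemma onb_span_dense:
  fixes y :: "'h::complex_hilbert"
  assumes "\<epsilon> > 0"
  obtains F c where "finite F" "F \<subseteq> onb" "norm (y - (\<Sum>e\<in>F. c e *\<^sub>C e)) < \<epsilon>"
proof -
  define V where "V = complex_space.span (onb :: 'h set)"
  have "subspace V"
    unfolding V_def subspace_def
    by (simp add: complex_space.span_zero complex_space.span_add complex_space.span_scale scaleR_scaleC)
  then have "subspace (closure V)" by (rule subspace_closure)
  then obtain z where z: "z \<in> closure V" "\<And>w. w \<in> closure V \<Longrightarrow> inner (y - z) w = 0"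
    using closed_subspace_projection[of "closure V" y] closed_closure by blast
  have "y - z = 0"
  proof (rule onb_eq_0)
    fix e :: 'h assume "e \<in> onb"
    \<comment> \<open>The projection is orthogonal for the real inner product only; testing with
      \<open>e\<close> and \<open>i e\<close> recovers both parts of the complex one.\<close>
    then have "e \<in> V" "\<i> *\<^sub>C e \<in> V"
      unfolding V_def by (simp_all add: complex_space.span_base complex_space.span_scale)
    then have "Re (cinner (y - z) e) = 0" "Re (cinner (y - z) (\<i> *\<^sub>C e)) = 0"
      using z(2) closure_subset unfolding Re_cinner by blast+
    then have "cinner (y - z) e = 0" by (simp add: cinner_scaleC_right complex_eq_iff)
    then show "cinner e (y - z) = 0" by (metis cinner_commute complex_cnj_zero)
  qed
  with z(1) have "y \<in> closure V" by simp
  then obtain v where v: "v \<in> V" "dist v y < \<epsilon>" using assms closure_approachable by blast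
  from v(1) obtain F c where "finite F" "F \<subseteq> onb" "v = (\<Sum>e\<in>F. c e *\<^sub>C e)"
    unfolding V_def complex_space.span_explicit by blast
  with v(2) that show thesis by (simp add: dist_norm norm_minus_commute)
qed

lemma parseval:
  fixes y :: "'h::complex_hilbert"
  shows "((\<lambda>e. (cmod (cinner e y))\<^sup>2) has_sum (norm y)\<^sup>2) onb"
proof -
  let ?f = "\<lambda>e. (cmod (cinner e y))\<^sup>2"
  have bessel: "sum ?f F \<le> (norm y)\<^sup>2" if "finite F" "F \<subseteq> onb" for F
    using onb_partial_sum_norm[OF that, of y "\<lambda>e. cinner e y"] zero_le_power2[of "norm (y - (\<Sum>e\<in>F. cinner e y *\<^sub>C e))"]
    by simp
  have summable: "?f summable_on onb"
    by (rule nonneg_bdd_above_summable_on) (auto intro!: bdd_aboveI[of _ "(norm y)\<^sup>2"] bessel)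
  have "infsum ?f onb \<le> (norm y)\<^sup>2"
    by (rule infsum_le_finite_sums[OF summable bessel])
  moreover have "(norm y)\<^sup>2 \<le> infsum ?f onb"
  proof (rule field_le_epsilon)
    fix \<delta> :: real assume that: "\<delta> > 0"
    from that have "sqrt \<delta> > 0" by simp
    then obtain F c where F: "finite F" "F \<subseteq> onb" "norm (y - (\<Sum>e\<in>F. c e *\<^sub>C e)) < sqrt \<delta>"
      by (rule onb_span_dense)
    have "(norm (y - (\<Sum>e\<in>F. c e *\<^sub>C e)))\<^sup>2 \<le> \<delta>"
      using F(3) that by (simp add: real_le_rsqrt sqrt_ge_absD less_imp_le)
    moreover have "0 \<le> (\<Sum>e\<in>F. (cmod (cinner e y - c e))\<^sup>2)" by (simp add: sum_nonneg)
    moreover have "sum ?f F \<le> infsum ?f onb"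
      using summable F by (intro finite_sum_le_infsum) auto
    ultimately show "(norm y)\<^sup>2 \<le> infsum ?f onb + \<delta>"
      using onb_partial_sum_norm[OF F(1,2), of y c] by linarith
  qed
  ultimately have "infsum ?f onb = (norm y)\<^sup>2" by (rule antisym)
  with summable show ?thesis by (metis has_sum_infsum)
qed

section \<open>Hilbert-Schmidt operators\<close>

text \<open>Both sums equal the sum of the squared moduli of the matrix entries
  \<open>cinner e' (f e)\<close>, taken by columns or by rows; Parseval evaluates each. The equality
  of the two sums later does the work of the cyclicity of the trace.\<close>

lemma hilbert_schmidt_adjoint:
  fixes f g :: "'h::complex_hilbert \<Rightarrow> 'h"
  assumes "hilbert_schmidt f" and adj: "\<And>x y. cinner (f x) y = cinner x (g y)"
  shows "hilbert_schmidt g"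
    and "(\<Sum>\<^sub>\<infinity>e\<in>onb. (norm (g e))\<^sup>2) = (\<Sum>\<^sub>\<infinity>e\<in>onb. (norm (f e))\<^sup>2)"
proof -
  let ?F = "\<lambda>(e, e'). (cmod (cinner e' (f e)))\<^sup>2"
  have f: "((\<lambda>e'. ?F (e, e')) has_sum (norm (f e))\<^sup>2) onb" for e
    by (simp add: parseval)
  have g: "((\<lambda>e. (\<lambda>(x, y). ?F (y, x)) (e', e)) has_sum (norm (g e'))\<^sup>2) onb" for e'
  proof -
    have "cmod (cinner e' (f e)) = cmod (cinner e (g e'))" for e
      by (metis adj cinner_commute complex_mod_cnj)
    then show ?thesis by (simp add: parseval)
  qed
  have "?F summable_on onb \<times> onb"
    using assms(1) unfolding hilbert_schmidt_def by (intro summable_on_SigmaI[OF f]) auto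
  moreover have sf: "((\<lambda>e. (norm (f e))\<^sup>2) has_sum (\<Sum>\<^sub>\<infinity>e\<in>onb. (norm (f e))\<^sup>2)) onb"
    using assms(1) unfolding hilbert_schmidt_def by simp
  ultimately have "(?F has_sum (\<Sum>\<^sub>\<infinity>e\<in>onb. (norm (f e))\<^sup>2)) (onb \<times> onb)"
    by (intro has_sum_SigmaI[OF f])
  then have "((\<lambda>(x, y). ?F (y, x)) has_sum (\<Sum>\<^sub>\<infinity>e\<in>onb. (norm (f e))\<^sup>2)) (onb \<times> onb)"
    by (simp only: has_sum_swap[of ?F])
  from has_sum_SigmaD[OF this g]
  have "((\<lambda>e. (norm (g e))\<^sup>2) has_sum (\<Sum>\<^sub>\<infinity>e\<in>onb. (norm (f e))\<^sup>2)) onb" .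
  then show "hilbert_schmidt g" "(\<Sum>\<^sub>\<infinity>e\<in>onb. (norm (g e))\<^sup>2) = (\<Sum>\<^sub>\<infinity>e\<in>onb. (norm (f e))\<^sup>2)"
    unfolding hilbert_schmidt_def by (auto simp: summable_on_def infsumI)
qed

lemma u2_cinner: "cinner (u2_apply A x) y = - cinner x (u2_apply A y)"
  by (simp add: u2_skew cinner_minus_right)

lemma u2_norm_sq_has_sum: "((\<lambda>e. (norm (u2_apply A e))\<^sup>2) has_sum (norm A)\<^sup>2) onb"
  using u2_hs[of A] unfolding hilbert_schmidt_def norm_u2_def
  by (simp add: infsum_nonneg)

text \<open>Expand \<open>u2_apply A x\<close> by Parseval, move \<open>A\<close> onto the basis
  vectors by skew-adjointness and apply Cauchy-Schwarz to each coefficient.\<close>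

lemma norm_u2_apply_le: "norm (u2_apply A x) \<le> norm A * norm x"
proof -
  have "(norm (u2_apply A x))\<^sup>2 \<le> (norm A * norm x)\<^sup>2" unfolding power_mult_distrib
  proof (rule has_sum_mono[OF parseval has_sum_cmult_left[OF u2_norm_sq_has_sum]])
    fix e :: 'a
    have "cmod (cinner e (u2_apply A x)) = cmod (cinner (u2_apply A e) x)"
      by (simp add: u2_cinner)
    then show "(cmod (cinner e (u2_apply A x)))\<^sup>2 \<le> (norm (u2_apply A e))\<^sup>2 * (norm x)\<^sup>2"
      using power_mono[OF cmod_cinner_le[of "u2_apply A e" x], of 2] by (simp add: power_mult_distrib)
  qed
  then show ?thesis by (rule power2_le_imp_le) simp
qed

lemma linear_u2_apply: "linear (u2_apply A)"
  unfolding u2_apply.rep_eq by (rule bounded_linear.linear[OF blinfun.bounded_linear_right])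

lemma u2_apply_scaleC: "u2_apply A (c *\<^sub>C x) = c *\<^sub>C u2_apply A x"
  by transfer simp

lemma ex_u2:
  fixes f :: "'h::complex_hilbert \<Rightarrow> 'h"
  assumes "\<And>x y. f (x + y) = f x + f y" "\<And>c x. f (c *\<^sub>C x) = c *\<^sub>C f x"
    and "\<And>x. norm (f x) \<le> K * norm x"
    and "hilbert_schmidt f" "\<And>x y. cinner (f x) y = - cinner x (f y)"
  obtains A where "u2_apply A = f"
proof -
  have "bounded_linear f"
    using assms(1-3) by (intro bounded_linear_intro[where K = K]) (simp_all add: scaleR_scaleC mult.commute[of _ K])
  then have [simp]: "blinfun_apply (Blinfun f) = f" by (rule bounded_linear_Blinfun_apply)
  have "u2_apply (Abs_u2 (Blinfun f)) = f"
    unfolding u2_apply.rep_eq using assms(2,4,5)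
    by (subst Abs_u2_inverse) (simp_all add: cinner_minus_right)
  then show thesis by (rule that)
qed

section \<open>Completeness in the Hilbert-Schmidt norm\<close>

instance complex_hilbert \<subseteq> banach ..

text \<open>A Cauchy sequence converges pointwise because the Hilbert-Schmidt norm dominates the
  operator norm. The Cauchy estimate, restricted to finite partial sums, survives the pointwise
  limit; this makes the limit Hilbert-Schmidt and the convergence one in norm.\<close>

instance u2 :: (complex_hilbert) complete_space
proof
  fix A :: "nat \<Rightarrow> 'a u2" assume A: "Cauchy A"
  have Cx: "convergent (\<lambda>n. u2_apply (A n) x)" for x
  proof (rule Cauchy_convergent, rule metric_CauchyI)
    fix \<epsilon> :: real assume "\<epsilon> > 0"
    then have "\<epsilon> / (norm x + 1) > 0" by (simp add: add_nonneg_pos)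
    with A obtain M where M: "\<And>m n. m \<ge> M \<Longrightarrow> n \<ge> M \<Longrightarrow> dist (A m) (A n) < \<epsilon> / (norm x + 1)"
      unfolding Cauchy_def by meson
    have "dist (u2_apply (A m) x) (u2_apply (A n) x) < \<epsilon>" if "m \<ge> M" "n \<ge> M" for m n
    proof -
      have "dist (u2_apply (A m) x) (u2_apply (A n) x) \<le> norm (A m - A n) * norm x"
        using norm_u2_apply_le[of "A m - A n" x] by (simp add: dist_norm)
      also have "\<dots> \<le> norm (A m - A n) * (norm x + 1)" by (intro mult_left_mono) auto
      also have "\<dots> < \<epsilon>" using M[OF that] by (simp add: dist_norm pos_less_divide_eq add_nonneg_pos)
      finally show ?thesis .
    qed
    then show "\<exists>M. \<forall>m\<ge>M. \<forall>n\<ge>M. dist (u2_apply (A m) x) (u2_apply (A n) x) < \<epsilon>" by blast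
  qed
  define f where "f x = lim (\<lambda>n. u2_apply (A n) x)" for x
  have f: "(\<lambda>n. u2_apply (A n) x) \<longlonglongrightarrow> f x" for x
    using Cx unfolding f_def by (simp add: convergent_LIMSEQ_iff)
  have sums: "(\<Sum>e\<in>F. (norm (u2_apply (A n) e - f e))\<^sup>2) \<le> \<epsilon>\<^sup>2"
    if "finite F" "F \<subseteq> onb" "\<epsilon> > 0" "\<And>m. m \<ge> n \<Longrightarrow> dist (A n) (A m) < \<epsilon>" for F n \<epsilon>
  proof (rule LIMSEQ_le_const2)
    show "(\<lambda>m. \<Sum>e\<in>F. (norm (u2_apply (A n) e - u2_apply (A m) e))\<^sup>2)
        \<longlonglongrightarrow> (\<Sum>e\<in>F. (norm (u2_apply (A n) e - f e))\<^sup>2)"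
      by (intro tendsto_intros f)
    have "(\<Sum>e\<in>F. (norm (u2_apply (A n) e - u2_apply (A m) e))\<^sup>2) \<le> \<epsilon>\<^sup>2" if "m \<ge> n" for m
    proof -
      have "(\<Sum>e\<in>F. (norm (u2_apply (A n - A m) e))\<^sup>2) \<le> (norm (A n - A m))\<^sup>2"
        using \<open>finite F\<close> \<open>F \<subseteq> onb\<close> by (intro finite_sum_le_has_sum[OF u2_norm_sq_has_sum]) auto
      also have "\<dots> \<le> \<epsilon>\<^sup>2"
        using \<open>\<And>m. m \<ge> n \<Longrightarrow> dist (A n) (A m) < \<epsilon>\<close>[OF that] by (intro power_mono) (auto simp: dist_norm)
      finally show ?thesis by simp
    qed
    then show "\<exists>N. \<forall>m\<ge>N. (\<Sum>e\<in>F. (norm (u2_apply (A n) e - u2_apply (A m) e))\<^sup>2) \<le> \<epsilon>\<^sup>2" by blast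
  qed
  have tail: "\<exists>n0. \<forall>n\<ge>n0. \<forall>m\<ge>n0. dist (A n) (A m) < \<epsilon>" if "\<epsilon> > 0" for \<epsilon>
    using A that unfolding Cauchy_def by blast
  obtain K where K: "\<And>n. norm (A n) \<le> K"
    using Cauchy_Bseq[OF A] unfolding Bseq_def by auto
  obtain B where B: "u2_apply B = f"
  proof (rule ex_u2)
    show "f (x + y) = f x + f y" for x y
      using LIMSEQ_unique[OF f[of "x + y", unfolded linear_add[OF linear_u2_apply]]
          tendsto_add[OF f[of x] f[of y]]] .
    have bl: "bounded_linear ((*\<^sub>C) c :: 'a \<Rightarrow> 'a)" for c
      by (rule bounded_linear_intro[where K = "cmod c"])
        (simp_all add: scaleC_add_right norm_scaleC mult.commute scaleR_scaleC complex_space.scale_left_commute)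
    show "f (c *\<^sub>C x) = c *\<^sub>C f x" for c x
      using LIMSEQ_unique[OF f[of "c *\<^sub>C x", unfolded u2_apply_scaleC]
          bounded_linear.tendsto[OF bl f[of x], of c]] .
    show "norm (f x) \<le> K * norm x" for x
    proof (rule LIMSEQ_le_const2[OF tendsto_norm[OF f]])
      show "\<exists>N. \<forall>n\<ge>N. norm (u2_apply (A n) x) \<le> K * norm x"
        using order.trans[OF norm_u2_apply_le mult_right_mono[OF K norm_ge_zero]] by blast
    qed
    show "cinner (f x) y = - cinner x (f y)" for x y
    proof (rule complex_eqI)
      \<comment> \<open>Real parts suffice: up to sign, the imaginary part at \<open>y\<close> is
        the real part at \<open>i y\<close>, and \<open>f\<close> commutes with
        \<open>i\<close>.\<close>
      have re: "inner (f x) y = - inner x (f y)" for x y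
      proof (rule LIMSEQ_unique)
        show "(\<lambda>n. inner (u2_apply (A n) x) y) \<longlonglongrightarrow> inner (f x) y" by (intro tendsto_intros f)
        have "inner (u2_apply (A n) x) y = - inner x (u2_apply (A n) y)" for n
          using arg_cong[OF u2_cinner[of "A n" x y], of Re] by (simp add: Re_cinner)
        then show "(\<lambda>n. inner (u2_apply (A n) x) y) \<longlonglongrightarrow> - inner x (f y)"
          by (simp only:) (intro tendsto_intros f)
      qed
      then show "Re (cinner (f x) y) = Re (- cinner x (f y))" by (simp add: Re_cinner)
      have fi: "f (\<i> *\<^sub>C y) = \<i> *\<^sub>C f y"
        using LIMSEQ_unique[OF f[of "\<i> *\<^sub>C y", unfolded u2_apply_scaleC]
            bounded_linear.tendsto[OF bl f[of y], of \<i>]] .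
      have "Re (cinner (f x) (\<i> *\<^sub>C y)) = - Re (cinner x (f (\<i> *\<^sub>C y)))" by (simp add: Re_cinner re)
      then show "Im (cinner (f x) y) = Im (- cinner x (f y))" by (simp add: cinner_scaleC_right fi)
    qed
    obtain n where n: "\<forall>m\<ge>n. dist (A n) (A m) < 1" using tail[of 1] by auto
    have "hilbert_schmidt (\<lambda>x. u2_apply (A n) x - f x)"
      unfolding hilbert_schmidt_def
      by (rule nonneg_bdd_above_summable_on)
        (use sums[where \<epsilon> = 1 and n = n] n in \<open>auto intro!: bdd_aboveI[of _ 1]\<close>)
    then have "hilbert_schmidt (\<lambda>x. f x - u2_apply (A n) x)"
      by (rule hilbert_schmidt_dominated[where C = 1]) (simp add: norm_minus_commute)
    from hilbert_schmidt_add[OF this u2_hs[of "A n"]]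
    show "hilbert_schmidt f" by simp
  qed
  have "A \<longlonglongrightarrow> B"
  proof (rule metric_LIMSEQ_I)
    fix \<epsilon> :: real assume "\<epsilon> > 0"
    then obtain n0 where n0: "\<forall>n\<ge>n0. \<forall>m\<ge>n0. dist (A n) (A m) < \<epsilon> / 2" using tail[of "\<epsilon> / 2"] by auto
    have "dist (A n) B < \<epsilon>" if "n \<ge> n0" for n
    proof -
      have "(norm (A n - B))\<^sup>2 \<le> (\<epsilon> / 2)\<^sup>2"
        by (rule has_sum_le_finite_sums[OF u2_norm_sq_has_sum])
          (use sums[where \<epsilon> = "\<epsilon> / 2" and n = n] n0 that \<open>\<epsilon> > 0\<close> in \<open>auto simp: B\<close>)
      then have "norm (A n - B) \<le> \<epsilon> / 2" by (rule power2_le_imp_le) (use \<open>\<epsilon> > 0\<close> in simp)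
      with \<open>\<epsilon> > 0\<close> show ?thesis by (simp add: dist_norm)
    qed
    then show "\<exists>n0. \<forall>n\<ge>n0. dist (A n) B < \<epsilon>" by blast
  qed
  then show "convergent A" by (rule convergentI)
qed

instance u2 :: (complex_hilbert) banach ..

section \<open>Products of operators\<close>

text \<open>The linear endomorphisms form a unital ring without the axiom \<open>0 \<noteq> 1\<close>, which fails
  on the zero space; this is why \<^class>\<open>ring_1\<close> is not instantiated.\<close>

typedef (overloaded) 'a endo = "{f :: 'a::real_vector \<Rightarrow> 'a. linear f}"
  by (rule exI[of _ "\<lambda>x. x"]) (simp add: linear_iff)

setup_lifting type_definition_endo

lift_definition endo_apply :: "'a::real_vector endo \<Rightarrow> 'a \<Rightarrow> 'a" is "\<lambda>f. f" .

lemma endo_eqI: "(\<And>x. endo_apply S x = endo_apply T x) \<Longrightarrow> S = T"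
  by transfer auto

instantiation endo :: (real_vector) "{real_algebra, monoid_mult}"
begin

lift_definition zero_endo :: "'a endo" is "\<lambda>x. 0" by (simp add: linear_iff)
lift_definition one_endo :: "'a endo" is "\<lambda>x. x" by (simp add: linear_iff)
lift_definition plus_endo :: "'a endo \<Rightarrow> 'a endo \<Rightarrow> 'a endo" is "\<lambda>f g x. f x + g x"
  by (rule linear_compose_add)
lift_definition minus_endo :: "'a endo \<Rightarrow> 'a endo \<Rightarrow> 'a endo" is "\<lambda>f g x. f x - g x"
  by (rule linear_compose_sub)
lift_definition uminus_endo :: "'a endo \<Rightarrow> 'a endo" is "\<lambda>f x. - f x"
  by (rule linear_compose_neg)
lift_definition scaleR_endo :: "real \<Rightarrow> 'a endo \<Rightarrow> 'a endo" is "\<lambda>r f x. r *\<^sub>R f x"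
  by (rule linear_compose_scale_right)
lift_definition times_endo :: "'a endo \<Rightarrow> 'a endo \<Rightarrow> 'a endo" is "\<lambda>f g x. f (g x)"
  using linear_compose unfolding o_def by blast

instance
  by standard (transfer; auto simp: fun_eq_iff algebra_simps linear_iff)+

end

lemma endo_apply_simps [simp]:
  "endo_apply (S + T) x = endo_apply S x + endo_apply T x"
  "endo_apply (S - T) x = endo_apply S x - endo_apply T x"
  "endo_apply (- S) x = - endo_apply S x"
  "endo_apply (r *\<^sub>R S) x = r *\<^sub>R endo_apply S x"
  "endo_apply (S * T) x = endo_apply S (endo_apply T x)"
  "endo_apply 0 x = 0" "endo_apply 1 x = x"
  by (transfer; simp)+

lift_definition i_op :: "'h::complex_hilbert endo" is "\<lambda>x. \<i> *\<^sub>C x"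
  by (rule complex_hilbert_linear_scaleC)

text \<open>The embedding into a ring lets \<open>algebra_simps\<close> settle operator identities,
  which return to \<open>u2\<close> through \<open>opr_inject\<close>.\<close>

definition opr :: "'h::complex_hilbert u2 \<Rightarrow> 'h endo" where
  "opr A = Abs_endo (u2_apply A)"

lemma endo_apply_opr [simp]: "endo_apply (opr A) x = u2_apply A x"
  unfolding opr_def endo_apply.rep_eq by (subst Abs_endo_inverse) (simp_all add: linear_u2_apply)

lemma endo_apply_i_op [simp]: "endo_apply i_op x = \<i> *\<^sub>C x"
  by transfer simp

lemma opr_inject: "opr A = opr B \<longleftrightarrow> A = B"
  by (metis endo_apply_opr u2_eq_iff)

lemma opr_simps [simp]:
  "opr 0 = 0" "opr (A + B) = opr A + opr B" "opr (A - B) = opr A - opr B" "opr (- A) = - opr A"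
  "opr (r *\<^sub>R A) = r *\<^sub>R opr A"
  "opr (u2_commutator A B) = opr A * opr B - opr B * opr A"
  by (rule endo_eqI; simp add: u2_commutator_apply)+

lemma i_op_i_op: "i_op * i_op = - 1"
  by (rule endo_eqI) (simp add: scaleC_scaleC complex_space.scale_minus_left[of 1, simplified])

lemma opr_i_op: "opr A * i_op = i_op * opr A"
  by (rule endo_eqI) (simp add: u2_apply_scaleC)

lemma i_op_i_op_left: "i_op * (i_op * S) = - S"
  using i_op_i_op by (metis mult.assoc mult_1_left mult_minus_left)

lemma opr_i_op_left: "opr A * (i_op * S) = i_op * (opr A * S)"
  by (metis mult.assoc opr_i_op)

section \<open>Jordan, commutator and triple products\<close>

lemma hilbert_schmidt_comp_left:
  "hilbert_schmidt (\<lambda>x. u2_apply A (u2_apply B x))"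
  by (rule hilbert_schmidt_dominated[OF u2_hs[of B] norm_u2_apply_le])

text \<open>The Jordan product needs the factor \<open>\<i>\<close>, because \<open>A B + B A\<close> is self-adjoint.\<close>

definition jordan :: "'h::complex_hilbert u2 \<Rightarrow> 'h u2 \<Rightarrow> 'h u2" where
  "jordan A B = (THE C. u2_apply C = (\<lambda>x. \<i> *\<^sub>C (u2_apply A (u2_apply B x) + u2_apply B (u2_apply A x))))"

lemma norm_i [simp]: "norm (\<i> *\<^sub>C x :: 'h::complex_hilbert) = norm x"
  by (simp add: norm_scaleC)

lemma u2_apply_jordan:
  "u2_apply (jordan A B) x = \<i> *\<^sub>C (u2_apply A (u2_apply B x) + u2_apply B (u2_apply A x))"
proof -
  let ?f = "\<lambda>x. \<i> *\<^sub>C (u2_apply A (u2_apply B x) + u2_apply B (u2_apply A x))"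
  obtain C where C: "u2_apply C = ?f"
  proof (rule ex_u2)
    show "?f (x + y) = ?f x + ?f y" for x y
      by (simp add: linear_add[OF linear_u2_apply] scaleC_add_right)
    show "?f (c *\<^sub>C x) = c *\<^sub>C ?f x" for c x
      by (simp add: u2_apply_scaleC scaleC_add_right scaleC_scaleC mult.commute)
    have 1: "norm (u2_apply A (u2_apply B x)) \<le> norm A * (norm B * norm x)" for A B :: "'a u2" and x
      by (rule order.trans[OF norm_u2_apply_le mult_left_mono[OF norm_u2_apply_le norm_ge_zero]])
    show "norm (?f x) \<le> (norm A * norm B + norm B * norm A) * norm x" for x
      using norm_triangle_ineq[of "u2_apply A (u2_apply B x)" "u2_apply B (u2_apply A x)"]
        1[of A B x] 1[of B A x] by (simp only: norm_i) (simp add: algebra_simps)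
    show "hilbert_schmidt ?f"
      by (rule hilbert_schmidt_dominated[OF hilbert_schmidt_add[OF hilbert_schmidt_comp_left[of A B]
              hilbert_schmidt_comp_left[of B A]], where C = 1]) simp
    show "cinner (?f x) y = - cinner x (?f y)" for x y
      by (simp add: cinner_scaleC_left cinner_scaleC_right cinner_add_left cinner_add_right u2_cinner
          cinner_minus_right algebra_simps)
  qed
  then have "jordan A B = C" unfolding jordan_def
    by (intro the_equality) (auto simp: u2_eq_iff)
  with C show ?thesis by simp
qed

lemma opr_jordan: "opr (jordan A B) = i_op * (opr A * opr B + opr B * opr A)"
  by (rule endo_eqI) (simp add: u2_apply_jordan)

text \<open>Serves Jordan products and commutators alike: in each of the two words one factor is
  measured in operator norm and the other in Hilbert-Schmidt norm. Squaring with
  \<open>(p + q)^2 \<le> 2 p^2 + 2 q^2\<close> still gives the constant 2 of the triangle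
  inequality.\<close>

lemma norm_u2_le_sum:
  assumes "\<And>x. norm (u2_apply S x) \<le> norm A * norm (u2_apply B x) + norm B * norm (u2_apply A x)"
  shows "norm S \<le> 2 * norm A * norm B"
proof (rule power2_le_imp_le)
  have "(norm (u2_apply S x))\<^sup>2
      \<le> 2 * (norm A)\<^sup>2 * (norm (u2_apply B x))\<^sup>2 + 2 * (norm B)\<^sup>2 * (norm (u2_apply A x))\<^sup>2" for x
  proof -
    have "(norm (u2_apply S x))\<^sup>2 \<le> (norm A * norm (u2_apply B x) + norm B * norm (u2_apply A x))\<^sup>2"
      using assms by (rule power_mono) simp
    also have "\<dots> \<le> 2 * (norm A * norm (u2_apply B x))\<^sup>2 + 2 * (norm B * norm (u2_apply A x))\<^sup>2"
      using sum_squares_bound[of "norm A * norm (u2_apply B x)" "norm B * norm (u2_apply A x)"]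
      by (simp add: power2_sum)
    finally show ?thesis by (simp add: power_mult_distrib mult.assoc)
  qed
  then have "(norm S)\<^sup>2 \<le> 2 * (norm A)\<^sup>2 * (norm B)\<^sup>2 + 2 * (norm B)\<^sup>2 * (norm A)\<^sup>2"
    by (intro has_sum_mono[OF u2_norm_sq_has_sum
        has_sum_add[OF has_sum_cmult_right[OF u2_norm_sq_has_sum] has_sum_cmult_right[OF u2_norm_sq_has_sum]]])
  then show "(norm S)\<^sup>2 \<le> (2 * norm A * norm B)\<^sup>2" by (simp add: power_mult_distrib)
qed simp

lemma norm_jordan_le: "norm (jordan A B) \<le> 2 * norm A * norm B"
proof (rule norm_u2_le_sum)
  show "norm (u2_apply (jordan A B) x) \<le> norm A * norm (u2_apply B x) + norm B * norm (u2_apply A x)" for x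
    using norm_triangle_le[OF add_mono[OF norm_u2_apply_le norm_u2_apply_le]]
    by (simp add: u2_apply_jordan)
qed

lemma norm_commutator_le: "norm (u2_commutator A B) \<le> 2 * norm A * norm B"
proof (rule norm_u2_le_sum)
  show "norm (u2_apply (u2_commutator A B) x) \<le> norm A * norm (u2_apply B x) + norm B * norm (u2_apply A x)" for x
    using order.trans[OF norm_triangle_ineq4 add_mono[OF norm_u2_apply_le norm_u2_apply_le]]
    by (simp add: u2_commutator_apply)
qed

lemma bounded_bilinear_jordan: "bounded_bilinear jordan"
proof
  show "jordan (A + A') B = jordan A B + jordan A' B" "jordan A (B + B') = jordan A B + jordan A B'"
    "jordan (r *\<^sub>R A) B = r *\<^sub>R jordan A B" "jordan A (r *\<^sub>R B) = r *\<^sub>R jordan A B"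
    for A A' B B' :: "'a u2" and r
    by (simp_all add: opr_inject[symmetric] opr_jordan algebra_simps)
  show "\<exists>K. \<forall>A B :: 'a u2. norm (jordan A B) \<le> norm A * norm B * K"
    by (intro exI[of _ 2] allI order.trans[OF norm_jordan_le]) (simp add: mult_ac)
qed

lemma bounded_bilinear_commutator: "bounded_bilinear u2_commutator"
proof
  show "u2_commutator (A + A') B = u2_commutator A B + u2_commutator A' B"
    "u2_commutator A (B + B') = u2_commutator A B + u2_commutator A B'"
    "u2_commutator (r *\<^sub>R A) B = r *\<^sub>R u2_commutator A B"
    "u2_commutator A (r *\<^sub>R B) = r *\<^sub>R u2_commutator A B"
    for A A' B B' :: "'a u2" and r
    by (simp_all add: opr_inject[symmetric] algebra_simps)
  show "\<exists>K. \<forall>A B :: 'a u2. norm (u2_commutator A B) \<le> norm A * norm B * K"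
    by (intro exI[of _ 2] allI order.trans[OF norm_commutator_le]) (simp add: mult_ac)
qed

text \<open>This is the Jordan triple product \<open>A B C + C B A\<close>. Each iterated Jordan
  product is minus a sum of four words; in the combination the words with \<open>B\<close> at an end
  cancel and the other two appear twice, hence the factor \<open>- 1 / 2\<close>. Being built from
  \<open>jordan\<close>, it stays in \<open>u2\<close> and is bounded.\<close>

definition triple :: "'h::complex_hilbert u2 \<Rightarrow> 'h u2 \<Rightarrow> 'h u2 \<Rightarrow> 'h u2" where
  "triple A B C = (- 1 / 2) *\<^sub>R (jordan (jordan A B) C + jordan (jordan C B) A - jordan (jordan A C) B)"

lemma opr_triple: "opr (triple A B C) = opr A * opr B * opr C + opr C * opr B * opr A"
proof -
  let ?s = "opr A * opr B * opr C + opr C * opr B * opr A"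
  have "opr (triple A B C) = (- 1 / 2) *\<^sub>R (- (?s + ?s))"
    unfolding triple_def
    by (simp add: opr_jordan algebra_simps opr_i_op_left i_op_i_op_left)
  also have "\<dots> = ?s" by (simp add: scaleR_add_right[symmetric] scaleR_2[symmetric])
  finally show ?thesis .
qed

lemma norm_triple_le: "norm (triple A B C) \<le> 6 * norm A * norm B * norm C"
proof -
  have 1: "norm (jordan (jordan A B) C) \<le> 4 * norm A * norm B * norm C" for A B C :: "'a u2"
    using order.trans[OF norm_jordan_le mult_right_mono[OF mult_left_mono[OF norm_jordan_le]]]
    by (force simp: mult_ac)
  have "norm (jordan (jordan A B) C + jordan (jordan C B) A - jordan (jordan A C) B)
      \<le> 12 * norm A * norm B * norm C"
    using 1[of A B C] 1[of C B A] 1[of A C B]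
      norm_triangle_ineq4[of "jordan (jordan A B) C + jordan (jordan C B) A" "jordan (jordan A C) B"]
      norm_triangle_ineq[of "jordan (jordan A B) C" "jordan (jordan C B) A"]
    by (simp add: mult_ac)
  then show ?thesis by (simp add: triple_def)
qed

section \<open>Invariance of the trace form\<close>

text \<open>\<open>?f = A + i B\<close> and its adjoint \<open>?g = - A + i B\<close> have equal
  Hilbert-Schmidt norms, and their squared norms at \<open>e\<close> differ by four times the
  summand. This expresses that \<open>Tr (A B)\<close> is real.\<close>

lemma infsum_inner_i:
  "(\<Sum>\<^sub>\<infinity>e\<in>onb. inner (u2_apply A e) (\<i> *\<^sub>C u2_apply B e)) = 0"
proof -
  let ?f = "\<lambda>x. u2_apply A x + \<i> *\<^sub>C u2_apply B x"
  let ?g = "\<lambda>x. - u2_apply A x + \<i> *\<^sub>C u2_apply B x"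
  let ?s = "\<lambda>e. inner (u2_apply A e) (\<i> *\<^sub>C u2_apply B e)"
  have hs_i: "hilbert_schmidt (\<lambda>x. \<i> *\<^sub>C u2_apply B x)"
    by (rule hilbert_schmidt_dominated[OF u2_hs[of B], where C = 1]) simp
  have f: "hilbert_schmidt ?f" by (rule hilbert_schmidt_add[OF u2_hs hs_i])
  have adj: "cinner (?f x) y = cinner x (?g y)" for x y
    by (simp add: cinner_add_left cinner_add_right cinner_scaleC_left cinner_scaleC_right u2_cinner
        cinner_diff_right)
  have F: "((\<lambda>e. (norm (?f e))\<^sup>2) has_sum (\<Sum>\<^sub>\<infinity>e\<in>onb. (norm (?f e))\<^sup>2)) onb"
    using f by (simp add: hilbert_schmidt_def)
  have G: "((\<lambda>e. (norm (?g e))\<^sup>2) has_sum (\<Sum>\<^sub>\<infinity>e\<in>onb. (norm (?f e))\<^sup>2)) onb"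
    unfolding hilbert_schmidt_adjoint(2)[OF f adj, symmetric]
    by (rule has_sum_infsum) (rule hilbert_schmidt_adjoint(1)[OF f adj, unfolded hilbert_schmidt_def])
  have "((\<lambda>e. (norm (?f e))\<^sup>2 + (- 1) * (norm (?g e))\<^sup>2) has_sum
      ((\<Sum>\<^sub>\<infinity>e\<in>onb. (norm (?f e))\<^sup>2) + (- 1) * (\<Sum>\<^sub>\<infinity>e\<in>onb. (norm (?f e))\<^sup>2))) onb"
    by (rule has_sum_add[OF F has_sum_cmult_right[OF G]])
  then have "((\<lambda>e. 4 * ?s e) has_sum 0) onb"
    by (simp add: power2_norm_eq_inner inner_add_left inner_add_right inner_commute
        inner_diff_left inner_diff_right)
  from has_sum_cmult_right[OF this, of "1/4"] have "(?s has_sum 0) onb" by simp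
  then show ?thesis by (rule infsumI)
qed

lemma u2_inner: "inner (u2_apply A x) y = - inner x (u2_apply A y)"
  using arg_cong[OF u2_cinner[of A x y], of Re] by (simp add: Re_cinner)

text \<open>Moving operators across by skew-adjointness reduces the difference of the two sides to a
  sum of the form treated in \<open>infsum_inner_i\<close>, with \<open>B\<close> against the Jordan
  product of \<open>A\<close> and \<open>M\<close>. This is the invariance of the trace form under
  the adjoint action.\<close>

lemma inner_commutator: "inner (u2_commutator A B) M = inner A (u2_commutator B M)"
proof -
  have "inner (u2_commutator A B) M - inner A (u2_commutator B M)
    = (\<Sum>\<^sub>\<infinity>e\<in>onb. inner (u2_apply (u2_commutator A B) e) (u2_apply M e)
        - inner (u2_apply A e) (u2_apply (u2_commutator B M) e))"

    using has_sum_add[OF has_sum_infsum[OF summable_inner_u2[of "u2_commutator A B" M]]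
        has_sum_cmult_right[OF has_sum_infsum[OF summable_inner_u2[of A "u2_commutator B M"]], of "-1"]]
    by (simp add: inner_u2_def infsumI)
  also have "\<dots> = (\<Sum>\<^sub>\<infinity>e\<in>onb. inner (u2_apply B e) (\<i> *\<^sub>C u2_apply (jordan A M) e))"
  proof (rule infsum_cong)
    fix e
    have "\<i> *\<^sub>C u2_apply (jordan A M) e = - (u2_apply A (u2_apply M e) + u2_apply M (u2_apply A e))"
      unfolding u2_apply_jordan scaleC_scaleC by (simp add: complex_space.scale_minus_left[of 1, simplified])
    then show "inner (u2_apply (u2_commutator A B) e) (u2_apply M e)
        - inner (u2_apply A e) (u2_apply (u2_commutator B M) e)
      = inner (u2_apply B e) (\<i> *\<^sub>C u2_apply (jordan A M) e)"
      using u2_inner[of M "u2_apply A e" "u2_apply B e"] u2_inner[of A "u2_apply M e" "u2_apply B e"]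
        u2_inner[of B "u2_apply A e" "u2_apply M e"]
      by (simp add: u2_commutator_apply inner_diff_left inner_diff_right inner_commute)
  qed
  also have "\<dots> = 0" by (rule infsum_inner_i)
  finally show ?thesis by simp
qed

lemma pairing_eq: "pairing A B = - inner A B"
proof -
  have eq: "cinner e ((u2_apply A \<circ> u2_apply B) e) = - cinner (u2_apply A e) (u2_apply B e)" for e
    by (simp add: u2_cinner)
  have "(\<lambda>e. cinner (u2_apply A e) (u2_apply B e)) summable_on onb"
  proof (rule abs_summable_summable, rule summable_on_comparison_test)
    show "(\<lambda>e. (norm (u2_apply A e))\<^sup>2 + (norm (u2_apply B e))\<^sup>2) summable_on onb"
      using u2_hs[of A] u2_hs[of B] unfolding hilbert_schmidt_def by (rule summable_on_add)
    fix e
    have "2 * (norm (u2_apply A e) * norm (u2_apply B e)) \<le> (norm (u2_apply A e))\<^sup>2 + (norm (u2_apply B e))\<^sup>2"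
      using sum_squares_bound[of "norm (u2_apply A e)" "norm (u2_apply B e)"] by simp
    moreover have "0 \<le> norm (u2_apply A e) * norm (u2_apply B e)" by simp
    ultimately show "norm (cinner (u2_apply A e) (u2_apply B e)) \<le> (norm (u2_apply A e))\<^sup>2 + (norm (u2_apply B e))\<^sup>2"
      using cmod_cinner_le[of "u2_apply A e" "u2_apply B e"] by linarith
  qed simp
  from infsum_Re[OF this] show ?thesis
    unfolding pairing_def op_trace_def eq infsum_uminus by (simp add: Re_cinner inner_u2_def)
qed

section \<open>The Cayley transform\<close>

text \<open>With \<open>g = (1 - X)^{-1} (1 + X)\<close> the hypotheses are
  \<open>A' = g A g^{-1}\<close> and \<open>B' = g B g^{-1}\<close> with denominators cleared. The
  cancellation in the middle works because \<open>r\<close>, the inverse of \<open>1 - X\<close>,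
  commutes with \<open>1 + X\<close>.\<close>

lemma intertwining_mult:
  fixes X :: "'a::{ring,monoid_mult}"
  assumes r: "r * (1 - X) = 1" "(1 - X) * r = 1"
    and A: "(1 - X) * A' * (1 + X) = (1 + X) * A * (1 - X)"
    and B: "(1 - X) * B' * (1 + X) = (1 + X) * B * (1 - X)"
  shows "(1 - X) * (A' * B') * (1 + X) = (1 + X) * (A * B) * (1 - X)"
proof -
  have comm: "(1 - X) * (1 + X) = (1 + X) * (1 - X)" by (simp add: algebra_simps)
  have "r * (1 + X) = r * ((1 + X) * (1 - X)) * r" using r by (simp add: mult.assoc)
  also have "\<dots> = (r * (1 - X)) * (1 + X) * r" by (simp only: comm[symmetric] mult.assoc)
  finally have rp: "r * (1 + X) = (1 + X) * r" using r by simp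
  have "B' * (1 + X) = r * ((1 - X) * B' * (1 + X))" using r by (simp only: mult.assoc[symmetric]) simp
  also have "\<dots> = r * (1 + X) * (B * (1 - X))" unfolding B by (simp only: mult.assoc)
  finally have 1: "B' * (1 + X) = (1 + X) * (r * B * (1 - X))" by (simp only: rp mult.assoc)
  have "(1 - X) * (A' * B') * (1 + X) = (1 - X) * A' * (B' * (1 + X))" by (simp only: mult.assoc)
  also have "\<dots> = ((1 - X) * A' * (1 + X)) * (r * B * (1 - X))" unfolding 1 by (simp only: mult.assoc)
  also have "\<dots> = (1 + X) * A * ((1 - X) * r) * (B * (1 - X))" unfolding A by (simp only: mult.assoc)
  finally show ?thesis using r by (simp add: mult.assoc)
qed

lemma endo_inverse:
  assumes "norm X < 1"
  obtains r where "r * (1 - opr X) = 1" "(1 - opr X) * r = 1"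
proof -
  have ex: "\<exists>!z. z = w + u2_apply X z" for w
    by (rule neumann_fixed_point[OF linear_u2_apply norm_u2_apply_le assms])
  define g where "g w = (THE z. z = w + u2_apply X z)" for w
  have g: "g w = w + u2_apply X (g w)" for w
    unfolding g_def by (rule theI'[OF ex])
  have gI: "z = g w" if "z = w + u2_apply X z" for z w
    using ex[of w] g that by blast
  have "linear g"
  proof (rule linearI)
    show "g (x + y) = g x + g y" for x y
      by (rule gI[symmetric], subst g[of x], subst g[of y]) (simp add: linear_add[OF linear_u2_apply])
    show "g (c *\<^sub>R x) = c *\<^sub>R g x" for c x
      by (rule gI[symmetric], subst g[of x]) (simp add: linear_scale[OF linear_u2_apply] scaleR_add_right)
  qed
  then have app: "endo_apply (Abs_endo g) x = g x" for x
    unfolding endo_apply.rep_eq by (simp add: Abs_endo_inverse)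
  show thesis
  proof (rule that[of "Abs_endo g"])
    show "Abs_endo g * (1 - opr X) = 1"
      by (rule endo_eqI) (simp add: app gI[symmetric])
    show "(1 - opr X) * Abs_endo g = 1"
      by (rule endo_eqI) (simp add: app, metis g add_diff_cancel_right')
  qed
qed

text \<open>By \<open>opr_cayL\<close>, the map \<open>cayL X\<close> is
  \<open>B \<mapsto> (1 - X) B (1 + X)\<close>; \<open>cayN X\<close> is the identity minus
  \<open>cayL X\<close>, which turns the inverse \<open>cayC X\<close> into a fixed point problem.
  Half of \<open>triple X B X\<close> is \<open>X B X\<close>.\<close>

definition cayN :: "'h::complex_hilbert u2 \<Rightarrow> 'h u2 \<Rightarrow> 'h u2" where
  "cayN X B = u2_commutator X B + (1/2) *\<^sub>R triple X B X"

definition cayL :: "'h::complex_hilbert u2 \<Rightarrow> 'h u2 \<Rightarrow> 'h u2" where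
  "cayL X B = B - cayN X B"

definition cayC :: "'h::complex_hilbert u2 \<Rightarrow> 'h u2 \<Rightarrow> 'h u2" where
  "cayC X W = (THE B. B = W + cayN X B)"

lemma opr_cayN: "opr (cayN X B) = opr X * opr B - opr B * opr X + opr X * opr B * opr X"
  by (simp add: cayN_def opr_triple scaleR_2[symmetric])

lemma opr_cayL: "opr (cayL X B) = (1 - opr X) * opr B * (1 + opr X)"
  by (simp add: cayL_def opr_cayN algebra_simps)

lemma linear_cayN: "linear (cayN X)"
  by (rule linearI) (simp_all add: opr_inject[symmetric] opr_cayN algebra_simps)

lemma linear_cayL: "linear (cayL X)"
  by (rule linearI) (simp_all add: opr_inject[symmetric] opr_cayL algebra_simps)

text \<open>Source of the radius 1/20: the commutator contributes 2/20 and the triple product 3/400,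
  together less than 1/8.\<close>

lemma norm_cayN_le:
  assumes "norm X \<le> 1/20"
  shows "norm (cayN X B) \<le> 1/8 * norm B"
proof -
  have "norm (cayN X B) \<le> norm (u2_commutator X B) + 1/2 * norm (triple X B X)"
    unfolding cayN_def by (rule order.trans[OF norm_triangle_ineq]) simp
  also have "\<dots> \<le> 2 * norm X * norm B + 1/2 * (6 * norm X * norm B * norm X)"
    by (intro add_mono mult_left_mono norm_commutator_le norm_triple_le) simp
  also have "\<dots> = (2 * norm X + 3 * (norm X * norm X)) * norm B" by (simp add: algebra_simps)
  also have "\<dots> \<le> (2 * (1/20) + 3 * (1/20 * (1/20))) * norm B"
    by (intro mult_right_mono add_mono mult_mono mult_left_mono assms) auto
  also have "\<dots> \<le> 1/8 * norm B" by (rule mult_right_mono) auto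
  finally show ?thesis .
qed

lemma cayL_eq_iff: "cayL X B = W \<longleftrightarrow> B = W + cayN X B"
  by (auto simp: cayL_def algebra_simps)

context
  fixes X :: "'h::complex_hilbert u2"
  assumes X: "norm X \<le> 1/20"
begin

lemma cayC_unique: "\<exists>!B. B = W + cayN X B"
  by (rule neumann_fixed_point[OF linear_cayN norm_cayN_le[OF X]]) simp

lemma cayL_cayC: "cayL X (cayC X W) = W"
  unfolding cayL_eq_iff unfolding cayC_def by (rule theI'[OF cayC_unique])

lemma cayL_cancel: "cayL X A = cayL X B \<longleftrightarrow> A = B"
  using cayC_unique[of "cayL X B"] cayL_eq_iff[of X] by metis

lemma cayC_cayL: "cayC X (cayL X B) = B"
  using cayL_cancel cayL_cayC by blast

lemma linear_cayC: "linear (cayC X)"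
  by (rule linearI)
    (simp_all add: cayL_cancel[symmetric] cayL_cayC linear_add[OF linear_cayL] linear_scale[OF linear_cayL])

lemma norm_cayC_le: "norm (cayC X W) \<le> 8/7 * norm W"
proof -
  have "cayC X W = W + cayN X (cayC X W)" using cayL_cayC cayL_eq_iff by blast
  then have "norm (cayC X W) \<le> norm W + norm (cayN X (cayC X W))" by (metis norm_triangle_ineq)
  with norm_cayN_le[OF X, of "cayC X W"] show ?thesis by linarith
qed

end

section \<open>Ring identities for tangent vectors and for coinciding orbit points\<close>

text \<open>Differentiating equation \<open>b\<close> along \<open>V\<close> makes
  \<open>(1 - X) b' (1 + X)\<close> equal to the left-hand side. After regrouping into
  \<open>V b (1 + X) - (1 - X) b V\<close> and factoring \<open>V\<close>, the point
  \<open>b\<close> enters only through \<open>(1 - X) b (1 + X)\<close>. The outcome says that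
  \<open>b'\<close> is the Cayley conjugate of \<open>2 [F, a]\<close>.\<close>

lemma cayley_tangent_identity:
  fixes X :: "'a::{ring,monoid_mult}"
  assumes b: "(1 - X) * b * (1 + X) = (X * a - a * X) + (X * a - a * X)"
    and V: "V = (1 + X) * F * (1 - X)"
  shows "(V * a - a * V) + (V * a - a * V) + (V * b - b * V) + (V * b * X + X * b * V)
    = (1 + X) * ((F * a - a * F) + (F * a - a * F)) * (1 - X)"
proof -
  have 1: "V * b * (1 + X) = (1 + X) * F * ((1 - X) * b * (1 + X))"
    "(1 - X) * b * V = ((1 - X) * b * (1 + X)) * F * (1 - X)"
    by (simp_all only: V mult.assoc)
  have "(V * a - a * V) + (V * a - a * V) + (V * b - b * V) + (V * b * X + X * b * V)
    = (V * a - a * V) + (V * a - a * V) + V * b * (1 + X) - (1 - X) * b * V"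
    by (simp add: algebra_simps)
  also have "\<dots> = (1 + X) * ((F * a - a * F) + (F * a - a * F)) * (1 - X)"
    unfolding 1 b unfolding V by (simp add: algebra_simps)
  finally show ?thesis .
qed

lemma double_eq_iff: "x + x = y + y \<longleftrightarrow> x = (y :: 'a::real_vector)"
  by (metis scaleR_2 scaleR_cancel_left zero_neq_numeral)

text \<open>Finite-difference counterpart of \<open>cayley_tangent_identity\<close>: the parameters
  \<open>q + e\<close> and \<open>q - e\<close> share the point \<open>b\<close>. Half the sum and
  half the difference of the two equations give \<open>e2\<close> and \<open>e1\<close>; the
  quadratic term \<open>e b e\<close> of the former becomes \<open>f [e, a] f\<close>. The outer
  factors form \<open>cayL (- q)\<close>, which is injective for small \<open>q\<close>.\<close>

lemma cayley_secant_identity: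
  fixes q e f a b :: "'a::{real_algebra,monoid_mult}"
  assumes X: "(1 - (q + e)) * b * (1 + (q + e)) = ((q + e) * a - a * (q + e)) + ((q + e) * a - a * (q + e))"
    and Y: "(1 - (q - e)) * b * (1 + (q - e)) = ((q - e) * a - a * (q - e)) + ((q - e) * a - a * (q - e))"
    and e: "e = (1 + q) * f * (1 - q)"
  shows "(1 + q) * ((f * a - a * f) - f * (e * a - a * e) * f) * (1 - q) = 0"
proof -
  have e2: "(1 - q) * b * (1 + q) = (q * a - a * q) + (q * a - a * q) + e * b * e"
  proof (subst double_eq_iff[symmetric])
    have "(1 - q) * b * (1 + q) + (1 - q) * b * (1 + q)
      = (1 - (q + e)) * b * (1 + (q + e)) + (1 - (q - e)) * b * (1 + (q - e)) + e * b * e + e * b * e"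
      by (simp add: algebra_simps)
    then show "(1 - q) * b * (1 + q) + (1 - q) * b * (1 + q)
      = (q * a - a * q) + (q * a - a * q) + e * b * e + ((q * a - a * q) + (q * a - a * q) + e * b * e)"
      unfolding X Y by (simp add: algebra_simps)
  qed
  have e1: "(1 - q) * b * e - e * b * (1 + q) = (e * a - a * e) + (e * a - a * e)"
  proof (subst double_eq_iff[symmetric])
    have "((1 - q) * b * e - e * b * (1 + q)) + ((1 - q) * b * e - e * b * (1 + q))
      = (1 - (q + e)) * b * (1 + (q + e)) - (1 - (q - e)) * b * (1 + (q - e))"
      by (simp add: algebra_simps)
    then show "((1 - q) * b * e - e * b * (1 + q)) + ((1 - q) * b * e - e * b * (1 + q))
      = (e * a - a * e) + (e * a - a * e) + ((e * a - a * e) + (e * a - a * e))"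
      unfolding X Y by (simp add: algebra_simps)
  qed
  have 1: "e * b * (1 + q) = (1 + q) * f * ((1 - q) * b * (1 + q))"
    and 2: "(1 - q) * b * e = ((1 - q) * b * (1 + q)) * f * (1 - q)"
    by (simp_all only: e mult.assoc)
  have 3: "(1 + q) * f * (e * b * e) = (1 + q) * (f * (e * b * (1 + q)) * f) * (1 - q)"
    and 4: "(e * b * e) * f * (1 - q) = (1 + q) * (f * ((1 - q) * b * e) * f) * (1 - q)"
    using arg_cong[OF e, of "\<lambda>x. (1 + q) * f * (e * b * x)"]
      arg_cong[OF e, of "\<lambda>x. (x * b * e) * f * (1 - q)"] by (simp_all only: mult.assoc)
  let ?df = "f * a - a * f" and ?de = "e * a - a * e"
  have "0 = e * b * (1 + q) - (1 - q) * b * e + (?de + ?de)" unfolding e1[symmetric] by simp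
  also have "\<dots> = (1 + q) * f * ((q * a - a * q) + (q * a - a * q)) - ((q * a - a * q) + (q * a - a * q)) * f * (1 - q)
       + ((1 + q) * f * (e * b * e) - (e * b * e) * f * (1 - q)) + (?de + ?de)"
    unfolding 1 2 e2 by (simp add: algebra_simps)
  also have "\<dots> = (1 + q) * (?df + ?df) * (1 - q) + ((1 + q) * f * (e * b * e) - (e * b * e) * f * (1 - q))"
    unfolding e[THEN arg_cong, of "\<lambda>x. x * a - a * x"] by (simp add: algebra_simps)
  also have "(1 + q) * f * (e * b * e) - (e * b * e) * f * (1 - q)
     = - ((1 + q) * (f * ((1 - q) * b * e - e * b * (1 + q)) * f) * (1 - q))"
    unfolding 3 4 by (simp add: algebra_simps)
  also have "\<dots> = - ((1 + q) * (f * (?de + ?de) * f) * (1 - q))" unfolding e1 ..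
  finally have "(1 + q) * (?df - f * ?de * f) * (1 - q) + (1 + q) * (?df - f * ?de * f) * (1 - q) = 0 + 0"
    by (simp add: algebra_simps)
  then show ?thesis unfolding double_eq_iff .
qed

text \<open>The hypothesis is the sum of \<open>z + z e f = f\<close> and
  \<open>z + f e z = f\<close>, the two one-sided equations of a quasi-inverse. To separate them,
  multiply by \<open>e f\<close> on the right and by \<open>f e\<close> on the left and subtract:
  the defect \<open>w\<close> solves the homogeneous equation.\<close>

lemma quasi_inverse_symmetric:
  fixes z e f :: "'a::real_algebra"
  assumes z: "z + z + (z * e * f + f * e * z) = f + f"
  defines "w \<equiv> z * e * f - f * e * z"
  shows "w + w + (w * e * f + f * e * w) = 0"
proof -
  from arg_cong[OF z, of "\<lambda>x. x * e * f"] arg_cong[OF z, of "\<lambda>x. f * e * x"]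
  have "z * e * f + z * e * f + (z * e * f * e * f + f * e * z * e * f)
    = f * e * z + f * e * z + (f * e * z * e * f + f * e * f * e * z)"
    by (simp add: algebra_simps)
  then show ?thesis unfolding w_def by (simp add: algebra_simps)
qed

text \<open>Take the commutator of each one-sided equation with \<open>a\<close> and trade
  \<open>[f, a]\<close> for \<open>f [e, a] f\<close>: everything cancels except a homogeneous
  equation for \<open>[z, a]\<close>.\<close>

lemma quasi_inverse_commutes:
  fixes z e f a :: "'a::real_algebra"
  assumes z: "z + z * e * f = f" "z + f * e * z = f"
    and f: "f * a - a * f = f * (e * a - a * e) * f"
  defines "w \<equiv> z * a - a * z"
  shows "w + w + (w * e * f + f * e * w) = 0"
proof -
  let ?df = "f * a - a * f" and ?de = "e * a - a * e"
  have "w + w * e * f + (z + z * e * f) * ?de * f - f * ?de * f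
      = w + w * e * f + z * ?de * f + z * e * (f * ?de * f) - f * ?de * f"
    by (simp add: algebra_simps)
  also have "\<dots> = w + w * e * f + z * ?de * f + z * e * ?df - ?df" by (simp only: f)
  also have "\<dots> = (z + z * e * f) * a - a * (z + z * e * f) - ?df"
    unfolding w_def by (simp add: algebra_simps)
  finally have 1: "w + w * e * f = 0" unfolding z by simp
  have "w + f * e * w + f * ?de * (z + f * e * z) - f * ?de * f
      = w + f * e * w + f * ?de * z + (f * ?de * f) * e * z - f * ?de * f"
    by (simp add: algebra_simps)
  also have "\<dots> = w + f * e * w + f * ?de * z + ?df * e * z - ?df" by (simp only: f)
  also have "\<dots> = (z + f * e * z) * a - a * (z + f * e * z) - ?df"
    unfolding w_def by (simp add: algebra_simps)
  finally have "w + f * e * w = 0" unfolding z by simp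
  with 1 show ?thesis by (simp add: algebra_simps) (metis add.assoc add.commute add.left_neutral)
qed


section \<open>The orbit map on the slice\<close>

text \<open>The operator \<open>\<mu> + \<gamma> d\<close> is in general not Hilbert-Schmidt, but
  its commutators with elements of \<open>u2\<close> are. Hence \<open>a\<close> is an endomorphism
  used in ring identities, and the analysis goes through the bounded map
  \<open>\<delta>\<close>.\<close>

locale coadjoint =
  fixes a :: "'h::complex_hilbert endo" and \<delta> :: "'h u2 \<Rightarrow> 'h u2"
  assumes bounded_linear_\<delta>: "bounded_linear \<delta>"
    and opr_\<delta>: "opr (\<delta> B) = opr B * a - a * opr B"
begin

definition stab :: "'h u2 set" where
  "stab = {\<kappa>. \<delta> \<kappa> = 0}"

definition slice :: "'h u2 set" where
  "slice = {V. \<forall>\<kappa>\<in>stab. inner V \<kappa> = 0}"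

definition orbit :: "'h u2 \<Rightarrow> 'h u2" where
  "orbit X = cayC X (2 *\<^sub>R \<delta> X)"

sublocale \<delta>: bounded_linear \<delta>
  by (rule bounded_linear_\<delta>)

lemma subspace_stab: "subspace stab"
  unfolding stab_def subspace_def by (simp add: \<delta>.zero \<delta>.add \<delta>.scaleR)

lemma closed_stab: "closed stab"
  unfolding stab_def
  by (intro closed_Collect_eq continuous_intros linear_continuous_on bounded_linear_\<delta>)

lemma subspace_slice: "subspace slice"
  unfolding slice_def subspace_def by (simp add: inner_add_left)

lemma closed_slice: "closed slice"
proof -
  have "slice = (\<Inter>\<kappa>\<in>stab. {V. inner V \<kappa> = 0})" by (auto simp: slice_def)
  then show ?thesis by (auto intro!: closed_INT closed_Collect_eq continuous_intros)
qed

lemma cayL_orbit: "norm X \<le> 1/20 \<Longrightarrow> cayL X (orbit X) = 2 *\<^sub>R \<delta> X"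
  unfolding orbit_def by (rule cayL_cayC)

lemma opr_cayL_orbit:
  assumes "norm X \<le> 1/20"
  shows "(1 - opr X) * opr (orbit X) * (1 + opr X)
    = (opr X * a - a * opr X) + (opr X * a - a * opr X)"
  using arg_cong[OF cayL_orbit[OF assms], of opr] by (simp add: opr_cayL opr_\<delta> scaleR_2)

text \<open>The hypothesis says that \<open>B\<close> is the conjugate of \<open>\<Phi>\<close> by the Cayley transform of
  \<open>X\<close>, which conjugates \<open>a\<close> to \<open>a + orbit X\<close>.\<close>

lemma \<delta>_equivariant:
  assumes X: "norm X \<le> 1/20" and B: "cayL X B = cayL (- X) \<Phi>"
  shows "cayL X (\<delta> B + u2_commutator B (orbit X)) = cayL (- X) (\<delta> \<Phi>)"
proof -
  obtain r where r: "r * (1 - opr X) = 1" "(1 - opr X) * r = 1"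
    using endo_inverse[of X] X by auto
  let ?b = "a + opr (orbit X)"
  have b: "(1 - opr X) * ?b * (1 + opr X) = (1 + opr X) * a * (1 - opr X)"
    using opr_cayL_orbit[OF X] by (simp add: algebra_simps)
  have B': "(1 - opr X) * opr B * (1 + opr X) = (1 + opr X) * opr \<Phi> * (1 - opr X)"
    using arg_cong[OF B, of opr] by (simp add: opr_cayL)
  have "opr (cayL X (\<delta> B + u2_commutator B (orbit X)))
      = (1 - opr X) * (opr B * ?b) * (1 + opr X) - (1 - opr X) * (?b * opr B) * (1 + opr X)"
    by (simp add: opr_cayL opr_\<delta> algebra_simps)
  also have "\<dots> = opr (cayL (- X) (\<delta> \<Phi>))"
    unfolding intertwining_mult[OF r B' b] intertwining_mult[OF r b B']
    by (simp add: opr_cayL opr_\<delta> algebra_simps)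
  finally show ?thesis unfolding opr_inject .
qed

text \<open>Adding \<open>\<kappa>\<close> from \<open>stab\<close> to \<open>\<Phi>\<close> leaves
  \<open>\<delta> \<Phi>\<close> unchanged. With the projection \<open>P\<close> onto
  \<open>stab\<close>, the vector \<open>cayL X (\<Phi> + \<kappa>)\<close> is in the slice iff
  \<open>\<kappa> = P (cayN X \<kappa> - cayL X \<Phi>)\<close>; this is a contraction since
  \<open>P\<close> is nonexpansive.\<close>

lemma slice_complement:
  assumes X: "norm X \<le> 1/20"
  obtains V where "V \<in> slice" "\<delta> (cayC X V) = \<delta> \<Phi>"
proof -
  have "\<exists>y. y \<in> stab \<and> (\<forall>z\<in>stab. inner (x - y) z = 0)" for x
    using closed_subspace_projection[OF subspace_stab closed_stab] by metis
  then obtain P where P: "\<And>x. P x \<in> stab" "\<And>x z. z \<in> stab \<Longrightarrow> inner (x - P x) z = 0"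
    by metis
  have nonexp: "norm (P x - P y) \<le> norm (x - y)" for x y
  proof -
    let ?u = "P x - P y"
    have u: "?u \<in> stab" using subspace_diff[OF subspace_stab P(1) P(1)] .
    have "inner (x - y) ?u = inner ?u ?u"
      using P(2)[OF u, of x] P(2)[OF u, of y] by (simp add: inner_diff_left)
    then have "norm ?u * norm ?u \<le> norm (x - y) * norm ?u"
      using norm_cauchy_schwarz[of "x - y" ?u] by (simp add: dot_square_norm power2_eq_square)
    then show ?thesis by (cases "norm ?u = 0") auto
  qed
  define T where "T \<kappa> = P (cayN X \<kappa> - cayL X \<Phi>)" for \<kappa>
  have "dist (T x) (T y) \<le> 1/8 * dist x y" for x y
    using nonexp[of "cayN X x - cayL X \<Phi>" "cayN X y - cayL X \<Phi>"] norm_cayN_le[OF X, of "x - y"]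
    by (simp add: T_def dist_norm linear_diff[OF linear_cayN])
  then have "\<exists>!\<kappa>. T \<kappa> = \<kappa>" by (intro banach_fix_type[of "1/8"]) auto
  then obtain \<kappa> where \<kappa>: "\<kappa> = T \<kappa>" by metis
  then have "\<kappa> \<in> stab" using P(1) T_def by metis
  show thesis
  proof (rule that[of "cayL X (\<Phi> + \<kappa>)"])
    show "cayL X (\<Phi> + \<kappa>) \<in> slice"
    proof -
      have "inner (cayL X (\<Phi> + \<kappa>)) z = 0" if "z \<in> stab" for z
        using P(2)[OF that, of "cayN X \<kappa> - cayL X \<Phi>", folded T_def, folded \<kappa>]
        by (simp add: linear_add[OF linear_cayL] inner_add_left inner_diff_left cayL_def[of X \<kappa>])
      then show ?thesis by (simp add: slice_def)
    qed
    show "\<delta> (cayC X (cayL X (\<Phi> + \<kappa>))) = \<delta> \<Phi>"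
      using \<open>\<kappa> \<in> stab\<close> by (simp add: cayC_cayL[OF X] \<delta>.add stab_def)
  qed
qed

text \<open>The vector \<open>\<kappa> = cayC X V\<close> is in \<open>stab\<close>, so
  \<open>V = \<kappa> - cayN X \<kappa>\<close> is orthogonal to it; but
  \<open>cayN X \<kappa>\<close> is too short to cancel \<open>\<kappa>\<close>.\<close>

lemma slice_transversal:
  assumes X: "norm X \<le> 1/20" and V: "V \<in> slice" "\<delta> (cayC X V) = 0"
  shows "V = 0"
proof -
  let ?\<kappa> = "cayC X V"
  have "inner V ?\<kappa> = 0" using V by (auto simp: slice_def stab_def)
  moreover have "V = ?\<kappa> - cayN X ?\<kappa>" using cayL_cayC[OF X, of V] by (simp add: cayL_def)
  ultimately have "inner ?\<kappa> ?\<kappa> = inner (cayN X ?\<kappa>) ?\<kappa>" by (metis eq_iff_diff_eq_0 inner_diff_left)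
  also have "\<dots> \<le> norm (cayN X ?\<kappa>) * norm ?\<kappa>" by (rule norm_cauchy_schwarz)
  also have "\<dots> \<le> 1/8 * norm ?\<kappa> * norm ?\<kappa>" by (intro mult_right_mono norm_cayN_le X) simp
  finally have "norm ?\<kappa> * norm ?\<kappa> \<le> 0" by (simp add: dot_square_norm power2_eq_square)
  then have "?\<kappa> = 0" by (auto simp: mult_le_0_iff)
  then show ?thesis using cayL_cayC[OF X, of V] linear_0[OF linear_cayL] by metis
qed

text \<open>\<open>T\<close> is the derivative of \<open>orbit\<close> at \<open>X\<close>. By
  \<open>key\<close> it is \<open>V \<mapsto> 2 \<delta> (cayC (- X) V)\<close> followed by Cayley
  conjugation. The slice lemmas at \<open>- X\<close> then control its kernel and range, and
  equivariance turns conjugates of \<open>[\<Phi>, a]\<close> into commutators with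
  \<open>a + orbit X\<close>.\<close>

lemma tangent_of_orbit:
  assumes X: "norm X \<le> 1/20"
    and T: "\<And>V. cayL X (T V) = 2 *\<^sub>R \<delta> V + u2_commutator V (orbit X) + triple V (orbit X) X"
  shows "inj_on T slice" "T ` slice = range (\<lambda>B. \<delta> B + u2_commutator B (orbit X))"
proof -
  have X': "norm (- X) \<le> 1/20" using X by simp
  have linT: "linear T"
    by (rule linearI; rule cayL_cancel[OF X, THEN iffD1])
      (simp_all add: T linear_add[OF linear_cayL] linear_scale[OF linear_cayL] opr_inject[symmetric]
        opr_triple opr_\<delta> algebra_simps)
  have key: "cayL X (T V) = 2 *\<^sub>R cayL (- X) (\<delta> (cayC (- X) V))" for V
  proof -
    let ?F = "cayC (- X) V"
    have "opr V = (1 + opr X) * opr ?F * (1 - opr X)"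
      using arg_cong[OF cayL_cayC[OF X', of V], of opr] by (simp add: opr_cayL)
    from cayley_tangent_identity[OF opr_cayL_orbit[OF X] this]
    show ?thesis
      unfolding T opr_inject[symmetric] by (simp add: opr_triple opr_\<delta> opr_cayL scaleR_2 algebra_simps)
  qed
  show "inj_on T slice"
  proof (subst linear_inj_on_iff_eq_0[OF linT subspace_slice], intro ballI impI)
    fix V assume V: "V \<in> slice" "T V = 0"
    then have "cayL (- X) (\<delta> (cayC (- X) V)) = cayL (- X) 0"
      using key[of V] linear_0[OF linear_cayL, of X] linear_0[OF linear_cayL, of "- X"] by simp
    then show "V = 0" unfolding cayL_cancel[OF X'] by (rule slice_transversal[OF X' V(1)])
  qed
  show "T ` slice = range (\<lambda>B. \<delta> B + u2_commutator B (orbit X))"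
  proof (intro subset_antisym subsetI)
    fix W assume "W \<in> T ` slice"
    then obtain V where V: "W = T V" by blast
    define B where "B = cayC X V"
    have "cayL X B = cayL (- X) (cayC (- X) V)" by (simp add: B_def cayL_cayC[OF X] cayL_cayC[OF X'])
    from \<delta>_equivariant[OF X this]
    have "cayL X W = cayL X (2 *\<^sub>R (\<delta> B + u2_commutator B (orbit X)))"
      by (simp add: V key linear_scale[OF linear_cayL])
    then have "W = \<delta> (2 *\<^sub>R B) + u2_commutator (2 *\<^sub>R B) (orbit X)"
      unfolding cayL_cancel[OF X] by (simp add: \<delta>.scaleR scaleR_add_right opr_inject[symmetric] algebra_simps)
    then show "W \<in> range (\<lambda>B. \<delta> B + u2_commutator B (orbit X))" by blast
  next
    fix W assume "W \<in> range (\<lambda>B. \<delta> B + u2_commutator B (orbit X))"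
    then obtain B where B: "W = \<delta> B + u2_commutator B (orbit X)" by blast
    obtain V where V: "V \<in> slice" "\<delta> (cayC (- X) V) = \<delta> (cayC (- X) (cayL X B))"
      using slice_complement[OF X'] .
    have "cayL X B = cayL (- X) (cayC (- X) (cayL X B))" by (simp add: cayL_cayC[OF X'])
    \<comment> \<open>The half compensates the factor 2 in \<open>key\<close>.\<close>
    from \<delta>_equivariant[OF X this] have "cayL X (T ((1/2) *\<^sub>R V)) = cayL X W"
      by (simp add: B key V(2)[symmetric] linear_scale[OF linear_cayC[OF X']] \<delta>.scaleR
          linear_scale[OF linear_cayL])
    then have "W = T ((1/2) *\<^sub>R V)" unfolding cayL_cancel[OF X] by simp
    moreover have "(1/2) *\<^sub>R V \<in> slice" using V(1) subspace_scale[OF subspace_slice] by blast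
    ultimately show "W \<in> T ` slice" by blast
  qed
qed

text \<open>If \<open>X\<close> and \<open>Y\<close> give the same point, the product of one Cayley transform with the inverse
  of the other commutes with \<open>a\<close>. The inverse Cayley transform of this product is, up to
  conjugation, the element \<open>z\<close> below; it lies in \<open>stab\<close> and is close to \<open>(X - Y) / 2\<close>, which is
  orthogonal to \<open>stab\<close>.\<close>

lemma inj_on_orbit: "inj_on orbit (slice \<inter> cball 0 (1/20))"
proof (rule inj_onI)
  fix X Y assume "X \<in> slice \<inter> cball 0 (1/20)" "Y \<in> slice \<inter> cball 0 (1/20)" and eq: "orbit X = orbit Y"
  then have X: "X \<in> slice" "norm X \<le> 1/20" and Y: "Y \<in> slice" "norm Y \<le> 1/20" by auto
  define q where "q = (1/2) *\<^sub>R (X + Y)"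
  define e where "e = (1/2) *\<^sub>R (X - Y)"
  have qe: "X = q + e" "Y = q - e"
    by (simp_all add: q_def e_def scaleR_add_right[symmetric] scaleR_diff_right[symmetric] scaleR_2[symmetric])
  have "norm q \<le> 1/20" "norm e \<le> 1/20"
    using norm_triangle_ineq[of X Y] norm_triangle_ineq4[of X Y] X(2) Y(2) by (simp_all add: q_def e_def)
  then have q: "norm (- q) \<le> 1/20" by simp
  have "e \<in> slice"
    unfolding e_def by (intro subspace_scale subspace_diff subspace_slice X Y)
  define f where "f = cayC (- q) e"
  have ef: "cayL (- q) f = e" unfolding f_def by (rule cayL_cayC[OF q])
  have norm_f: "norm f \<le> 1/16"
    using norm_cayC_le[OF q, of e] \<open>norm e \<le> 1/20\<close> by (simp add: f_def)
  have "opr e = (1 + opr q) * opr f * (1 - opr q)"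
    using arg_cong[OF ef, of opr] by (simp add: opr_cayL)
  then have "(1 + opr q) * ((opr f * a - a * opr f) - opr f * (opr e * a - a * opr e) * opr f) * (1 - opr q) = 0"
    using opr_cayL_orbit[OF X(2)] opr_cayL_orbit[OF Y(2)]
    by (intro cayley_secant_identity[where b = "opr (orbit X)"]) (simp_all add: eq, simp_all add: qe)
  then have "opr (cayL (- q) (\<delta> f - (1/2) *\<^sub>R triple f (\<delta> e) f)) = opr (cayL (- q) 0)"
    by (simp add: opr_cayL opr_triple opr_\<delta> scaleR_2[symmetric])
  then have "\<delta> f - (1/2) *\<^sub>R triple f (\<delta> e) f = 0" unfolding opr_inject cayL_cancel[OF q] .
  from arg_cong[OF this, of opr]
  have df: "opr f * a - a * opr f = opr f * (opr e * a - a * opr e) * opr f"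
    by (simp add: opr_triple opr_\<delta> scaleR_2[symmetric])
  \<comment> \<open>The equation \<open>z = f + N z\<close> is the symmetrized quasi-inverse
    equation. It is solved in this form because \<open>triple z e f\<close> lies in
    \<open>u2\<close>, unlike \<open>z e f\<close> alone in general.\<close>
  define N where "N z = - (1/2) *\<^sub>R triple z e f" for z
  have linN: "linear N"
    by (rule linearI) (simp_all add: N_def opr_inject[symmetric] opr_triple algebra_simps)
  have normN: "norm (N z) \<le> 1/100 * norm z" for z
  proof -
    have "norm (N z) \<le> 1/2 * (6 * norm z * norm e * norm f)"
      using norm_triple_le[of z e f] by (simp add: N_def mult_ac)
    also have "\<dots> = 3 * (norm e * norm f) * norm z" by simp
    also have "\<dots> \<le> 3 * (1/20 * (1/16)) * norm z"
      by (intro mult_right_mono mult_left_mono mult_mono \<open>norm e \<le> 1/20\<close> norm_f) auto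
    also have "\<dots> \<le> 1/100 * norm z" by (rule mult_right_mono) auto
    finally show ?thesis .
  qed
  have NN: "N z + N z = - triple z e f" for z
  proof -
    have "N z + N z = - ((1/2) *\<^sub>R (triple z e f + triple z e f))"
      by (simp add: N_def scaleR_add_right)
    then show ?thesis by simp
  qed
  have fix0: "w = 0" if "opr w + opr w + (opr w * opr e * opr f + opr f * opr e * opr w) = 0" for w
  proof -
    have "opr (w + w) = opr (N w + N w)"
      using that[folded eq_neg_iff_add_eq_0] by (simp add: NN opr_triple)
    then have "w = N w" unfolding opr_inject double_eq_iff .
    from normN[of w] have "norm w \<le> 1/100 * norm w" unfolding \<open>w = N w\<close>[symmetric] .
    then show ?thesis by simp
  qed
  have "\<exists>!z. z = f + N z" by (rule neumann_fixed_point[OF linN normN]) simp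
  then obtain z where z: "z = f + N z" by blast
  have z': "opr z + opr z + (opr z * opr e * opr f + opr f * opr e * opr z) = opr f + opr f"
  proof -
    have "z + z = (f + N z) + (f + N z)" using z by simp
    also have "\<dots> = f + f - triple z e f" using NN[of z] by (simp add: algebra_simps)
    finally have "opr (z + z) = opr (f + f - triple z e f)" by simp
    then show ?thesis by (simp add: opr_triple)
  qed
  let ?w = "opr z * opr e * opr f - opr f * opr e * opr z"
  \<comment> \<open>The defect \<open>?w\<close> is self-adjoint, so \<open>fix0\<close> cannot be
    applied to it directly; \<open>\<omega>\<close> represents \<open>2 i ?w\<close> by brackets and
    Jordan products inside \<open>u2\<close>.\<close>
  define \<omega> where "\<omega> = jordan z (u2_commutator e f) + jordan (u2_commutator z e) f + jordan e (u2_commutator z f)"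
  have \<omega>: "opr \<omega> = i_op * (?w + ?w)"
    unfolding \<omega>_def by (simp add: opr_jordan algebra_simps)
  have "opr \<omega> + opr \<omega> + (opr \<omega> * opr e * opr f + opr f * opr e * opr \<omega>)
    = i_op * ((?w + ?w + (?w * opr e * opr f + opr f * opr e * ?w))
        + (?w + ?w + (?w * opr e * opr f + opr f * opr e * ?w)))"
    unfolding \<omega> by (simp add: algebra_simps opr_i_op_left)
  also have "\<dots> = 0" unfolding quasi_inverse_symmetric[OF z'] by simp
  finally have "opr \<omega> = 0" using fix0[of \<omega>] by simp
  then have "i_op * (i_op * (?w + ?w)) = 0" unfolding \<omega> by simp
  then have "?w + ?w = 0 + 0" unfolding i_op_i_op_left neg_equal_0_iff_equal by (simp only: add_0_left)
  then have w0: "opr z * opr e * opr f = opr f * opr e * opr z" unfolding double_eq_iff by simp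
  have "(opr z + opr z * opr e * opr f) + (opr z + opr z * opr e * opr f) = opr f + opr f"
    using z' unfolding w0 by (simp add: algebra_simps)
  then have z1: "opr z + opr z * opr e * opr f = opr f" unfolding double_eq_iff .
  from quasi_inverse_commutes[OF z1 z1[unfolded w0] df]
  have "\<delta> z = 0" by (intro fix0) (simp add: opr_\<delta>)
  with \<open>e \<in> slice\<close> have orth: "inner e z = 0" by (simp add: slice_def stab_def)
  have fz: "f = z - N z" using z unfolding eq_diff_eq by (rule sym)
  then have "norm f \<le> norm z + norm (N z)" using norm_triangle_ineq4[of z "N z"] by simp
  then have "norm f \<le> 2 * norm z" using normN[of z] norm_ge_zero[of z] by linarith
  have e: "e = f - cayN (- q) f" using ef unfolding cayL_def by (rule sym)
  \<comment> \<open>The relative distance of \<open>e\<close> from \<open>z\<close> is at most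
    \<open>1/100 + 2/8\<close>, below 1/2, whereas \<open>e\<close> is orthogonal to
    \<open>z\<close>. This forces \<open>z = 0\<close>.\<close>
  have "z - e = (f + N z) - (f - cayN (- q) f)" by (rule arg_cong2[OF z e])
  then have "z - e = N z + cayN (- q) f" by simp
  then have "norm (z - e) \<le> 1/100 * norm z + 1/8 * norm f"
    using norm_triangle_ineq[of "N z" "cayN (- q) f"] normN[of z] norm_cayN_le[OF q, of f] by simp
  also have "\<dots> \<le> 1/2 * norm z" using \<open>norm f \<le> 2 * norm z\<close> norm_ge_zero[of z] by linarith
  finally have "norm (z - e) * norm z \<le> 1/2 * norm z * norm z" by (intro mult_right_mono) auto
  moreover have "inner z z = inner (z - e) z" using orth by (simp add: inner_diff_left)
  ultimately have "inner z z \<le> 1/2 * norm z * norm z"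
    using norm_cauchy_schwarz[of "z - e" z] by linarith
  then have "norm z * norm z \<le> 0" by (simp add: dot_square_norm power2_eq_square)
  then have "z = 0" by (auto simp: mult_le_0_iff)
  with \<open>norm f \<le> 2 * norm z\<close> have "f = 0" by simp
  with ef have "e = 0" using linear_0[OF linear_cayL] by metis
  then show "X = Y" using qe by simp
qed

end

section \<open>Smoothness of the orbit map\<close>

text \<open>Differentiability of a family \<open>\<lambda>x. f x v\<close> at \<open>x\<close> with derivative \<open>\<lambda>h. g h v\<close>, uniform in
  \<open>v\<close> with respect to the weight \<open>w v\<close>.\<close>

definition dq :: "'a::real_normed_vector set \<Rightarrow> 'a \<Rightarrow> ('v \<Rightarrow> real) \<Rightarrow> ('a \<Rightarrow> 'v \<Rightarrow> 'b::real_normed_vector)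
    \<Rightarrow> ('a \<Rightarrow> 'v \<Rightarrow> 'b) \<Rightarrow> bool" where
  "dq U x w f g \<longleftrightarrow> (\<forall>v. 0 \<le> w v)
     \<and> (\<exists>C\<ge>0. \<forall>v. norm (f x v) \<le> C * w v)
     \<and> (\<exists>C\<ge>0. \<forall>h v. norm (g h v) \<le> C * norm h * w v)
     \<and> (\<exists>\<rho>. (\<rho> \<longlongrightarrow> 0) (at 0) \<and> (\<forall>h. 0 \<le> \<rho> h)
          \<and> (\<forall>h v. x + h \<in> U \<longrightarrow> norm (f (x + h) v - f x v - g h v) \<le> \<rho> h * norm h * w v))"

lemma dqE:
  assumes "dq U x w f g"
  obtains C G \<rho> where "\<And>v. 0 \<le> w v" "0 \<le> C" "\<And>v. norm (f x v) \<le> C * w v"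
    "0 \<le> G" "\<And>h v. norm (g h v) \<le> G * norm h * w v" "(\<rho> \<longlongrightarrow> 0) (at 0)" "\<And>h. 0 \<le> \<rho> h"
    "\<And>h v. x + h \<in> U \<Longrightarrow> norm (f (x + h) v - f x v - g h v) \<le> \<rho> h * norm h * w v"
  using assms unfolding dq_def by metis

lemma dqI:
  assumes "\<And>v. 0 \<le> w v" "0 \<le> C" "\<And>v. norm (f x v) \<le> C * w v"
    "0 \<le> G" "\<And>h v. norm (g h v) \<le> G * norm h * w v" "(\<rho> \<longlongrightarrow> 0) (at 0)" "\<And>h. 0 \<le> \<rho> h"
    "\<And>h v. x + h \<in> U \<Longrightarrow> norm (f (x + h) v - f x v - g h v) \<le> \<rho> h * norm h * w v"
  shows "dq U x w f g"
  using assms unfolding dq_def by blast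

lemma dq_linear:
  assumes l: "bounded_linear l" and f: "dq U x w f g"
  shows "dq U x w (\<lambda>x v. l (f x v)) (\<lambda>h v. l (g h v))"
proof -
  interpret l: bounded_linear l by fact
  obtain K where K: "0 \<le> K" "\<And>y. norm (l y) \<le> norm y * K" using l.nonneg_bounded by blast
  obtain C G \<rho> where *: "\<And>v. 0 \<le> w v" "0 \<le> C" "\<And>v. norm (f x v) \<le> C * w v"
    "0 \<le> G" "\<And>h v. norm (g h v) \<le> G * norm h * w v" "(\<rho> \<longlongrightarrow> 0) (at 0)" "\<And>h. 0 \<le> \<rho> h"
    "\<And>h v. x + h \<in> U \<Longrightarrow> norm (f (x + h) v - f x v - g h v) \<le> \<rho> h * norm h * w v"
    using dqE[OF f] by blast
  show ?thesis
  proof (rule dqI[where C = "K * C" and G = "K * G" and \<rho> = "\<lambda>h. K * \<rho> h"])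
    show "norm (l (f x v)) \<le> K * C * w v" for v
      using order.trans[OF K(2) mult_right_mono[OF *(3) K(1)]] by (simp add: mult_ac)
    show "norm (l (g h v)) \<le> K * G * norm h * w v" for h v
      using order.trans[OF K(2) mult_right_mono[OF *(5) K(1)]] by (simp add: mult_ac)
    show "((\<lambda>h. K * \<rho> h) \<longlongrightarrow> 0) (at 0)" using tendsto_mult_right_zero[OF *(6)] by simp
    show "norm (l (f (x + h) v) - l (f x v) - l (g h v)) \<le> K * \<rho> h * norm h * w v" if "x + h \<in> U" for h v
      using order.trans[OF K(2) mult_right_mono[OF *(8)[OF that] K(1)]] by (simp add: mult_ac l.diff)
  qed (use * K in auto)
qed

lemma dq_add:
  assumes 1: "dq U x w f1 g1" and 2: "dq U x w f2 g2"
  shows "dq U x w (\<lambda>x v. f1 x v + f2 x v) (\<lambda>h v. g1 h v + g2 h v)"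
proof -
  obtain C G \<rho> where *: "\<And>v. 0 \<le> w v" "0 \<le> C" "\<And>v. norm (f1 x v) \<le> C * w v"
    "0 \<le> G" "\<And>h v. norm (g1 h v) \<le> G * norm h * w v" "(\<rho> \<longlongrightarrow> 0) (at 0)" "\<And>h. 0 \<le> \<rho> h"
    "\<And>h v. x + h \<in> U \<Longrightarrow> norm (f1 (x + h) v - f1 x v - g1 h v) \<le> \<rho> h * norm h * w v"
    using dqE[OF 1] by blast
  obtain C' G' \<rho>' where **: "\<And>v. 0 \<le> w v" "0 \<le> C'" "\<And>v. norm (f2 x v) \<le> C' * w v"
    "0 \<le> G'" "\<And>h v. norm (g2 h v) \<le> G' * norm h * w v" "(\<rho>' \<longlongrightarrow> 0) (at 0)" "\<And>h. 0 \<le> \<rho>' h"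
    "\<And>h v. x + h \<in> U \<Longrightarrow> norm (f2 (x + h) v - f2 x v - g2 h v) \<le> \<rho>' h * norm h * w v"
    using dqE[OF 2] by blast
  show ?thesis
  proof (rule dqI[where C = "C + C'" and G = "G + G'" and \<rho> = "\<lambda>h. \<rho> h + \<rho>' h"])
    show "norm (f1 x v + f2 x v) \<le> (C + C') * w v" for v
      using norm_triangle_le[OF add_mono[OF *(3) **(3)]] by (simp add: algebra_simps)
    show "norm (g1 h v + g2 h v) \<le> (G + G') * norm h * w v" for h v
      using norm_triangle_le[OF add_mono[OF *(5) **(5)]] by (simp add: algebra_simps)
    show "((\<lambda>h. \<rho> h + \<rho>' h) \<longlongrightarrow> 0) (at 0)" using tendsto_add[OF *(6) **(6)] by simp
    show "norm (f1 (x + h) v + f2 (x + h) v - (f1 x v + f2 x v) - (g1 h v + g2 h v))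
        \<le> (\<rho> h + \<rho>' h) * norm h * w v" if "x + h \<in> U" for h v
    proof -
      have eq: "f1 (x + h) v + f2 (x + h) v - (f1 x v + f2 x v) - (g1 h v + g2 h v)
        = (f1 (x + h) v - f1 x v - g1 h v) + (f2 (x + h) v - f2 x v - g2 h v)" by simp
      show ?thesis unfolding eq
        using norm_triangle_le[OF add_mono[OF *(8)[OF that, of v] **(8)[OF that, of v]]]
        by (simp add: distrib_right)
    qed
  qed (use * ** in auto)
qed

text \<open>The error consists of each remainder against the other factor and of the product of the
  two full increments, which is of second order in \<open>h\<close>. The weights multiply, as suits
  factors with disjoint sets of arguments.\<close>

lemma dq_bilinear:
  assumes b: "bounded_bilinear b" and 1: "dq U x w1 f1 g1" and 2: "dq U x w2 f2 g2"
  shows "dq U x (\<lambda>v. w1 v * w2 v) (\<lambda>x v. b (f1 x v) (f2 x v))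
    (\<lambda>h v. b (g1 h v) (f2 x v) + b (f1 x v) (g2 h v))"
proof -
  interpret b: bounded_bilinear b by fact
  obtain K where K: "0 \<le> K" "\<And>y z. norm (b y z) \<le> norm y * norm z * K" using b.nonneg_bounded by blast
  obtain C G \<rho> where *: "\<And>v. 0 \<le> w1 v" "0 \<le> C" "\<And>v. norm (f1 x v) \<le> C * w1 v"
    "0 \<le> G" "\<And>h v. norm (g1 h v) \<le> G * norm h * w1 v" "(\<rho> \<longlongrightarrow> 0) (at 0)" "\<And>h. 0 \<le> \<rho> h"
    "\<And>h v. x + h \<in> U \<Longrightarrow> norm (f1 (x + h) v - f1 x v - g1 h v) \<le> \<rho> h * norm h * w1 v"
    using dqE[OF 1] by blast
  obtain C' G' \<rho>' where **: "\<And>v. 0 \<le> w2 v" "0 \<le> C'" "\<And>v. norm (f2 x v) \<le> C' * w2 v"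
    "0 \<le> G'" "\<And>h v. norm (g2 h v) \<le> G' * norm h * w2 v" "(\<rho>' \<longlongrightarrow> 0) (at 0)" "\<And>h. 0 \<le> \<rho>' h"
    "\<And>h v. x + h \<in> U \<Longrightarrow> norm (f2 (x + h) v - f2 x v - g2 h v) \<le> \<rho>' h * norm h * w2 v"
    using dqE[OF 2] by blast
  have bb: "norm (b y z) \<le> (p * w1 v) * (p' * w2 v) * K"
    if "norm y \<le> p * w1 v" "norm z \<le> p' * w2 v" for y z p p' v
    using that by (intro order.trans[OF K(2)] mult_right_mono mult_mono K(1)) (auto intro: order.trans[OF norm_ge_zero])
  show ?thesis
  proof (rule dqI[where C = "C * C' * K" and G = "(G * C' + C * G') * K"
        and \<rho> = "\<lambda>h. (\<rho> h * C' + C * \<rho>' h + (G + \<rho> h) * (G' + \<rho>' h) * norm h) * K"])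
    show "norm (b (f1 x v) (f2 x v)) \<le> C * C' * K * (w1 v * w2 v)" for v
      using bb[OF *(3)[of v] **(3)[of v]] by (simp add: mult_ac)
    show "norm (b (g1 h v) (f2 x v) + b (f1 x v) (g2 h v)) \<le> (G * C' + C * G') * K * norm h * (w1 v * w2 v)" for h v
      using norm_triangle_le[OF add_mono[OF bb[OF *(5)[of h v] **(3)[of v]] bb[OF *(3)[of v] **(5)[of h v]]]]
      by (simp add: algebra_simps)
    have "((\<lambda>h. (\<rho> h * C' + C * \<rho>' h + (G + \<rho> h) * (G' + \<rho>' h) * norm h) * K) \<longlongrightarrow>
        (0 * C' + C * 0 + (G + 0) * (G' + 0) * 0) * K) (at 0)"
      by (intro tendsto_intros * ** tendsto_norm_zero[OF tendsto_ident_at])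
    then show "((\<lambda>h. (\<rho> h * C' + C * \<rho>' h + (G + \<rho> h) * (G' + \<rho>' h) * norm h) * K) \<longlongrightarrow> 0) (at 0)"
      by simp
    show "norm (b (f1 (x + h) v) (f2 (x + h) v) - b (f1 x v) (f2 x v) - (b (g1 h v) (f2 x v) + b (f1 x v) (g2 h v)))
      \<le> (\<rho> h * C' + C * \<rho>' h + (G + \<rho> h) * (G' + \<rho>' h) * norm h) * K * norm h * (w1 v * w2 v)"
      if "x + h \<in> U" for h v
    proof -
      define r1 where "r1 = f1 (x + h) v - f1 x v - g1 h v"
      define r2 where "r2 = f2 (x + h) v - f2 x v - g2 h v"
      have r: "norm r1 \<le> (\<rho> h * norm h) * w1 v" "norm r2 \<le> (\<rho>' h * norm h) * w2 v"
        unfolding r1_def r2_def using *(8)[OF that] **(8)[OF that] by auto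
      have s: "norm (g1 h v + r1) \<le> ((G + \<rho> h) * norm h) * w1 v" "norm (g2 h v + r2) \<le> ((G' + \<rho>' h) * norm h) * w2 v"
        using norm_triangle_le[OF add_mono[OF *(5)[of h v] r(1)]] norm_triangle_le[OF add_mono[OF **(5)[of h v] r(2)]]
        by (simp_all add: algebra_simps)
      have "f1 (x + h) v = f1 x v + g1 h v + r1" "f2 (x + h) v = f2 x v + g2 h v + r2"
        by (simp_all add: r1_def r2_def)
      then have "b (f1 (x + h) v) (f2 (x + h) v) - b (f1 x v) (f2 x v) - (b (g1 h v) (f2 x v) + b (f1 x v) (g2 h v))
        = b r1 (f2 x v) + b (f1 x v) r2 + b (g1 h v + r1) (g2 h v + r2)"
        by (simp add: b.add_left b.add_right algebra_simps)
      also have "norm \<dots> \<le> (\<rho> h * norm h * w1 v) * (C' * w2 v) * K + (C * w1 v) * (\<rho>' h * norm h * w2 v) * K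
         + ((G + \<rho> h) * norm h * w1 v) * ((G' + \<rho>' h) * norm h * w2 v) * K"
        by (intro norm_triangle_le add_mono bb r s * **)
      finally show ?thesis by (simp add: algebra_simps)
    qed
  qed (use * ** K in auto)
qed

lemma dq_has_derivative:
  assumes f: "dq U x w f g" and U: "open U" "x \<in> U" and g: "linear (\<lambda>h. g h v)"
  shows "((\<lambda>x. f x v) has_derivative (\<lambda>h. g h v)) (at x)"
proof -
  obtain C G \<rho> where *: "\<And>v. 0 \<le> w v" "0 \<le> C" "\<And>v. norm (f x v) \<le> C * w v"
    "0 \<le> G" "\<And>h v. norm (g h v) \<le> G * norm h * w v" "(\<rho> \<longlongrightarrow> 0) (at 0)" "\<And>h. 0 \<le> \<rho> h"
    "\<And>h v. x + h \<in> U \<Longrightarrow> norm (f (x + h) v - f x v - g h v) \<le> \<rho> h * norm h * w v"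
    using dqE[OF f] by blast
  show ?thesis unfolding has_derivative_at_alt
  proof (intro conjI allI impI)
    show "bounded_linear (\<lambda>h. g h v)"
      by (rule bounded_linear_intro[where K = "G * w v"])
        (use *(5)[of _ v] linear_add[OF g] linear_scale[OF g] in \<open>auto simp: mult_ac\<close>)
    fix e :: real assume e: "e > 0"
    \<comment> \<open>The added 1 covers the case of weight zero.\<close>
    then have e': "e / (w v + 1) > 0" using *(1) by (simp add: add_nonneg_pos)
    from U obtain d1 where d1: "d1 > 0" "ball x d1 \<subseteq> U" using open_contains_ball by blast
    from *(6) e' obtain d2 where d2: "d2 > 0" "\<And>h. h \<noteq> 0 \<Longrightarrow> norm h < d2 \<Longrightarrow> \<rho> h < e / (w v + 1)"
      using *(7) unfolding LIM_def dist_norm by force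
    show "\<exists>d>0. \<forall>y. norm (y - x) < d \<longrightarrow> norm (f y v - f x v - g (y - x) v) \<le> e * norm (y - x)"
    proof (intro exI[of _ "min d1 d2"] conjI allI impI)
      fix y assume y: "norm (y - x) < min d1 d2"
      define h where "h = y - x"
      have "x + h \<in> U" using d1 y by (auto simp: h_def dist_norm norm_minus_commute)
      then have 1: "norm (f (x + h) v - f x v - g h v) \<le> \<rho> h * norm h * w v" by (rule *(8))
      show "norm (f y v - f x v - g (y - x) v) \<le> e * norm (y - x)"
      proof (cases "h = 0")
        case False
        then have "\<rho> h < e / (w v + 1)" using d2(2) y by (simp add: h_def)
        then have "\<rho> h * (w v + 1) \<le> e" using *(1)[of v] by (simp add: pos_less_divide_eq add_nonneg_pos less_imp_le)
        then have "\<rho> h * w v \<le> e" using *(7)[of h] by (simp add: distrib_left)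
        then have "\<rho> h * w v * norm h \<le> e * norm h" by (intro mult_right_mono) auto
        with 1 show ?thesis by (simp add: h_def mult_ac)
      qed (use 1 in \<open>simp add: h_def\<close>)
    qed (use d1 d2 in auto)
  qed
qed

section \<open>Differentiability of the inverse \<open>cayC X\<close> in \<open>X\<close>\<close>

definition cayN_deriv :: "'h::complex_hilbert u2 \<Rightarrow> 'h u2 \<Rightarrow> 'h u2 \<Rightarrow> 'h u2" where
  "cayN_deriv X H B = u2_commutator H B + triple H B X"

abbreviation cay_ball :: "'h::complex_hilbert u2 set" where
  "cay_ball \<equiv> ball 0 (1/20)"

text \<open>\<open>cayN\<close> is quadratic in \<open>X\<close>, so the Taylor expansion ends with
  the term \<open>H B H\<close>.\<close>

lemma cayN_expand: "cayN (X + H) B = cayN X B + cayN_deriv X H B + (1/2) *\<^sub>R triple H B H"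
proof -
  have "opr (cayN (X + H) B) = opr (cayN X B + cayN_deriv X H B) + opr H * opr B * opr H"
    by (simp add: opr_cayN cayN_deriv_def opr_triple algebra_simps)
  also have "\<dots> = opr (cayN X B + cayN_deriv X H B + (1/2) *\<^sub>R triple H B H)"
    by (simp add: opr_triple scaleR_2[symmetric])
  finally show ?thesis unfolding opr_inject .
qed

text \<open>Differentiation of an inverse: \<open>\<Delta>\<close> is the increment of
  \<open>cayN\<close> and \<open>res\<close> is the resolvent identity between \<open>x\<close> and
  \<open>x + h\<close>; applied twice, it leaves an error of second order in \<open>h\<close>. The
  constants come from the rounded bounds 2 for \<open>cayC\<close>, \<open>3 * norm h\<close> for
  \<open>cayN_deriv\<close> and \<open>4 * norm h\<close> for \<open>\<Delta>\<close>.\<close>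

lemma dq_cayC:
  assumes x: "x \<in> cay_ball" and f: "dq cay_ball x w f g"
  shows "dq cay_ball x w (\<lambda>x v. cayC x (f x v)) (\<lambda>h v. cayC x (g h v + cayN_deriv x h (cayC x (f x v))))"
proof -
  obtain C G \<rho> where *: "\<And>v. 0 \<le> w v" "0 \<le> C" "\<And>v. norm (f x v) \<le> C * w v"
    "0 \<le> G" "\<And>h v. norm (g h v) \<le> G * norm h * w v" "(\<rho> \<longlongrightarrow> 0) (at 0)" "\<And>h. 0 \<le> \<rho> h"
    "\<And>h v. x + h \<in> cay_ball \<Longrightarrow> norm (f (x + h) v - f x v - g h v) \<le> \<rho> h * norm h * w v"
    using dqE[OF f] by blast
  have X: "norm x \<le> 1/20" using x by simp
  have cay2: "norm (cayC y u) \<le> 2 * p" if "norm y \<le> 1/20" "norm u \<le> p" for y u :: "'a u2" and p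
    using norm_cayC_le[OF that(1), of u] that(2) norm_ge_zero[of u] by linarith
  have M: "norm (cayN_deriv x h B) \<le> 3 * norm h * p" if "norm B \<le> p" for h B p
  proof -
    have "norm (cayN_deriv x h B) \<le> 2 * norm h * norm B + 6 * norm h * norm B * norm x"
      unfolding cayN_deriv_def by (intro norm_triangle_le add_mono norm_commutator_le norm_triple_le)
    also have "\<dots> \<le> 2 * norm h * norm B + 6 * norm h * norm B * (1/20)"
      using X by (intro add_left_mono mult_left_mono) auto
    also have "\<dots> \<le> 3 * norm h * norm B" by (simp add: mult_nonneg_nonneg)
    also have "\<dots> \<le> 3 * norm h * p" using that by (intro mult_left_mono) auto
    finally show ?thesis .
  qed
  have N2: "norm ((1/2) *\<^sub>R triple h B h) \<le> 3 * norm h * norm h * p" if "norm B \<le> p" for h B :: "'a u2" and p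
  proof -
    have "norm ((1/2) *\<^sub>R triple h B h) \<le> 3 * norm h * norm h * norm B"
      using norm_triple_le[of h B h] by (simp add: mult_ac)
    also have "\<dots> \<le> 3 * norm h * norm h * p" using that by (intro mult_left_mono) auto
    finally show ?thesis .
  qed
  show ?thesis
  proof (rule dqI[where C = "2 * C" and G = "2 * G + 12 * C"
        and \<rho> = "\<lambda>h. 2 * \<rho> h + (16 * G + 140 * C) * norm h"])
    show "norm (cayC x (f x v)) \<le> 2 * C * w v" for v
      using cay2[OF X *(3)] by (simp add: mult_ac)
    show "norm (cayC x (g h v + cayN_deriv x h (cayC x (f x v)))) \<le> (2 * G + 12 * C) * norm h * w v" for h v
    proof -
      have "norm (g h v + cayN_deriv x h (cayC x (f x v))) \<le> G * norm h * w v + 3 * norm h * (2 * (C * w v))"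
        by (intro norm_triangle_le add_mono * M cay2 X)
      from cay2[OF X this] show ?thesis by (simp add: algebra_simps)
    qed
    have "((\<lambda>h. 2 * \<rho> h + (16 * G + 140 * C) * norm h) \<longlongrightarrow> 2 * 0 + (16 * G + 140 * C) * 0) (at 0)"
      by (intro tendsto_intros * tendsto_norm_zero[OF tendsto_ident_at])
    then show "((\<lambda>h. 2 * \<rho> h + (16 * G + 140 * C) * norm h) \<longlongrightarrow> 0) (at 0)" by simp
    show "norm (cayC (x + h) (f (x + h) v) - cayC x (f x v) - cayC x (g h v + cayN_deriv x h (cayC x (f x v))))
      \<le> (2 * \<rho> h + (16 * G + 140 * C) * norm h) * norm h * w v" if y: "x + h \<in> cay_ball" for h v
    proof -
      let ?y = "x + h"
      have Y: "norm ?y \<le> 1/20" using y by simp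
      have h: "norm h \<le> 1/10" using norm_triangle_ineq4[of ?y x] X Y by simp
      define r where "r = f ?y v - f x v - g h v"
      have r: "norm r \<le> \<rho> h * norm h * w v" unfolding r_def by (rule *(8)[OF y])
      define \<Delta> where "\<Delta> B = cayN_deriv x h B + (1/2) *\<^sub>R triple h B h" for B
      have \<Delta>: "norm (\<Delta> B) \<le> 4 * norm h * p" if "norm B \<le> p" for B p
      proof -
        have "0 \<le> p" using that norm_ge_zero order.trans by blast
        have "norm (\<Delta> B) \<le> 3 * norm h * p + 3 * norm h * norm h * p"
          unfolding \<Delta>_def by (intro norm_triangle_le add_mono M N2 that)
        also have "3 * norm h * norm h * p \<le> 3 * norm h * (1/10) * p"
          using h \<open>0 \<le> p\<close> by (intro mult_right_mono mult_left_mono) auto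
        also have "3 * norm h * p + 3 * norm h * (1/10) * p \<le> 4 * norm h * p"
          using mult_nonneg_nonneg[OF \<open>0 \<le> p\<close> norm_ge_zero[of h]] by (simp add: mult_ac)
        finally show ?thesis by simp
      qed
      have res: "cayC ?y u = cayC x u + cayC ?y (\<Delta> (cayC x u))" for u
      proof -
        have "cayL ?y (cayC x u) = cayL x (cayC x u) - \<Delta> (cayC x u)"
          by (simp add: cayL_def cayN_expand \<Delta>_def)
        then have "cayL ?y (cayC ?y u) = cayL ?y (cayC x u + cayC ?y (\<Delta> (cayC x u)))"
          by (simp add: cayL_cayC[OF X] cayL_cayC[OF Y] linear_add[OF linear_cayL])
        then show ?thesis unfolding cayL_cancel[OF Y] .
      qed
      let ?c = "cayC x (f x v)"
      have "f ?y v = f x v + (g h v + r)" by (simp add: r_def)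
      then have "cayC ?y (f ?y v) = cayC ?y (f x v) + (cayC ?y (g h v) + cayC ?y r)"
        by (simp add: linear_add[OF linear_cayC[OF Y]])
      also have "cayC ?y (f x v) = ?c + cayC ?y (cayN_deriv x h ?c) + cayC ?y ((1/2) *\<^sub>R triple h ?c h)"
        by (subst res) (simp add: \<Delta>_def linear_add[OF linear_cayC[OF Y]])
      finally have "cayC ?y (f ?y v) - ?c - cayC x (g h v + cayN_deriv x h ?c)
        = (cayC ?y (cayN_deriv x h ?c) - cayC x (cayN_deriv x h ?c)) + cayC ?y ((1/2) *\<^sub>R triple h ?c h)
          + ((cayC ?y (g h v) - cayC x (g h v)) + cayC ?y r)"
        by (simp add: linear_add[OF linear_cayC[OF X]])
      also have "\<dots> = cayC ?y (\<Delta> (cayC x (cayN_deriv x h ?c))) + cayC ?y ((1/2) *\<^sub>R triple h ?c h)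
          + (cayC ?y (\<Delta> (cayC x (g h v))) + cayC ?y r)"
        using res[of "cayN_deriv x h ?c"] res[of "g h v"] by simp
      also have "norm \<dots> \<le> 2 * (4 * norm h * (2 * (3 * norm h * (2 * (C * w v))))) + 2 * (3 * norm h * norm h * (2 * (C * w v)))
          + (2 * (4 * norm h * (2 * (G * norm h * w v))) + 2 * (\<rho> h * norm h * w v))"
        by (intro norm_triangle_le add_mono cay2 \<Delta> M N2 X Y r *)
      also have "\<dots> = (2 * \<rho> h + (16 * G + 108 * C) * norm h) * norm h * w v"
        by (simp add: algebra_simps)
      also have "\<dots> \<le> (2 * \<rho> h + (16 * G + 140 * C) * norm h) * norm h * w v"
        using *(1,2) by (intro mult_right_mono add_left_mono) auto
      finally show ?thesis .
    qed
  qed (use * in auto)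
qed


section \<open>Multilinear families closed under differentiation\<close>

text \<open>The maps obtained from \<open>x\<close> and from vectors \<open>v i\<close> by bounded multilinear operations
  and \<open>cayC x\<close>, each \<open>v i\<close> with \<open>i \<in> I\<close> being used exactly once.\<close>

inductive mfam :: "nat set \<Rightarrow> ('h::complex_hilbert u2 \<Rightarrow> (nat \<Rightarrow> 'h u2) \<Rightarrow> 'h u2) \<Rightarrow> bool" where
  base: "mfam {} (\<lambda>x v. x)"
| arg: "mfam {i} (\<lambda>x v. v i)"
| zero: "finite I \<Longrightarrow> mfam I (\<lambda>x v. 0)"
| add: "mfam I f \<Longrightarrow> mfam I g \<Longrightarrow> mfam I (\<lambda>x v. f x v + g x v)"
| lin: "bounded_linear l \<Longrightarrow> mfam I f \<Longrightarrow> mfam I (\<lambda>x v. l (f x v))"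
| bil: "bounded_bilinear b \<Longrightarrow> mfam I f \<Longrightarrow> mfam J g \<Longrightarrow> I \<inter> J = {}
    \<Longrightarrow> mfam (I \<union> J) (\<lambda>x v. b (f x v) (g x v))"
| cay: "mfam I f \<Longrightarrow> mfam I (\<lambda>x v. cayC x (f x v))"

lemma mfam_finite: "mfam I f \<Longrightarrow> finite I"
  by (induction rule: mfam.induct) auto

lemma mfam_bil_cong:
  "bounded_bilinear b \<Longrightarrow> mfam I f \<Longrightarrow> mfam J g \<Longrightarrow> I \<inter> J = {} \<Longrightarrow> I \<union> J = K
    \<Longrightarrow> mfam K (\<lambda>x v. b (f x v) (g x v))"
  using mfam.bil by blast

lemma mfam_shift: "mfam I f \<Longrightarrow> mfam (Suc ` I) (\<lambda>x v. f x (\<lambda>i. v (Suc i)))"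
proof (induction rule: mfam.induct)
  case (bil b I f J g)
  have "Suc ` I \<inter> Suc ` J = {}" using bil.hyps(4) by auto
  then show ?case by (intro mfam_bil_cong[OF bil.hyps(1) bil.IH]) auto
qed (auto intro: mfam.intros)

lemma mfam_indep: "mfam I f \<Longrightarrow> i \<notin> I \<Longrightarrow> f x (v(i := a)) = f x v"
  by (induction rule: mfam.induct) auto

text \<open>In a product the index sets are disjoint, so just one factor depends on
  \<open>v i\<close>; the other is constant by \<open>mfam_indep\<close>.\<close>

lemma mfam_linear:
  assumes "mfam I f" "norm x \<le> 1/20" "i \<in> I"
  shows "linear (\<lambda>a. f x (v(i := a)))"
  using assms(1,3)
proof (induction rule: mfam.induct)
  case (arg j)
  then show ?case by (simp add: linear_iff)
next
  case (zero I)
  then show ?case by (simp add: linear_iff)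
next
  case (add I f g)
  then show ?case by (intro linear_compose_add) auto
next
  case (lin l I f)
  show ?case
    using linear_compose[OF lin.IH[OF lin.prems] bounded_linear.linear[OF lin.hyps(1)]] unfolding o_def .
next
  case (bil b I f J g)
  interpret b: bounded_bilinear b by fact
  show ?case
  proof (cases "i \<in> I")
    case True
    then have "i \<notin> J" using bil.hyps(4) by auto
    have "linear (\<lambda>a. b (f x (v(i := a))) (g x v))"
      using linear_compose[OF bil.IH(1)[OF True] bounded_linear.linear[OF b.bounded_linear_left[of "g x v"]]]
      unfolding o_def .
    then show ?thesis by (simp only: mfam_indep[OF bil.hyps(3) \<open>i \<notin> J\<close>])
  next
    case False
    then have "i \<in> J" using bil.prems by auto
    have "linear (\<lambda>a. b (f x v) (g x (v(i := a))))"
      using linear_compose[OF bil.IH(2)[OF \<open>i \<in> J\<close>] bounded_linear.linear[OF b.bounded_linear_right[of "f x v"]]]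
      unfolding o_def .
    then show ?thesis by (simp only: mfam_indep[OF bil.hyps(2) False])
  qed
next
  case (cay I f)
  show ?case
    using linear_compose[OF cay.IH[OF cay.prems] linear_cayC[OF assms(2)]] unfolding o_def .
qed simp

lemma mfam_bound:
  assumes "mfam I f" "norm x \<le> 1/20"
  shows "\<exists>C\<ge>0. \<forall>v. norm (f x v) \<le> C * (\<Prod>i\<in>I. norm (v i))"
  using assms(1)
proof (induction rule: mfam.induct)
  case base
  show ?case by (intro exI[of _ "norm x"]) simp
next
  case (arg i)
  show ?case by (intro exI[of _ 1]) simp
next
  case (zero I)
  show ?case by (intro exI[of _ 0]) simp
next
  case (add I f g)
  then obtain C D where C: "0 \<le> C" "\<And>v. norm (f x v) \<le> C * (\<Prod>i\<in>I. norm (v i))"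
    and D: "0 \<le> D" "\<And>v. norm (g x v) \<le> D * (\<Prod>i\<in>I. norm (v i))" by blast
  show ?case
    using norm_triangle_le[OF add_mono[OF C(2) D(2)]] C(1) D(1)
    by (intro exI[of _ "C + D"]) (simp add: distrib_right)
next
  case (lin l I f)
  then obtain C where C: "0 \<le> C" "\<And>v. norm (f x v) \<le> C * (\<Prod>i\<in>I. norm (v i))" by blast
  obtain K where K: "0 \<le> K" "\<And>y. norm (l y) \<le> norm y * K"
    using bounded_linear.nonneg_bounded[OF lin.hyps(1)] by blast
  show ?case
    using order.trans[OF K(2) mult_right_mono[OF C(2) K(1)]] C(1) K(1)
    by (intro exI[of _ "C * K"]) (simp add: mult_ac)
next
  case (bil b I f J g)
  then obtain C D where C: "0 \<le> C" "\<And>v. norm (f x v) \<le> C * (\<Prod>i\<in>I. norm (v i))"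
    and D: "0 \<le> D" "\<And>v. norm (g x v) \<le> D * (\<Prod>i\<in>J. norm (v i))" by blast
  obtain K where K: "0 \<le> K" "\<And>y z. norm (b y z) \<le> norm y * norm z * K"
    using bounded_bilinear.nonneg_bounded[OF bil.hyps(1)] by blast
  have "norm (b (f x v) (g x v)) \<le> C * D * K * (\<Prod>i\<in>I \<union> J. norm (v i))" for v
  proof -
    have "norm (b (f x v) (g x v))
        \<le> (C * (\<Prod>i\<in>I. norm (v i))) * (D * (\<Prod>i\<in>J. norm (v i))) * K"
      using C D by (intro order.trans[OF K(2)] mult_right_mono mult_mono K(1)) (auto intro: order.trans[OF norm_ge_zero])
    then show ?thesis
      using prod.union_disjoint[OF mfam_finite[OF bil.hyps(2)] mfam_finite[OF bil.hyps(3)] bil.hyps(4), of "\<lambda>i. norm (v i)"]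
      by (simp add: mult_ac)
  qed
  then show ?case using C(1) D(1) K(1) by (intro exI[of _ "C * D * K"]) simp
next
  case (cay I f)
  then obtain C where C: "0 \<le> C" "\<And>v. norm (f x v) \<le> C * (\<Prod>i\<in>I. norm (v i))" by blast
  have "norm (cayC x (f x v)) \<le> (8/7 * C) * (\<Prod>i\<in>I. norm (v i))" for v
    using norm_cayC_le[OF assms(2), of "f x v"] C(2)[of v] by simp
  then show ?case using C(1) by (intro exI[of _ "8/7 * C"]) simp
qed

text \<open>In the derivative the direction of differentiation becomes the argument with index 0.\<close>

abbreviation mfam_deriv ::
  "nat set \<Rightarrow> ('h::complex_hilbert u2 \<Rightarrow> (nat \<Rightarrow> 'h u2) \<Rightarrow> 'h u2) \<Rightarrow> ('h u2 \<Rightarrow> (nat \<Rightarrow> 'h u2) \<Rightarrow> 'h u2) \<Rightarrow> bool"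
  where "mfam_deriv I f f' \<equiv> mfam (insert 0 (Suc ` I)) f'
     \<and> (\<forall>x\<in>cay_ball. dq cay_ball x (\<lambda>v. \<Prod>i\<in>I. norm (v i)) f (\<lambda>h v. f' x (case_nat h v)))"

lemma mfam_triple:
  assumes "mfam I f" "mfam J g" "mfam K k" "I \<inter> J = {}" "I \<inter> K = {}" "J \<inter> K = {}"
  shows "mfam (I \<union> J \<union> K) (\<lambda>x v. triple (f x v) (g x v) (k x v))"
proof -
  have neg: "bounded_linear (\<lambda>A :: 'a u2. (- 1) *\<^sub>R A)" and half: "bounded_linear (\<lambda>A :: 'a u2. (- 1 / 2) *\<^sub>R A)"
    by (rule bounded_linear_scaleR_right)+
  note j = mfam_bil_cong[OF bounded_bilinear_jordan]
  have 1: "mfam (I \<union> J \<union> K) (\<lambda>x v. jordan (jordan (f x v) (g x v)) (k x v))"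
    by (rule j[OF j[OF assms(1,2) _ refl] assms(3)]) (use assms in auto)
  have 2: "mfam (I \<union> J \<union> K) (\<lambda>x v. jordan (jordan (k x v) (g x v)) (f x v))"
    by (rule j[OF j[OF assms(3,2) _ refl] assms(1)]) (use assms in auto)
  have 3: "mfam (I \<union> J \<union> K) (\<lambda>x v. jordan (jordan (f x v) (k x v)) (g x v))"
    by (rule j[OF j[OF assms(1,3) _ refl] assms(2)]) (use assms in auto)
  from mfam.lin[OF half mfam.add[OF mfam.add[OF 1 2] mfam.lin[OF neg 3]]]
  show ?thesis by (simp add: triple_def)
qed

text \<open>Each rule differentiates into the class again, the old arguments being shifted to make
  room for the direction. An argument \<open>v i\<close> has derivative zero, which must count as a
  family in both indices; this is why \<open>zero\<close> admits every finite index set.\<close>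

lemma mfam_has_deriv: "mfam I f \<Longrightarrow> \<exists>f'. mfam_deriv I f f'"
proof (induction rule: mfam.induct)
  case base
  show ?case
  proof (intro exI[of _ "\<lambda>x v. v 0"] conjI ballI)
    show "mfam (insert 0 (Suc ` {})) (\<lambda>x v. v 0)" using mfam.arg[of 0] by simp
    show "dq cay_ball x (\<lambda>v. \<Prod>i\<in>{}. norm (v i)) (\<lambda>x v. x) (\<lambda>h v. case_nat h v 0)" for x
      by (rule dqI[where C = "norm x" and G = 1 and \<rho> = "\<lambda>_. 0"]) auto
  qed
next
  case (arg i)
  show ?case
  proof (intro exI[of _ "\<lambda>x v. 0"] conjI ballI)
    show "mfam (insert 0 (Suc ` {i})) (\<lambda>x v. 0)" by (rule mfam.zero) simp
    show "dq cay_ball x (\<lambda>v. \<Prod>i\<in>{i}. norm (v i)) (\<lambda>x v. v i) (\<lambda>h v. 0)" for x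
      by (rule dqI[where C = 1 and G = 0 and \<rho> = "\<lambda>_. 0"]) auto
  qed
next
  case (zero I)
  show ?case
  proof (intro exI[of _ "\<lambda>x v. 0"] conjI ballI)
    show "mfam (insert 0 (Suc ` I)) (\<lambda>x v. 0)" by (rule mfam.zero) (use zero in simp)
    show "dq cay_ball x (\<lambda>v. \<Prod>i\<in>I. norm (v i)) (\<lambda>x v. 0) (\<lambda>h v. 0)" for x
      by (rule dqI[where C = 0 and G = 0 and \<rho> = "\<lambda>_. 0"]) (auto simp: prod_nonneg)
  qed
next
  case (add I f g)
  then obtain f' g' where "mfam_deriv I f f'" "mfam_deriv I g g'" by blast
  then show ?case
    by (intro exI[of _ "\<lambda>x v. f' x v + g' x v"]) (auto intro: mfam.add dq_add)
next
  case (lin l I f)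
  then obtain f' where "mfam_deriv I f f'" by blast
  then show ?case
    by (intro exI[of _ "\<lambda>x v. l (f' x v)"]) (auto intro: mfam.lin lin.hyps(1) dq_linear)
next
  case (bil b I f J g)
  then obtain f' g' where f': "mfam_deriv I f f'" and g': "mfam_deriv J g g'" by blast
  let ?s = "\<lambda>v :: nat \<Rightarrow> 'a u2. \<lambda>i. v (Suc i)"
  let ?h = "\<lambda>x v. b (f' x v) (g x (?s v)) + b (f x (?s v)) (g' x v)"
  have dis: "Suc ` I \<inter> Suc ` J = {}" using bil.hyps(4) by auto
  have "mfam (insert 0 (Suc ` (I \<union> J))) ?h"
  proof (rule mfam.add)
    show "mfam (insert 0 (Suc ` (I \<union> J))) (\<lambda>x v. b (f' x v) (g x (?s v)))"
      by (rule mfam_bil_cong[OF bil.hyps(1) conjunct1[OF f'] mfam_shift[OF bil.hyps(3)]]) (use dis in auto)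
    show "mfam (insert 0 (Suc ` (I \<union> J))) (\<lambda>x v. b (f x (?s v)) (g' x v))"
      by (rule mfam_bil_cong[OF bil.hyps(1) mfam_shift[OF bil.hyps(2)] conjunct1[OF g']]) (use dis in auto)
  qed
  moreover have "dq cay_ball x (\<lambda>v. \<Prod>i\<in>I \<union> J. norm (v i)) (\<lambda>x v. b (f x v) (g x v))
      (\<lambda>h v. ?h x (case_nat h v))" if x: "x \<in> cay_ball" for x
    using dq_bilinear[OF bil.hyps(1) conjunct2[OF f', THEN bspec, OF x] conjunct2[OF g', THEN bspec, OF x]]
    by (simp add: prod.union_disjoint[OF mfam_finite[OF bil.hyps(2)] mfam_finite[OF bil.hyps(3)] bil.hyps(4)])
  ultimately show ?case by blast
next
  case (cay I f)
  then obtain f' where f': "mfam_deriv I f f'" by blast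
  let ?s = "\<lambda>v :: nat \<Rightarrow> 'a u2. \<lambda>i. v (Suc i)"
  let ?h = "\<lambda>x v. cayC x (f' x v + cayN_deriv x (v 0) (cayC x (f x (?s v))))"
  have c: "mfam (Suc ` I) (\<lambda>x v. cayC x (f x (?s v)))"
    by (rule mfam.cay[OF mfam_shift[OF cay.hyps]])
  have "mfam (insert 0 (Suc ` I)) ?h"
  proof (intro mfam.cay mfam.add conjunct1[OF f'], unfold cayN_deriv_def, rule mfam.add)
    show "mfam (insert 0 (Suc ` I)) (\<lambda>x v. u2_commutator (v 0) (cayC x (f x (?s v))))"
      by (rule mfam_bil_cong[OF bounded_bilinear_commutator mfam.arg c]) auto
    show "mfam (insert 0 (Suc ` I)) (\<lambda>x v. triple (v 0) (cayC x (f x (?s v))) x)"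
      using mfam_triple[OF mfam.arg[of 0] c mfam.base] by auto
  qed
  moreover have "dq cay_ball x (\<lambda>v. \<Prod>i\<in>I. norm (v i)) (\<lambda>x v. cayC x (f x v))
      (\<lambda>h v. ?h x (case_nat h v))" if x: "x \<in> cay_ball" for x
    using dq_cayC[OF x conjunct2[OF f', THEN bspec, OF x]] by simp
  ultimately show ?case by blast
qed

lemma nth_Cons_case: "(!) (x # xs) = case_nat x ((!) xs)"
  by (rule ext) (simp add: nth_Cons)

lemma nth_update_fun: "i < length xs \<Longrightarrow> (!) (xs[i := a]) = ((!) xs)(i := a)"
  by (rule ext) (simp add: nth_list_update)

lemma prod_list_norm_nth: "prod_list (map norm vs) = (\<Prod>i<length vs. norm (vs ! i))"
  by (simp add: prod.list_conv_set_nth atLeast0LessThan)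

text \<open>Since differentiation stays in the class, derivatives of all orders can be chosen
  recursively. Lists enter as functions \<open>(!) vs\<close>; then \<open>h # vs\<close> is
  \<open>case_nat h\<close>, matching the place of the new direction.\<close>

lemma mfam_smooth:
  assumes f: "mfam {} f"
  shows "smooth_map_on UNIV norm UNIV norm cay_ball (\<lambda>x. f x ((!) []))"
proof -
  have "\<exists>F. \<forall>n. (mfam {..<n} (F n) \<and> (n = 0 \<longrightarrow> F n = f)) \<and> mfam_deriv {..<n} (F n) (F (Suc n))"
  proof (rule dependent_nat_choice)
    show "\<exists>x. mfam {..<0} x \<and> (0 = 0 \<longrightarrow> x = f)" using f by auto
    fix g and n :: nat
    assume "mfam {..<n} g \<and> (n = 0 \<longrightarrow> g = f)"
    then obtain g' where "mfam_deriv {..<n} g g'" using mfam_has_deriv by blast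
    then show "\<exists>y. (mfam {..<Suc n} y \<and> (Suc n = 0 \<longrightarrow> y = f)) \<and> mfam_deriv {..<n} g y"
      unfolding lessThan_Suc_eq_insert_0 by blast
  qed
  then obtain F where F0: "F 0 = f" and F: "\<And>n. mfam {..<n} (F n)"
    and dF: "\<And>n x. x \<in> cay_ball \<Longrightarrow> dq cay_ball x (\<lambda>v. \<Prod>i<n. norm (v i)) (F n) (\<lambda>h v. F (Suc n) x (case_nat h v))"
    by blast
  show ?thesis unfolding smooth_map_on_def
  proof (intro exI[of _ "\<lambda>k x vs. F k x ((!) vs)"] conjI ballI allI impI)
    show "F 0 x ((!) []) = f x ((!) [])" for x by (simp add: F0)
    fix k and x :: "'a u2" assume x: "x \<in> cay_ball"
    then have nx: "norm x \<le> 1/20" by simp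
    show "bounded_multilinear_on UNIV norm UNIV norm k (\<lambda>vs. F k x ((!) vs))"
      unfolding bounded_multilinear_on_def
    proof (intro conjI ballI allI impI)
      fix vs :: "'a u2 list" and i v w r assume "i < k" "length vs = k"
      then show "F k x ((!) (vs[i := v + w])) = F k x ((!) (vs[i := v])) + F k x ((!) (vs[i := w]))"
        "F k x ((!) (vs[i := r *\<^sub>R v])) = r *\<^sub>R F k x ((!) (vs[i := v]))"
        using mfam_linear[OF F[of k] nx, of i "(!) vs"] by (simp_all add: nth_update_fun linear_iff)
    next
      obtain C where "\<And>v. norm (F k x v) \<le> C * (\<Prod>i<k. norm (v i))" using mfam_bound[OF F[of k] nx] by blast
      then show "\<exists>C. \<forall>vs\<in>lists UNIV. length vs = k \<longrightarrow> norm (F k x ((!) vs)) \<le> C * prod_list (map norm vs)"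
        by (auto simp: prod_list_norm_nth)
    qed simp
    fix \<epsilon> :: real assume \<epsilon>: "\<epsilon> > 0"
    obtain \<rho> where \<rho>: "(\<rho> \<longlongrightarrow> 0) (at 0)" "\<And>h. 0 \<le> \<rho> h"
      "\<And>h v. x + h \<in> cay_ball \<Longrightarrow> norm (F k (x + h) v - F k x v - F (Suc k) x (case_nat h v))
        \<le> \<rho> h * norm h * (\<Prod>i<k. norm (v i))"
      using dF[OF x, of k] unfolding dq_def by blast
    from \<rho>(1) \<epsilon> obtain d where d: "d > 0" "\<And>h. h \<noteq> 0 \<Longrightarrow> norm h < d \<Longrightarrow> \<rho> h < \<epsilon>"
      using \<rho>(2) unfolding LIM_def dist_norm by force
    show "\<exists>\<delta>>0. \<forall>h\<in>UNIV. norm h < \<delta> \<and> x + h \<in> cay_ball \<longrightarrow> (\<forall>vs\<in>lists UNIV. length vs = k \<longrightarrow>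
        norm (F k (x + h) ((!) vs) - F k x ((!) vs) - F (Suc k) x ((!) (h # vs))) \<le> \<epsilon> * norm h * prod_list (map norm vs))"
    proof (intro exI[of _ d] conjI ballI impI d(1))
      fix h :: "'a u2" and vs :: "'a u2 list" assume h: "norm h < d \<and> x + h \<in> cay_ball" and vs: "length vs = k"
      have "norm (F k (x + h) ((!) vs) - F k x ((!) vs) - F (Suc k) x ((!) (h # vs)))
        \<le> (\<rho> h * norm h) * (\<Prod>i<k. norm (vs ! i))"
        unfolding nth_Cons_case using h by (intro \<rho>(3)) simp
      also have "\<dots> \<le> (\<epsilon> * norm h) * (\<Prod>i<k. norm (vs ! i))"
      proof (rule mult_right_mono)
        show "\<rho> h * norm h \<le> \<epsilon> * norm h" using d(2)[of h] h by (cases "h = 0") auto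
      qed (simp add: prod_nonneg)
      finally show "norm (F k (x + h) ((!) vs) - F k x ((!) vs) - F (Suc k) x ((!) (h # vs))) \<le> \<epsilon> * norm h * prod_list (map norm vs)"
        by (simp add: prod_list_norm_nth vs)
    qed
  qed
qed

context coadjoint
begin

lemma orbit_smooth: "smooth_map_on UNIV norm UNIV norm cay_ball orbit"
  using mfam_smooth[OF mfam.cay[OF mfam.lin[OF bounded_linear_compose[OF bounded_linear_scaleR_right bounded_linear_\<delta>] mfam.base]], of 2]
  by (simp add: orbit_def[abs_def])

lemma orbit_has_derivative:
  assumes x: "x \<in> cay_ball"
  shows "(orbit has_derivative (\<lambda>V. cayC x (2 *\<^sub>R \<delta> V + cayN_deriv x V (orbit x)))) (at x)"
proof -
  have X: "norm x \<le> 1/20" using x by simp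
  have bl: "bounded_linear (\<lambda>V. 2 *\<^sub>R \<delta> V)"
    by (rule bounded_linear_compose[OF bounded_linear_scaleR_right bounded_linear_\<delta>])
  \<comment> \<open>A one-point parameter type with weight 1 reduces \<open>dq\<close> to ordinary
    differentiability.\<close>
  have "dq cay_ball x (\<lambda>_::unit. 1) (\<lambda>x _. x) (\<lambda>h _. h)"
    by (rule dqI[where C = "norm x" and G = 1 and \<rho> = "\<lambda>_. 0"]) auto
  from dq_cayC[OF x dq_linear[OF bl this]]
  have "dq cay_ball x (\<lambda>_::unit. 1) (\<lambda>x _. orbit x) (\<lambda>V _. cayC x (2 *\<^sub>R \<delta> V + cayN_deriv x V (orbit x)))"
    by (simp add: orbit_def)
  then show ?thesis
  proof (rule dq_has_derivative[OF _ open_ball x, of _ _ _ "()"])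
    have "linear (\<lambda>V. 2 *\<^sub>R \<delta> V + cayN_deriv x V (orbit x))"
      by (rule linearI) (simp_all add: cayN_deriv_def opr_inject[symmetric] opr_triple opr_\<delta> algebra_simps)
    from linear_compose[OF this linear_cayC[OF X]]
    show "linear (\<lambda>V. cayC x (2 *\<^sub>R \<delta> V + cayN_deriv x V (orbit x)))" by (simp add: o_def)
  qed
qed

end

section \<open>The Poisson structure\<close>

locale skew_contraction =
  fixes d :: "'h::complex_hilbert \<Rightarrow> 'h"
  assumes d_add: "d (x + y) = d x + d y"
    and d_scaleC: "d (c *\<^sub>C x) = c *\<^sub>C d x"
    and d_norm: "norm (d x) \<le> norm x"
    and d_skew: "cinner (d x) y = - cinner x (d y)"
begin

definition d_comm :: "'h u2 \<Rightarrow> 'h u2" where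
  "d_comm B = (THE C. u2_apply C = (\<lambda>x. u2_apply B (d x) - d (u2_apply B x)))"

lemma d_left_le: "norm (d (u2_apply B x)) \<le> 1 * norm (u2_apply B x)"
  using d_norm by simp

lemma hilbert_schmidt_d_left: "hilbert_schmidt (\<lambda>x. d (u2_apply B x))"
  by (rule hilbert_schmidt_dominated[OF u2_hs d_left_le])

text \<open>Basis vectors are not adapted to \<open>d\<close>, so \<open>B d\<close> is not
  dominated termwise by \<open>B\<close>. It is, however, the adjoint of \<open>d B\<close>.\<close>

lemma hilbert_schmidt_d_right:
  shows "hilbert_schmidt (\<lambda>x. u2_apply B (d x))"
    and "(\<Sum>\<^sub>\<infinity>e\<in>onb. (norm (u2_apply B (d e)))\<^sup>2) = (\<Sum>\<^sub>\<infinity>e\<in>onb. (norm (d (u2_apply B e)))\<^sup>2)"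
proof -
  have "cinner (d (u2_apply B x)) y = cinner x (u2_apply B (d y))" for x y
    by (simp add: d_skew u2_cinner)
  from hilbert_schmidt_adjoint[OF hilbert_schmidt_d_left this]
  show "hilbert_schmidt (\<lambda>x. u2_apply B (d x))"
    "(\<Sum>\<^sub>\<infinity>e\<in>onb. (norm (u2_apply B (d e)))\<^sup>2) = (\<Sum>\<^sub>\<infinity>e\<in>onb. (norm (d (u2_apply B e)))\<^sup>2)"
    by auto
qed

lemma linear_d: "linear d"
  by (rule linearI) (simp_all add: d_add d_scaleC scaleR_scaleC)

lemma u2_apply_d_comm: "u2_apply (d_comm B) x = u2_apply B (d x) - d (u2_apply B x)"
proof -
  let ?f = "\<lambda>x. u2_apply B (d x) - d (u2_apply B x)"
  obtain C where C: "u2_apply C = ?f"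
  proof (rule ex_u2)
    show "?f (x + y) = ?f x + ?f y" for x y
      by (simp add: d_add linear_add[OF linear_u2_apply])
    show "?f (c *\<^sub>C x) = c *\<^sub>C ?f x" for c x
      by (simp add: d_scaleC u2_apply_scaleC complex_space.scale_right_diff_distrib)
    show "norm (?f x) \<le> (2 * norm B) * norm x" for x
    proof -
      have "norm (u2_apply B (d x)) \<le> norm B * norm x"
        by (rule order.trans[OF norm_u2_apply_le mult_left_mono[OF d_norm norm_ge_zero]])
      moreover have "norm (d (u2_apply B x)) \<le> norm B * norm x"
        by (rule order.trans[OF d_norm norm_u2_apply_le])
      ultimately show ?thesis using norm_triangle_ineq4[of "u2_apply B (d x)" "d (u2_apply B x)"] by simp
    qed
    have "hilbert_schmidt (\<lambda>x. - d (u2_apply B x))"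
      by (rule hilbert_schmidt_dominated[OF hilbert_schmidt_d_left[of B], where C = 1]) simp
    from hilbert_schmidt_add[OF hilbert_schmidt_d_right(1) this]
    show "hilbert_schmidt ?f" by simp
    show "cinner (?f x) y = - cinner x (?f y)" for x y
      by (simp add: cinner_diff_left cinner_diff_right d_skew u2_cinner)
  qed
  then have "d_comm B = C" unfolding d_comm_def
    by (intro the_equality) (auto simp: u2_eq_iff)
  with C show ?thesis by simp
qed

definition d_endo :: "'h endo" where
  "d_endo = Abs_endo d"

lemma endo_apply_d_endo [simp]: "endo_apply d_endo x = d x"
  unfolding d_endo_def endo_apply.rep_eq by (simp add: Abs_endo_inverse linear_d)

lemma opr_d_comm: "opr (d_comm B) = opr B * d_endo - d_endo * opr B"
  by (rule endo_eqI) (simp add: u2_apply_d_comm)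

lemma norm_d_comm_le: "norm (d_comm B) \<le> 2 * norm B"
proof (rule power2_le_imp_le)
  let ?S = "\<Sum>\<^sub>\<infinity>e\<in>onb. (norm (d (u2_apply B e)))\<^sup>2"
  have l: "((\<lambda>e. (norm (d (u2_apply B e)))\<^sup>2) has_sum ?S) onb"
    using hilbert_schmidt_d_left unfolding hilbert_schmidt_def by (rule has_sum_infsum)
  have r: "((\<lambda>e. (norm (u2_apply B (d e)))\<^sup>2) has_sum ?S) onb"
    unfolding hilbert_schmidt_d_right(2)[symmetric]
    using hilbert_schmidt_d_right(1) unfolding hilbert_schmidt_def by (rule has_sum_infsum)
  have S: "?S \<le> (norm B)\<^sup>2"
    using d_norm by (intro has_sum_mono[OF l u2_norm_sq_has_sum] power_mono) auto
  have "(norm (u2_apply (d_comm B) e))\<^sup>2 \<le> 2 * (norm (u2_apply B (d e)))\<^sup>2 + 2 * (norm (d (u2_apply B e)))\<^sup>2" for e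
  proof -
    have "(norm (u2_apply (d_comm B) e))\<^sup>2 \<le> (norm (u2_apply B (d e)) + norm (d (u2_apply B e)))\<^sup>2"
      unfolding u2_apply_d_comm by (intro power_mono norm_triangle_ineq4) simp
    then show ?thesis
      using sum_squares_bound[of "norm (u2_apply B (d e))" "norm (d (u2_apply B e))"]
      by (simp add: power2_sum)
  qed
  then have "(norm (d_comm B))\<^sup>2 \<le> 2 * ?S + 2 * ?S"
    by (intro has_sum_mono[OF u2_norm_sq_has_sum has_sum_add[OF has_sum_cmult_right[OF r] has_sum_cmult_right[OF l]]])
  with S show "(norm (d_comm B))\<^sup>2 \<le> (2 * norm B)\<^sup>2" by (simp add: power_mult_distrib)
qed simp

lemma bounded_linear_d_comm: "bounded_linear d_comm"
  by (rule bounded_linear_intro[where K = 2])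
    (use norm_d_comm_le in \<open>simp_all add: opr_inject[symmetric] opr_d_comm algebra_simps\<close>)

definition ham :: "'h u2 \<Rightarrow> real \<Rightarrow> 'h u2 \<Rightarrow> 'h u2" where
  "ham \<mu> \<gamma> B = u2_commutator B \<mu> + \<gamma> *\<^sub>R d_comm B"

lemma coadjoint_ham: "coadjoint (opr \<mu> + \<gamma> *\<^sub>R d_endo) (ham \<mu> \<gamma>)"
proof (rule coadjoint.intro)
  show "bounded_linear (ham \<mu> \<gamma>)" unfolding ham_def[abs_def]
    by (intro bounded_linear_add bounded_bilinear.bounded_linear_left[OF bounded_bilinear_commutator]
        bounded_linear_compose[OF bounded_linear_scaleR_right bounded_linear_d_comm])
  show "opr (ham \<mu> \<gamma> B) = opr B * (opr \<mu> + \<gamma> *\<^sub>R d_endo) - (opr \<mu> + \<gamma> *\<^sub>R d_endo) * opr B" for B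
    by (simp add: ham_def opr_d_comm algebra_simps)
qed

text \<open>With \<open>\<nu> = orbit X\<close> this identifies the range found in
  \<open>tangent_of_orbit\<close> with the distribution at the displaced point.\<close>

lemma ham_add: "ham (\<mu> + \<nu>) \<gamma> B = ham \<mu> \<gamma> B + u2_commutator B \<nu>"
  by (simp add: opr_inject[symmetric] coadjoint.opr_\<delta>[OF coadjoint_ham] algebra_simps)

end

text \<open>Riesz representation supplies the operator described by \<open>D_mu\<close>, and
  nondegeneracy of the pairing makes it unique.\<close>

lemma D_mu_pairing:
  assumes "f differentiable (at (\<mu>, \<gamma>))"
  shows "frechet_derivative f (at (\<mu>, \<gamma>)) (B, 0) = pairing (D_mu f (\<mu>, \<gamma>)) B"
proof -
  let ?F = "frechet_derivative f (at (\<mu>, \<gamma>))"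
  have F: "(f has_derivative ?F) (at (\<mu>, \<gamma>))" using assms frechet_derivative_works by blast
  have "((\<lambda>\<nu>. (\<nu>, \<gamma>)) has_derivative (\<lambda>B. (B, 0))) (at \<mu>)"
    by (auto intro!: derivative_eq_intros)
  from has_derivative_compose[OF this F]
  have G: "((\<lambda>\<nu>. f (\<nu>, \<gamma>)) has_derivative (\<lambda>B. ?F (B, 0))) (at \<mu>)" .
  obtain a where a: "\<And>B. ?F (B, 0) = inner a B"
    using riesz_representation[OF has_derivative_bounded_linear[OF G]] by blast
  have pa: "(\<lambda>B. ?F (B, 0)) = (\<lambda>B. pairing (- a) B)" by (simp add: a pairing_eq fun_eq_iff)
  have "D_mu f (\<mu>, \<gamma>) = - a"
    unfolding D_mu_def prod.case
  proof (rule the_equality)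
    show "((\<lambda>\<nu>. f (\<nu>, \<gamma>)) has_derivative (\<lambda>B. pairing (- a) B)) (at \<mu>)" using G unfolding pa .
    fix A assume "((\<lambda>\<nu>. f (\<nu>, \<gamma>)) has_derivative (\<lambda>B. pairing A B)) (at \<mu>)"
    from has_derivative_unique[OF this G] have pe: "pairing A B = pairing (- a) B" for B
      unfolding pa by (rule fun_cong)
    have "inner (A + a) B = 0" for B
      using pe[of B] unfolding pairing_eq inner_add_left inner_minus_left by linarith
    then show "A = - a" by (metis eq_neg_iff_add_eq_0 inner_eq_zero_iff)
  qed
  with pa show ?thesis by (metis)
qed

lemma smooth_map_on_linear:
  assumes f: "bounded_linear f" "f ` E \<subseteq> F" and E: "subspace E" and F: "0 \<in> F" and U: "U \<subseteq> E"
  shows "smooth_map_on E norm F norm U f"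
proof -
  interpret bounded_linear f by fact
  \<comment> \<open>On lists of length \<open>k\<close> this is \<open>f x\<close> for order 0, the
    constant derivative \<open>f\<close> for order 1, and zero beyond.\<close>
  define D where "D k x vs = (case vs of [] \<Rightarrow> f x | [v] \<Rightarrow> f v | _ \<Rightarrow> 0)" for k :: nat and x vs
  show ?thesis unfolding smooth_map_on_def
  proof (intro exI[of _ D] conjI ballI allI impI)
    show "D 0 x [] = f x" for x by (simp add: D_def)
    fix k x assume x: "x \<in> U"
    show "bounded_multilinear_on E norm F norm k (D k x)"
      unfolding bounded_multilinear_on_def
    proof (intro conjI ballI allI impI)
      fix vs assume "vs \<in> lists E"
      then show "D k x vs \<in> F" using f(2) F U x by (auto simp: D_def split: list.split)
    next
      fix vs i v w r assume vs: "vs \<in> lists E" "length vs = k" "i < k"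
      then have "(i = 0 \<and> (\<exists>u. vs = [u])) \<or> (\<exists>u1 u2 us. vs = u1 # u2 # us)"
        by (cases vs rule: remdups_adj.cases) auto
      then show "D k x (vs[i := v + w]) = D k x (vs[i := v]) + D k x (vs[i := w])"
        "D k x (vs[i := r *\<^sub>R v]) = r *\<^sub>R D k x (vs[i := v])"
        by (auto simp: D_def add scaleR split: nat.split)
    next
      obtain K where K: "0 \<le> K" "\<And>y. norm (f y) \<le> norm y * K" using nonneg_bounded by blast
      have "norm (D k x vs) \<le> max (norm (f x)) K * prod_list (map norm vs)" for vs
        using order.trans[OF K(2) mult_left_mono[OF max.cobounded2 norm_ge_zero]]
        by (auto simp: D_def mult.commute K(1) le_max_iff_disj split: list.split
            intro!: mult_nonneg_nonneg prod_list_nonneg)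
      then show "\<exists>C. \<forall>vs\<in>lists E. length vs = k \<longrightarrow> norm (D k x vs) \<le> C * prod_list (map norm vs)" by blast
    qed
    fix \<epsilon> :: real assume "\<epsilon> > 0"
    have "D k (x + h) vs - D k x vs - D (Suc k) x (h # vs) = 0" for h vs
      by (auto simp: D_def add split: list.split)
    then show "\<exists>\<delta>>0. \<forall>h\<in>E. norm h < \<delta> \<and> x + h \<in> U \<longrightarrow> (\<forall>vs\<in>lists E. length vs = k \<longrightarrow>
        norm (D k (x + h) vs - D k x vs - D (Suc k) x (h # vs)) \<le> \<epsilon> * norm h * prod_list (map norm vs))"
      using \<open>\<epsilon> > 0\<close> by (auto intro!: exI[of _ 1] mult_nonneg_nonneg prod_list_nonneg)
  qed
qed

lemma smooth_map_on_cong: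
  assumes "smooth_map_on E n F m U f" "\<And>x. x \<in> U \<Longrightarrow> f x = g x"
  shows "smooth_map_on E n F m U g"
  using assms unfolding smooth_map_on_def by metis

section \<open>Hamiltonian vector fields and the characteristic distribution\<close>

context
  fixes Hp Hm :: "'h::complex_hilbert set"
  assumes Hp: "complex_space.subspace Hp" and Hm: "complex_space.subspace Hm"
    and orth: "\<And>x y. x \<in> Hp \<Longrightarrow> y \<in> Hm \<Longrightarrow> cinner x y = 0"
    and sum: "\<And>z. \<exists>x\<in>Hp. \<exists>y\<in>Hm. z = x + y"
begin

lemma orth_proj_unique:
  assumes S: "complex_space.subspace S" and y: "y \<in> S" "\<And>z. z \<in> S \<Longrightarrow> cinner z (x - y) = 0"
  shows "orth_proj S x = y"
  unfolding orth_proj_def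
proof (rule the_equality)
  fix y' assume y': "y' \<in> S \<and> (\<forall>z\<in>S. cinner z (x - y') = 0)"
  have "y' - y \<in> S" using S y y' complex_space.subspace_diff by blast
  then have "cinner (y' - y) (x - y) - cinner (y' - y) (x - y') = 0" using y y' by simp
  then have "cinner (y' - y) (y' - y) = 0" by (simp add: cinner_diff_right)
  then show "y' = y" by (simp add: cinner_self)
qed (use y in auto)

lemma d_op_sum:
  assumes "x \<in> Hp" "y \<in> Hm"
  shows "d_op Hp Hm (x + y) = \<i> *\<^sub>C (x - y)"
proof -
  have "orth_proj Hp (x + y) = x"
    by (rule orth_proj_unique[OF Hp assms(1)]) (simp add: orth assms)
  moreover have "orth_proj Hm (x + y) = y"
  proof (rule orth_proj_unique[OF Hm assms(2)])
    fix z assume "z \<in> Hm"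
    then show "cinner z (x + y - y) = 0" using orth[OF assms(1)] cinner_commute[of z x] by simp
  qed
  ultimately show ?thesis by (simp add: d_op_def)
qed

lemma skew_contraction_d_op: "skew_contraction (d_op Hp Hm)"
proof
  fix u v :: 'h and c
  obtain x y where u: "x \<in> Hp" "y \<in> Hm" "u = x + y" using sum by blast
  obtain x' y' where v: "x' \<in> Hp" "y' \<in> Hm" "v = x' + y'" using sum by blast
  have du: "d_op Hp Hm u = \<i> *\<^sub>C (x - y)" and dv: "d_op Hp Hm v = \<i> *\<^sub>C (x' - y')"
    using d_op_sum u v by auto
  have uv: "u + v = (x + x') + (y + y')" by (simp add: u v)
  have "x + x' \<in> Hp" "y + y' \<in> Hm" using u v Hp Hm complex_space.subspace_add by blast+
  from d_op_sum[OF this] show "d_op Hp Hm (u + v) = d_op Hp Hm u + d_op Hp Hm v"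
    by (simp add: uv du dv scaleC_add_right[symmetric])
  have cu: "c *\<^sub>C u = c *\<^sub>C x + c *\<^sub>C y" by (simp add: u scaleC_add_right)
  have "c *\<^sub>C x \<in> Hp" "c *\<^sub>C y \<in> Hm" using u Hp Hm complex_space.subspace_scale by blast+
  from d_op_sum[OF this] show "d_op Hp Hm (c *\<^sub>C u) = c *\<^sub>C d_op Hp Hm u"
    by (simp add: cu du complex_space.scale_right_diff_distrib scaleC_scaleC mult.commute)
  have "inner x y = 0" using orth[OF u(1,2)] Re_cinner[of x y] by simp
  then have "(norm (x - y))\<^sup>2 = (norm (x + y))\<^sup>2"
    by (simp add: power2_norm_eq_inner inner_add_left inner_add_right inner_diff_left inner_diff_right
        inner_commute)
  then show "norm (d_op Hp Hm u) \<le> norm u"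
    using d_op_sum[OF u(1,2)] u(3) by (simp add: power2_eq_iff_nonneg)
  have "cinner x y' = 0" "cinner y x' = 0"
    using orth[OF u(1) v(2)] orth[OF v(1) u(2)] cinner_commute[of y x'] by auto
  then show "cinner (d_op Hp Hm u) v = - cinner u (d_op Hp Hm v)"
    by (simp add: u v d_op_sum[OF u(1,2)] d_op_sum[OF v(1,2)] cinner_scaleC_left cinner_scaleC_right
        cinner_add_left cinner_add_right cinner_diff_left cinner_diff_right algebra_simps)
qed

interpretation d: skew_contraction "d_op Hp Hm"
  by (rule skew_contraction_d_op)

lemma cocycle_eq: "cocycle Hp Hm A B = inner A (d.d_comm B)"
proof -
  have "u2_apply A (d_op Hp Hm (u2_apply B x) - u2_apply B (d_op Hp Hm x))
      = (u2_apply A \<circ> u2_apply (- d.d_comm B)) x" for x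
    by (simp add: d.u2_apply_d_comm)
  then have "cocycle Hp Hm A B = pairing A (- d.d_comm B)"
    unfolding cocycle_def pairing_def by presburger
  then show ?thesis by (simp add: pairing_eq)
qed

text \<open>Invariance of the trace form isolates \<open>D_mu f\<close>; the cocycle is already a
  trace form against \<open>[D_mu g, d]\<close>, so both terms merge into the commutator of
  \<open>D_mu g\<close> with \<open>\<mu> + \<gamma> d\<close>.\<close>

lemma poisson_bracket_eq:
  "poisson_bracket Hp Hm f g (\<mu>, \<gamma>) = pairing (D_mu f (\<mu>, \<gamma>)) (d.ham \<mu> \<gamma> (D_mu g (\<mu>, \<gamma>)))"
  using inner_commutator[of "D_mu f (\<mu>, \<gamma>)" "D_mu g (\<mu>, \<gamma>)" \<mu>]
  by (simp add: poisson_bracket_def cocycle_eq pairing_eq d.ham_def inner_add_right inner_commute)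

lemma D_mu_pairing_fst: "D_mu (\<lambda>p. pairing A (fst p)) q = A"
proof -
  obtain \<mu> \<gamma> where q: "q = (\<mu>, \<gamma>)" by fastforce
  have bl: "bounded_linear (\<lambda>B. pairing A B)"
    unfolding pairing_eq by (intro bounded_linear_minus bounded_linear_inner_right)
  then have "((\<lambda>B. pairing A B) has_derivative (\<lambda>B. pairing A B)) (at \<mu>)"
    by (rule bounded_linear_imp_has_derivative)
  then show ?thesis
    unfolding D_mu_def q prod.case fst_conv
  proof (rule the_equality)
    fix A' assume "((\<lambda>B. pairing A B) has_derivative (\<lambda>B. pairing A' B)) (at \<mu>)"
    from has_derivative_unique[OF this bounded_linear_imp_has_derivative[OF bl]]
    have "pairing A' B = pairing A B" for B by (rule fun_cong)
    then have "inner (A' - A) B = 0" for B by (simp add: pairing_eq inner_diff_left)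
    then show "A' = A" by (metis eq_iff_diff_eq_0 inner_eq_zero_iff)
  qed
qed

lemma D_mu_snd: "D_mu snd q = 0"
proof -
  obtain \<mu> \<gamma> where q: "q = (\<mu>, \<gamma>)" by fastforce
  have "((\<lambda>\<nu>. snd (\<nu>, \<gamma>)) has_derivative (\<lambda>B. pairing 0 B)) (at \<mu>)"
    by (simp add: pairing_eq)
  then show ?thesis
    unfolding D_mu_def q prod.case
  proof (rule the_equality)
    fix A' assume *: "((\<lambda>\<nu>. snd (\<nu>, \<gamma>)) has_derivative (\<lambda>B. pairing A' B)) (at \<mu>)"
    have "((\<lambda>\<nu>. snd (\<nu>, \<gamma>)) has_derivative (\<lambda>B. 0)) (at \<mu>)" by simp
    from has_derivative_unique[OF * this] have "inner A' B = 0" for B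
      by (simp add: pairing_eq fun_eq_iff)
    then show "A' = 0" by (metis inner_eq_zero_iff)
  qed
qed

lemma bounded_linear_pairing_fst: "bounded_linear (\<lambda>p. pairing A (fst p))"
  unfolding pairing_eq
  by (intro bounded_linear_minus bounded_linear_inner_right_comp bounded_linear_fst)

lemma smooth_bounded_linear: "bounded_linear f \<Longrightarrow> smooth f"
  by (rule smooth_map_on_linear) auto

text \<open>The test functions \<open>pairing A (fst p)\<close> and \<open>snd\<close> are linear
  and determine both components of \<open>X\<close>. As \<open>D_mu snd\<close> vanishes,
  \<open>snd\<close> is a Casimir function and the second component is zero.\<close>

lemma hamiltonian_vector_field_iff:
  "hamiltonian_vector_field Hp Hm h X
    \<longleftrightarrow> (\<forall>\<mu> \<gamma>. X (\<mu>, \<gamma>) = (d.ham \<mu> \<gamma> (D_mu h (\<mu>, \<gamma>)), 0))"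
proof
  assume X: "hamiltonian_vector_field Hp Hm h X"
  show "\<forall>\<mu> \<gamma>. X (\<mu>, \<gamma>) = (d.ham \<mu> \<gamma> (D_mu h (\<mu>, \<gamma>)), 0)"
  proof (intro allI)
    fix \<mu> \<gamma>
    let ?v = "d.ham \<mu> \<gamma> (D_mu h (\<mu>, \<gamma>))"
    have fd: "frechet_derivative f (at p) = f" if "bounded_linear f" for f :: "'h u2 \<times> real \<Rightarrow> real" and p
      using frechet_derivative_at[OF bounded_linear_imp_has_derivative[OF that]] by metis
    have "pairing A (fst (X (\<mu>, \<gamma>))) = pairing A ?v" for A
      using X smooth_bounded_linear[OF bounded_linear_pairing_fst[of A]]
      unfolding hamiltonian_vector_field_def
      by (metis D_mu_pairing_fst bounded_linear_pairing_fst fd poisson_bracket_eq)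
    then have "inner A (fst (X (\<mu>, \<gamma>)) - ?v) = 0" for A by (simp add: pairing_eq inner_diff_right)
    then have 1: "fst (X (\<mu>, \<gamma>)) = ?v" by (metis eq_iff_diff_eq_0 inner_eq_zero_iff)
    have "snd (X (\<mu>, \<gamma>)) = pairing 0 ?v"
      using X smooth_bounded_linear[OF bounded_linear_snd]
      unfolding hamiltonian_vector_field_def
      by (metis D_mu_snd bounded_linear_snd fd poisson_bracket_eq)
    with 1 show "X (\<mu>, \<gamma>) = (?v, 0)" by (simp add: prod_eq_iff pairing_eq)
  qed
next
  assume X: "\<forall>\<mu> \<gamma>. X (\<mu>, \<gamma>) = (d.ham \<mu> \<gamma> (D_mu h (\<mu>, \<gamma>)), 0)"
  show "hamiltonian_vector_field Hp Hm h X"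
    unfolding hamiltonian_vector_field_def
    by (auto simp: X poisson_bracket_eq D_mu_pairing smooth_differentiable)
qed

text \<open>Linear Hamiltonians have constant \<open>D_mu\<close>, so every \<open>B\<close>
  occurs.\<close>

lemma characteristic_distribution_eq:
  "characteristic_distribution Hp Hm (\<mu>, \<gamma>) = (\<lambda>B. (d.ham \<mu> \<gamma> B, 0)) ` UNIV"
proof (intro subset_antisym subsetI)
  fix v assume "v \<in> characteristic_distribution Hp Hm (\<mu>, \<gamma>)"
  then show "v \<in> (\<lambda>B. (d.ham \<mu> \<gamma> B, 0)) ` UNIV"
    unfolding characteristic_distribution_def hamiltonian_vector_field_iff by auto
next
  fix v assume "v \<in> (\<lambda>B. (d.ham \<mu> \<gamma> B, 0 :: real)) ` UNIV"
  then obtain B where B: "v = (d.ham \<mu> \<gamma> B, 0)" by blast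
  define h where "h p = pairing B (fst p)" for p :: "'h u2 \<times> real"
  define X where "X = (\<lambda>(\<mu>, \<gamma>). (d.ham \<mu> \<gamma> B, 0 :: real))"
  have "hamiltonian_vector_field Hp Hm h X"
    unfolding hamiltonian_vector_field_iff h_def D_mu_pairing_fst X_def by simp
  moreover have "smooth h" unfolding h_def by (rule smooth_bounded_linear[OF bounded_linear_pairing_fst])
  moreover have "v = X (\<mu>, \<gamma>)" by (simp add: B X_def)
  ultimately show "v \<in> characteristic_distribution Hp Hm (\<mu>, \<gamma>)"
    unfolding characteristic_distribution_def by blast
qed

end

section \<open>Integral manifolds\<close>

lemma banach_on_norm:
  fixes E :: "'a::banach set"
  assumes "subspace E" "closed E"
  shows "banach_on E norm"
  unfolding banach_on_def
proof (intro conjI ballI allI impI)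
  fix X :: "nat \<Rightarrow> 'a"
  assume X: "range X \<subseteq> E \<and> (\<forall>\<epsilon>>0. \<exists>N. \<forall>i\<ge>N. \<forall>j\<ge>N. norm (X i - X j) < \<epsilon>)"
  then have "Cauchy X" unfolding Cauchy_def dist_norm by blast
  then obtain x where x: "X \<longlonglongrightarrow> x" using Cauchy_convergent convergent_def by blast
  have "x \<in> E" by (rule closed_sequentially[OF assms(2) _ x]) (use X in auto)
  moreover have "(\<lambda>i. norm (X i - x)) \<longlonglongrightarrow> 0"
    by (rule tendsto_norm_zero[OF LIM_zero[OF x]])
  ultimately show "\<exists>x\<in>E. (\<lambda>i. norm (X i - x)) \<longlonglongrightarrow> 0" by blast
qed (use assms in \<open>auto intro: norm_triangle_ineq\<close>)

lemma has_frechet_derivative_on_restrict: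
  assumes f: "(f has_derivative T) (at x)" and g: "\<And>y. y \<in> U \<Longrightarrow> g y = f y" "x \<in> U"
  shows "has_frechet_derivative_on E norm UNIV norm U g x T"
proof -
  from f have "has_frechet_derivative_on UNIV norm UNIV norm UNIV f x T"
    by (simp add: has_frechet_derivative_on_UNIV)
  then show ?thesis
    unfolding has_frechet_derivative_on_def using g by simp meson
qed

text \<open>Carries smoothness from \<open>u2\<close> over to the copy of the slice in the product
  space, on which the integral manifold is modelled.\<close>

lemma smooth_map_on_graph:
  fixes f :: "'a::real_normed_vector \<Rightarrow> 'b::real_normed_vector" and c :: "'b \<times> 'c::real_normed_vector"
  assumes f: "smooth_map_on UNIV norm UNIV norm U f"
    and E: "E \<subseteq> UNIV \<times> {0 :: 'd::real_normed_vector}" and V: "\<And>p. p \<in> V \<Longrightarrow> fst p \<in> U"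
  shows "smooth_map_on E norm UNIV norm V (\<lambda>p. c + (f (fst p), 0))"
proof -
  obtain D where D0: "\<forall>x\<in>U. D 0 x [] = f x"
    and D1: "\<forall>k. \<forall>x\<in>U. bounded_multilinear_on UNIV norm UNIV norm k (D k x)"
    and D2: "\<forall>k. \<forall>x\<in>U. \<forall>\<epsilon>>0. \<exists>\<delta>>0. \<forall>h\<in>UNIV. norm h < \<delta> \<and> x + h \<in> U \<longrightarrow>
      (\<forall>vs\<in>lists UNIV. length vs = k \<longrightarrow>
        norm (D k (x + h) vs - D k x vs - D (Suc k) x (h # vs)) \<le> \<epsilon> * norm h * prod_list (map norm vs))"
    using f[unfolded smooth_map_on_def] by blast
  have nE: "norm p = norm (fst p)" if "p \<in> E" for p
    using E that by (cases p) (auto simp: norm_Pair)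
  have mE: "map norm vs = map norm (map fst vs)" if "vs \<in> lists E" for vs
    using that nE by auto
  \<comment> \<open>The constant \<open>c\<close> contributes at order 0 only, where the empty
    product of norms is 1; hence the bound \<open>norm c + C\<close> below.\<close>
  define D' :: "nat \<Rightarrow> 'a \<times> 'd \<Rightarrow> ('a \<times> 'd) list \<Rightarrow> 'b \<times> 'c" where
    "D' k p vs = (if k = 0 then c else 0) + (D k (fst p) (map fst vs), 0)" for k p vs
  show ?thesis unfolding smooth_map_on_def
  proof (intro exI[of _ D'] conjI ballI allI impI)
    show "D' 0 p [] = c + (f (fst p), 0)" if "p \<in> V" for p
      using bspec[OF D0 V[OF that]] by (simp add: D'_def)
    fix k p assume p: "p \<in> V"
    note B = D1[rule_format, OF V[OF p], of k, unfolded bounded_multilinear_on_def]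
    show "bounded_multilinear_on E norm UNIV norm k (D' k p)"
      unfolding bounded_multilinear_on_def
    proof (intro conjI ballI allI impI)
      fix vs :: "('a \<times> 'd) list" and i v w r assume vs: "i < k" "length vs = k"
      with B show "D' k p (vs[i := v + w]) = D' k p (vs[i := v]) + D' k p (vs[i := w])"
        "D' k p (vs[i := r *\<^sub>R v]) = r *\<^sub>R D' k p (vs[i := v])"
        by (auto simp: D'_def map_update)
    next
      obtain C where C: "\<And>vs. length vs = k \<Longrightarrow> norm (D k (fst p) vs) \<le> C * prod_list (map norm vs)"
        using B by auto
      have "norm (D' k p vs) \<le> (norm c + C) * prod_list (map norm vs)" if "vs \<in> lists E" "length vs = k" for vs
      proof (cases "k = 0")
        case True
        then show ?thesis
          using that norm_triangle_ineq[of c "(D 0 (fst p) [], 0)"] C[of "[]"] by (simp add: D'_def norm_Pair)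
      next
        case False
        have "norm (D' k p vs) \<le> C * prod_list (map norm vs)"
          using False C[of "map fst vs"] that by (simp add: D'_def norm_Pair mE)
        also have "\<dots> \<le> (norm c + C) * prod_list (map norm vs)"
          by (intro mult_right_mono prod_list_nonneg) auto
        finally show ?thesis .
      qed
      then show "\<exists>C. \<forall>vs\<in>lists E. length vs = k \<longrightarrow> norm (D' k p vs) \<le> C * prod_list (map norm vs)" by blast
    qed simp
    fix \<epsilon> :: real assume "\<epsilon> > 0"
    from D2[rule_format, OF V[OF p] this, of k] obtain \<delta> where \<delta>: "\<delta> > 0"
      "\<And>h vs. norm h < \<delta> \<Longrightarrow> fst p + h \<in> U \<Longrightarrow> length vs = k \<Longrightarrow>
        norm (D k (fst p + h) vs - D k (fst p) vs - D (Suc k) (fst p) (h # vs)) \<le> \<epsilon> * norm h * prod_list (map norm vs)"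
      by auto
    have "norm (D' k (p + h) vs - D' k p vs - D' (Suc k) p (h # vs)) \<le> \<epsilon> * norm h * prod_list (map norm vs)"
      if "h \<in> E" "norm h < \<delta>" "p + h \<in> V" "vs \<in> lists E" "length vs = k" for h vs
    proof -
      have "D' k (p + h) vs - D' k p vs - D' (Suc k) p (h # vs)
        = (D k (fst p + fst h) (map fst vs) - D k (fst p) (map fst vs) - D (Suc k) (fst p) (fst h # map fst vs), 0)"
        by (simp add: D'_def)
      then show ?thesis
        using \<delta>(2)[of "fst h" "map fst vs"] V[OF that(3)] that nE[OF that(1)] by (simp add: norm_Pair mE)
    qed
    then show "\<exists>\<delta>>0. \<forall>h\<in>E. norm h < \<delta> \<and> p + h \<in> V \<longrightarrow> (\<forall>vs\<in>lists E. length vs = k \<longrightarrow>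
        norm (D' k (p + h) vs - D' k p vs - D' (Suc k) p (h # vs)) \<le> \<epsilon> * norm h * prod_list (map norm vs))"
      using \<delta>(1) by blast
  qed
qed

text \<open>\<open>chart_inv\<close> is the identity on \<open>U\<close> but arbitrary elsewhere, so
  smoothness and derivatives are transferred by agreement on \<open>U\<close>.\<close>

lemma single_chart_integral_manifold:
  fixes E :: "'v::banach set"
  assumes E: "subspace E" "closed E"
    and U: "U \<subseteq> E" "open W" "U = E \<inter> W"
    and smooth: "smooth_map_on E norm UNIV norm U \<iota>"
    and inj: "inj_on \<iota> U"
    and T: "\<And>x. x \<in> U \<Longrightarrow> (\<iota> has_derivative T x) (at x)"
      "\<And>x. x \<in> U \<Longrightarrow> inj_on (T x) E" "\<And>x. x \<in> U \<Longrightarrow> T x ` E = P (\<iota> x)"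
  shows "integral_manifold P U {\<lparr>cdom = U, coord = (\<lambda>x. x), model = E, mnorm = norm\<rparr>} \<iota>"
proof -
  let ?c = "\<lparr>cdom = U, coord = (\<lambda>x. x), model = E, mnorm = norm\<rparr>"
  have inv: "chart_inv ?c x = x" if "x \<in> U" for x
  proof -
    have "inj_on (\<lambda>x. x) U" by simp
    from inv_into_f_f[OF this that] show ?thesis by (simp add: chart_inv_def)
  qed
  have op: "open_on E norm U"
    unfolding open_on_def
  proof (intro conjI ballI)
    fix x assume "x \<in> U"
    then have "x \<in> W" unfolding U(3) by simp
    then obtain r where "r > 0" "ball x r \<subseteq> W" using U(2) open_contains_ball by blast
    then show "\<exists>r>0. \<forall>y\<in>E. norm (y - x) < r \<longrightarrow> y \<in> U"
      unfolding U(3) by (intro exI[of _ r]) (auto simp: dist_norm norm_minus_commute)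
  qed (rule U)
  have id: "smooth_map_on E norm E norm U (\<lambda>x. x)"
    by (rule smooth_map_on_linear) (use E U in \<open>auto simp: subspace_0\<close>)
  have "banach_atlas U {?c}"
    unfolding banach_atlas_def using banach_on_norm[OF E] op smooth_map_on_cong[OF id, of "chart_inv ?c"] inv
    by (auto simp: o_def)
  moreover have "smooth_map_on E norm UNIV norm U (\<iota> \<circ> chart_inv ?c)"
    by (rule smooth_map_on_cong[OF smooth]) (simp add: inv)
  moreover have "\<exists>T. has_frechet_derivative_on E norm UNIV norm U (\<iota> \<circ> chart_inv ?c) x T
      \<and> inj_on T E \<and> T ` E = P (\<iota> x)" if "x \<in> U" for x
  proof (intro exI conjI)
    show "has_frechet_derivative_on E norm UNIV norm U (\<iota> \<circ> chart_inv ?c) x (T x)"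
      by (rule has_frechet_derivative_on_restrict[OF T(1)[OF that] _ that]) (simp add: inv)
  qed (use T(2,3)[OF that] in auto)
  ultimately show ?thesis
    unfolding integral_manifold_def using inj by simp
qed

theorem theorem5p1:
  fixes Hp Hm :: "'h::complex_hilbert set"
  assumes "separable_space (euclidean :: 'h topology)"
    and "complex_space.subspace Hp" "closed Hp" "\<not> (\<exists>B. finite B \<and> Hp \<subseteq> complex_space.span B)"
    and "complex_space.subspace Hm" "closed Hm" "\<not> (\<exists>B. finite B \<and> Hm \<subseteq> complex_space.span B)"
    and "\<forall>x\<in>Hp. \<forall>y\<in>Hm. cinner x y = 0"
    and "\<forall>z. \<exists>x\<in>Hp. \<exists>y\<in>Hm. z = x + y"
  shows "integrable_distribution (characteristic_distribution Hp Hm)"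
proof -
  have split: "\<And>x y. x \<in> Hp \<Longrightarrow> y \<in> Hm \<Longrightarrow> cinner x y = 0" "\<And>z. \<exists>x\<in>Hp. \<exists>y\<in>Hm. z = x + y"
    using assms(8,9) by auto
  interpret d: skew_contraction "d_op Hp Hm"
    by (rule skew_contraction_d_op[OF assms(2,5) split])
  show ?thesis unfolding integrable_distribution_def
  proof
    fix p :: "'h u2 \<times> real"
    obtain \<mu> \<gamma> where p: "p = (\<mu>, \<gamma>)" by fastforce
    interpret c: coadjoint "opr \<mu> + \<gamma> *\<^sub>R d.d_endo" "d.ham \<mu> \<gamma>" by (rule d.coadjoint_ham)
    \<comment> \<open>Points and model vectors must belong to the ambient type, hence the second
      component 0.\<close>
    define E where "E = c.slice \<times> {0 :: real}"
    define U where "U = (c.slice \<inter> cay_ball) \<times> {0 :: real}"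
    define \<iota> where "\<iota> q = (\<mu>, \<gamma>) + (c.orbit (fst q), 0)" for q :: "'h u2 \<times> real"
    define T0 where "T0 x V = cayC x (2 *\<^sub>R d.ham \<mu> \<gamma> V + cayN_deriv x V (c.orbit x))" for x V
    have tangent: "inj_on (T0 x) c.slice"
      "T0 x ` c.slice = range (\<lambda>B. d.ham \<mu> \<gamma> B + u2_commutator B (c.orbit x))" if "x \<in> cay_ball" for x
    proof -
      have X: "norm x \<le> 1/20" using that by simp
      have "cayL x (T0 x V) = 2 *\<^sub>R d.ham \<mu> \<gamma> V + u2_commutator V (c.orbit x) + triple V (c.orbit x) x" for V
        by (simp add: T0_def cayL_cayC[OF X] cayN_deriv_def)
      from c.tangent_of_orbit[OF X this]
      show "inj_on (T0 x) c.slice"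
        "T0 x ` c.slice = range (\<lambda>B. d.ham \<mu> \<gamma> B + u2_commutator B (c.orbit x))" by auto
    qed
    have "integral_manifold (characteristic_distribution Hp Hm) U
        {\<lparr>cdom = U, coord = (\<lambda>x. x), model = E, mnorm = norm\<rparr>} \<iota>"
    proof (rule single_chart_integral_manifold[where T = "\<lambda>x v. (T0 (fst x) (fst v), 0)"])
      show "subspace E" unfolding E_def
        by (rule subspace_Times[OF c.subspace_slice]) (simp add: subspace_def)
      show "closed E" unfolding E_def by (intro closed_Times c.closed_slice closed_singleton)
      show "U \<subseteq> E" unfolding U_def E_def by auto
      show "open (cay_ball \<times> (UNIV :: real set))" by (intro open_Times) auto
      show "U = E \<inter> (cay_ball \<times> UNIV)" unfolding U_def E_def by auto
      show "smooth_map_on E norm UNIV norm U \<iota>"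
        unfolding \<iota>_def by (rule smooth_map_on_graph[OF c.orbit_smooth]) (auto simp: E_def U_def)
      show "inj_on \<iota> U"
        using c.inj_on_orbit by (fastforce simp: inj_on_def \<iota>_def U_def)
      fix q assume "q \<in> U"
      then obtain x where q: "q = (x, 0)" "x \<in> c.slice" "x \<in> cay_ball" by (auto simp: U_def)
      have "(c.orbit has_derivative T0 x) (at (fst q))"
        using c.orbit_has_derivative[OF q(3)] by (simp add: q(1) T0_def[abs_def])
      from has_derivative_compose[OF has_derivative_fst[OF has_derivative_ident] this]
      show "(\<iota> has_derivative (\<lambda>v. (T0 (fst q) (fst v), 0))) (at q)"
        unfolding \<iota>_def q(1) fst_conv by (auto intro!: derivative_eq_intros)
      show "inj_on (\<lambda>v. (T0 (fst q) (fst v), 0 :: real)) E"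
        using tangent(1)[OF q(3)] by (auto simp: inj_on_def E_def q(1))
      have "(\<lambda>v. (T0 (fst q) (fst v), 0 :: real)) ` E = (\<lambda>W. (W, 0)) ` (T0 x ` c.slice)"
        by (force simp: E_def q(1))
      also have "\<dots> = characteristic_distribution Hp Hm (\<iota> q)"
        unfolding tangent(2)[OF q(3)]
        by (simp add: \<iota>_def q(1) characteristic_distribution_eq[OF assms(2,5) split] d.ham_add image_image)
      finally show "(\<lambda>v. (T0 (fst q) (fst v), 0)) ` E = characteristic_distribution Hp Hm (\<iota> q)" .
    qed
    moreover have "p \<in> \<iota> ` U"
    proof (rule image_eqI)
      show "(0, 0) \<in> U" using subspace_0[OF c.subspace_slice] by (simp add: U_def)
      show "p = \<iota> (0, 0)"
        by (simp add: \<iota>_def p c.orbit_def linear_0[OF linear_cayC] c.\<delta>.zero)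
    qed
    ultimately show "\<exists>(L :: ('h u2 \<times> real) set)
        (\<A> :: ('h u2 \<times> real, 'h u2 \<times> real) chart set) \<iota>.
        integral_manifold (characteristic_distribution Hp Hm) L \<A> \<iota> \<and> p \<in> \<iota> ` L" by blast
  qed
qed

end
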